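(* Let $r\geq3$ be an integer, let $0<\delta<1$, and let $\varepsilon>0$. Denote $$q=\left\lceil\frac{(1+\varepsilon)(1-\delta)}{\delta}\right\rceil.$$ For all sufficiently large $n$, every $n$-vertex maximal $K_r$-free graph with minimum degree at least $\frac{2r-5}{2r-3}n-n^{1-\delta}$ has chromatic number at most $10^{391}+(r-2)+q$.
   Context: All graphs are finite and simple. A graph is maximal $K_r$-free if it is $K_r$-free and adding any missing edge creates a copy of $K_r$. *)

theory Defs
  imports Complex_Main
begin

definition simple_graph :: "'a set \<Rightarrow> 'a set set \<Rightarrow> bool" where
  "simple_graph V E \<longleftrightarrow> finite V \<and> (\<forall>e\<in>E. e \<subseteq> V \<and> card e = 2)"

definition contains_K :: "nat \<Rightarrow> 'a set \<Rightarrow> 'a set set \<Rightarrow> bool" where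
  "contains_K r V E \<longleftrightarrow>
     (\<exists>K\<subseteq>V. card K = r \<and> (\<forall>u\<in>K. \<forall>v\<in>K. u \<noteq> v \<longrightarrow> {u, v} \<in> E))"

definition K_free :: "nat \<Rightarrow> 'a set \<Rightarrow> 'a set set \<Rightarrow> bool" where
  "K_free r V E \<longleftrightarrow> \<not> contains_K r V E"

definition maximal_K_free :: "nat \<Rightarrow> 'a set \<Rightarrow> 'a set set \<Rightarrow> bool" where
  "maximal_K_free r V E \<longleftrightarrow> K_free r V E \<and>
     (\<forall>u\<in>V. \<forall>v\<in>V. u \<noteq> v \<and> {u, v} \<notin> E \<longrightarrow> contains_K r V (insert {u, v} E))"

definition degree :: "'a set set \<Rightarrow> 'a \<Rightarrow> nat" where
  "degree E v = card {e \<in> E. v \<in> e}"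

text \<open>Only meaningful for nonempty finite \<open>V\<close>: \<open>Min {}\<close> is unspecified.\<close>

definition min_degree :: "'a set \<Rightarrow> 'a set set \<Rightarrow> nat" where
  "min_degree V E = Min (degree E ` V)"

definition proper_colouring :: "'a set \<Rightarrow> 'a set set \<Rightarrow> nat \<Rightarrow> ('a \<Rightarrow> nat) \<Rightarrow> bool" where
  "proper_colouring V E k c \<longleftrightarrow>
     (\<forall>v\<in>V. c v < k) \<and> (\<forall>u\<in>V. \<forall>v\<in>V. {u, v} \<in> E \<longrightarrow> c u \<noteq> c v)"

definition chromatic_number :: "'a set \<Rightarrow> 'a set set \<Rightarrow> nat" where
  "chromatic_number V E = (LEAST k. \<exists>c. proper_colouring V E k c)"

end

theory Submission
  imports Defs "HOL-Analysis.Convex" "HOL-Real_Asymp.Real_Asymp"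
begin

text \<open>
  For triangle-free graphs, vertices with close neighbourhoods get the same colour. If this needs too
  many colours, sampling and the Sauer-Shelah lemma give vertices with \<open>x\<^sub>i\<close> adjacent to \<open>y\<^sub>j\<close> exactly
  for \<open>i \<noteq> j\<close>. Adding a common neighbour \<open>z\<^sub>i\<close> of \<open>x\<^sub>i\<close> and \<open>y\<^sub>i\<close> for \<open>i\<close> in a set of size \<open>k\<close>, no vertex
  sees more than \<open>k\<close> of these \<open>3k\<close> vertices, while the degrees add up to almost \<open>k n\<close>. So almost every
  vertex attains equality and the graph is nearly complete bipartite with parts \<open>P\<close>, \<open>Q\<close> of sizes \<open>2n/3\<close>
  and \<open>n/3\<close>, up to a small set \<open>D\<close>. The same counting bounds the number of colours for the vertices of \<open>D\<close>
  with many neighbours in \<open>D\<close>. For the others, adjacent vertices have nearly complementary neighbourhoods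
  in \<open>P\<close>, hence there are no odd closed walks of length below about \<open>n powr \<delta>\<close>, and the
  Kierstead-Szemeredi-Trotter colouring scheme needs \<open>q + O(1)\<close> colours.

  For \<open>r \<ge> 4\<close> let \<open>X\<close> be a largest common neighbourhood of a clique on \<open>r - 2\<close> vertices. The vertices
  with few neighbours in \<open>X\<close> form an independent set whose removal lowers the clique number, unless
  the graph is, up to errors linear in the degree defect, complete multipartite with \<open>r - 2\<close> parts of size
  \<open>2n/(2r-3)\<close> and one of half that size. In that case the exceptional vertices fall into groups without edges
  between them, each contained in a dense triangle-free graph, so the groups share one palette.
\<close>

section \<open>Set systems\<close>

text \<open>The obstacle is that degree \<open>n/3\<close> is critical. Hajnal's graphs attach a
  Kneser graph to a complete bipartite graph with parts near \<open>2n/3\<close> and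
  \<open>n/3\<close>; they are triangle-free with degree slightly below \<open>n/3\<close> and
  unbounded chromatic number. The set \<open>D\<close> is where such a Kneser graph can sit, so
  counting alone cannot colour it; only its odd cycles can be controlled. The term \<open>q\<close>
  comes from a trade. With \<open>d = n powr (1 - \<delta>)\<close>, a walk in \<open>D\<close>
  takes of order \<open>n / d = n powr \<delta>\<close> steps before its errors matter. The
  colouring scheme with shrinking factor \<open>n powr -a\<close> uses balls of radius about
  \<open>n powr a * ln n\<close>, so it needs \<open>a < \<delta>\<close>, and it runs for more than
  \<open>1 / a\<close> rounds. For larger \<open>r\<close> the critical ratio is the same: with
  \<open>u = n/(2r-3)\<close>, one part of size \<open>2u\<close> together with the part of size
  \<open>u\<close> spans a graph on \<open>3u\<close> vertices in which a vertex misses at most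
  about \<open>2u\<close>, which is again degree one third.\<close>

definition shatters :: "'a set set \<Rightarrow> 'a set \<Rightarrow> bool" where
  "shatters F S \<longleftrightarrow> (\<forall>R\<subseteq>S. \<exists>f\<in>F. f \<inter> S = R)"

lemma shatters_subset:
  assumes "shatters F S" "S' \<subseteq> S"
  shows "shatters F S'"
  unfolding shatters_def
proof (intro allI impI)
  fix R assume "R \<subseteq> S'"
  then obtain f where "f \<in> F" "f \<inter> S = R"
    using assms unfolding shatters_def by (metis subset_trans)
  then show "\<exists>f\<in>F. f \<inter> S' = R" using \<open>R \<subseteq> S'\<close> assms(2) by blast
qed

text \<open>Pajor's form of the Sauer-Shelah lemma, proved by splitting off one point
  \<open>x\<close>: traces that occur both with and without \<open>x\<close> are counted twice, and
  a set shattered by those stays shattered after adding \<open>x\<close>.\<close>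

lemma card_le_shattered:
  assumes "finite T" "F \<subseteq> Pow T"
  shows "card F \<le> card {S. S \<subseteq> T \<and> shatters F S}"
  using assms
proof (induction T arbitrary: F rule: finite_induct)
  case empty
  show ?case
  proof (cases "F = {}")
    case False
    then have "F = {{}}" using empty by auto
    then have "{S. S \<subseteq> {} \<and> shatters F S} = {{}}" by (auto simp: shatters_def)
    then show ?thesis using \<open>F = {{}}\<close> by simp
  qed simp
next
  case (insert x T)
  define F0 where "F0 = (\<lambda>f. f - {x}) ` F"
  define F1 where "F1 = {f\<in>F. x \<notin> f \<and> insert x f \<in> F}"
  have finF: "finite F" using insert.prems insert.hyps(1) by (meson finite_Pow_iff finite_insert rev_finite_subset)
  have F0: "F0 \<subseteq> Pow T" and F1: "F1 \<subseteq> Pow T"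
    using insert.prems unfolding F0_def F1_def by auto
  let ?Fx = "{f\<in>F. x \<in> f}" let ?Fn = "{f\<in>F. x \<notin> f}"
  let ?D = "(\<lambda>f. f - {x}) ` ?Fx"
  have inj: "inj_on (\<lambda>f. f - {x}) ?Fx" by (rule inj_onI) blast
  have "F0 = ?D \<union> (\<lambda>f. f - {x}) ` ?Fn" unfolding F0_def by blast
  also have "(\<lambda>f. f - {x}) ` ?Fn = (\<lambda>f. f) ` ?Fn" by (rule image_cong) auto
  finally have e0: "F0 = ?D \<union> ?Fn" by simp
  have e1: "F1 = ?D \<inter> ?Fn"
  proof (intro set_eqI iffI)
    fix f assume "f \<in> F1"
    then have "f = insert x f - {x}" "insert x f \<in> ?Fx" "f \<in> ?Fn" unfolding F1_def by auto
    then show "f \<in> ?D \<inter> ?Fn" by blast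
  next
    fix f assume "f \<in> ?D \<inter> ?Fn"
    then show "f \<in> F1" unfolding F1_def by (auto simp: insert_absorb)
  qed
  have "card F0 + card F1 = card ?D + card ?Fn"
    unfolding e0 e1 using finF by (intro card_Un_Int[symmetric]) auto
  also have "\<dots> = card ?Fx + card ?Fn" using inj by (simp add: card_image)
  also have "\<dots> = card F"
    using finF by (subst card_Un_disjoint[symmetric]) (auto intro: arg_cong[where f=card])
  finally have cF: "card F = card F0 + card F1" by simp
  let ?S = "\<lambda>U F. {S. S \<subseteq> U \<and> shatters F S}"
  have s0: "?S T F0 \<subseteq> ?S (insert x T) F \<inter> {S. x \<notin> S}"
  proof
    fix S assume S: "S \<in> ?S T F0"
    then have xS: "x \<notin> S" using insert.hyps by auto
    have "shatters F S" unfolding shatters_def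
    proof (intro allI impI)
      fix R assume "R \<subseteq> S"
      then obtain f where "f \<in> F" "(f - {x}) \<inter> S = R" using S unfolding shatters_def F0_def by blast
      then show "\<exists>f\<in>F. f \<inter> S = R" using xS by blast
    qed
    then show "S \<in> ?S (insert x T) F \<inter> {S. x \<notin> S}" using S xS by auto
  qed
  have s1: "insert x ` ?S T F1 \<subseteq> ?S (insert x T) F \<inter> {S. x \<in> S}"
  proof
    fix S' assume "S' \<in> insert x ` ?S T F1"
    then obtain S where S: "S' = insert x S" "S \<subseteq> T" "shatters F1 S" by auto
    have xS: "x \<notin> S" using S insert.hyps by auto
    have "shatters F S'" unfolding shatters_def
    proof (intro allI impI)
      fix R assume R: "R \<subseteq> S'"
      then have "R - {x} \<subseteq> S" using S by auto
      then obtain f where f: "f \<in> F1" "f \<inter> S = R - {x}" using S(3) unfolding shatters_def by blast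
      then have f': "f \<in> F" "x \<notin> f" "insert x f \<in> F" unfolding F1_def by auto
      show "\<exists>f\<in>F. f \<inter> S' = R"
      proof (cases "x \<in> R")
        case True
        then have "insert x f \<inter> S' = R" using f f' S(1) xS by auto
        then show ?thesis using f' by blast
      next
        case False
        then have "f \<inter> S' = R" using f f' S(1) xS by auto
        then show ?thesis using f' by blast
      qed
    qed
    then show "S' \<in> ?S (insert x T) F \<inter> {S. x \<in> S}" using S by auto
  qed
  have fin: "finite (?S (insert x T) F)"
    using insert.hyps(1) by simp
  have "card F \<le> card (?S T F0) + card (?S T F1)"
    using insert.IH[OF F0] insert.IH[OF F1] cF by linarith
  also have "card (?S T F1) = card (insert x ` ?S T F1)"
    using insert.hyps(2) by (intro card_image[symmetric] inj_onI) (metis (no_types, lifting) insert_ident mem_Collect_eq subsetD)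
  also have "card (?S T F0) + card (insert x ` ?S T F1)
      \<le> card (?S (insert x T) F \<inter> {S. x \<notin> S}) + card (?S (insert x T) F \<inter> {S. x \<in> S})"
    using s0 s1 fin by (intro add_mono card_mono) auto
  also have "\<dots> = card (?S (insert x T) F)"
    using fin by (subst card_Un_disjoint[symmetric]) (auto intro: arg_cong[where f=card])
  finally show ?case .
qed

lemma card_small_subsets:
  assumes "finite T" "card T \<le> t" "0 < t" "0 < k"
  shows "card {S. S \<subseteq> T \<and> card S < k} \<le> k * t ^ (k - 1)"
proof -
  have eq: "{S. S \<subseteq> T \<and> card S < k} = (\<Union>i<k. {S. S \<subseteq> T \<and> card S = i})" by auto
  have "card {S. S \<subseteq> T \<and> card S < k} \<le> (\<Sum>i<k. card {S. S \<subseteq> T \<and> card S = i})"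
    unfolding eq by (rule card_UN_le) simp
  also have "\<dots> \<le> (\<Sum>i<k. t ^ (k - 1))"
  proof (rule sum_mono)
    fix i assume "i \<in> {..<k}"
    have "card {S. S \<subseteq> T \<and> card S = i} = card T choose i" using assms(1) by (rule n_subsets)
    also have "\<dots> \<le> t choose i" using assms(2) by (simp add: binomial_right_mono)
    also have "\<dots> \<le> t ^ i"
      by (cases "i \<le> t") (auto simp: binomial_le_pow binomial_eq_0)
    also have "\<dots> \<le> t ^ (k - 1)" using assms \<open>i \<in> {..<k}\<close> by (intro power_increasing) auto
    finally show "card {S. S \<subseteq> T \<and> card S = i} \<le> t ^ (k - 1)" .
  qed
  finally show ?thesis by simp
qed

lemma sauer_shelah:
  assumes "finite T" "card T \<le> t" "0 < t" "0 < k" "F \<subseteq> Pow T" "k * t ^ (k - 1) < card F"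
  obtains S where "S \<subseteq> T" "card S = k" "shatters F S"
proof -
  have "\<exists>S. S \<subseteq> T \<and> shatters F S \<and> k \<le> card S"
  proof (rule ccontr)
    assume "\<not> ?thesis"
    then have "{S. S \<subseteq> T \<and> shatters F S} \<subseteq> {S. S \<subseteq> T \<and> card S < k}" by auto
    then have "card {S. S \<subseteq> T \<and> shatters F S} \<le> card {S. S \<subseteq> T \<and> card S < k}"
      using assms(1) by (intro card_mono) auto
    then show False
      using card_le_shattered[OF assms(1,5)] card_small_subsets[OF assms(1-4)] assms(6) by linarith
  qed
  then obtain S where S: "S \<subseteq> T" "shatters F S" "k \<le> card S" by auto
  obtain S' where "S' \<subseteq> S" "card S' = k" using S(3) obtain_subset_with_card_n by blast
  then show thesis using that[of S'] S shatters_subset by blast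
qed

text \<open>A random list of \<open>t\<close> points separates all pairs by the union bound.\<close>

lemma separating_sample:
  fixes g :: "'b \<Rightarrow> 'a set" and \<rho> :: real
  assumes "finite U" "U \<noteq> {}" "finite Y" "0 \<le> \<rho>" "\<rho> \<le> 1"
    and far: "\<And>y y'. y \<in> Y \<Longrightarrow> y' \<in> Y \<Longrightarrow> y \<noteq> y' \<Longrightarrow>
      \<rho> * card U \<le> card {u\<in>U. (u \<in> g y) \<noteq> (u \<in> g y')}"
    and small: "(real (card Y))\<^sup>2 * (1 - \<rho>) ^ t < 1"
  obtains T where "T \<subseteq> U" "card T \<le> t" "inj_on (\<lambda>y. g y \<inter> T) Y"
proof -
  let ?L = "\<lambda>U. {xs. set xs \<subseteq> U \<and> length xs = t}"
  let ?D = "\<lambda>p. {u\<in>U. (u \<in> g (fst p)) \<noteq> (u \<in> g (snd p))}"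
  let ?Y = "{p\<in>Y \<times> Y. fst p \<noteq> snd p}"
  have "\<exists>xs\<in>?L U. inj_on (\<lambda>y. g y \<inter> set xs) Y"
  proof (rule ccontr)
    assume no: "\<not> ?thesis"
    \<comment> \<open>A list fails for a pair exactly when it avoids the difference set
      \<open>?D p\<close>.\<close>
    have "?L U \<subseteq> (\<Union>p\<in>?Y. ?L (U - ?D p))"
    proof
      fix xs assume xs: "xs \<in> ?L U"
      then have "\<not> inj_on (\<lambda>y. g y \<inter> set xs) Y" using no by blast
      then obtain y y' where "y \<in> Y" "y' \<in> Y" "y \<noteq> y'" "g y \<inter> set xs = g y' \<inter> set xs"
        unfolding inj_on_def by blast
      then have "(y, y') \<in> ?Y" "xs \<in> ?L (U - ?D (y, y'))" using xs by auto
      then show "xs \<in> (\<Union>p\<in>?Y. ?L (U - ?D p))" by blast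
    qed
    then have "card (?L U) \<le> card (\<Union>p\<in>?Y. ?L (U - ?D p))"
      using assms(1,3) by (intro card_mono) (auto simp: finite_lists_length_eq)
    also have "\<dots> \<le> (\<Sum>p\<in>?Y. card (?L (U - ?D p)))" using assms(3) by (intro card_UN_le) auto
    also have "\<dots> = (\<Sum>p\<in>?Y. card (U - ?D p) ^ t)"
      using assms(1) by (intro sum.cong) (auto simp: card_lists_length_eq)
    finally have "real (card U ^ t) \<le> (\<Sum>p\<in>?Y. real (card (U - ?D p)) ^ t)"
      using assms(1) by (simp add: card_lists_length_eq flip: of_nat_power of_nat_sum)
    also have "\<dots> \<le> (\<Sum>p\<in>?Y. ((1 - \<rho>) * card U) ^ t)"
    proof (intro sum_mono power_mono)
      fix p assume p: "p \<in> ?Y"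
      have "card (U - ?D p) + card (?D p) = card U"
        using assms(1) by (metis (no_types, lifting) card_Diff_subset card_mono finite_subset le_add_diff_inverse2 mem_Collect_eq subsetI)
      moreover have "\<rho> * card U \<le> card (?D p)" using far[of "fst p" "snd p"] p by auto
      ultimately show "real (card (U - ?D p)) \<le> (1 - \<rho>) * card U" by (simp add: algebra_simps)
    qed simp
    also have "\<dots> \<le> (real (card Y))\<^sup>2 * ((1 - \<rho>) * card U) ^ t"
    proof -
      have "card ?Y \<le> card (Y \<times> Y)" using assms(3) by (intro card_mono) auto
      then have "real (card ?Y) \<le> (real (card Y))\<^sup>2"
        by (simp add: card_cartesian_product power2_eq_square flip: of_nat_mult)
      then show ?thesis using assms(5) by (simp add: mult_right_mono)
    qed
    also have "\<dots> = ((real (card Y))\<^sup>2 * (1 - \<rho>) ^ t) * real (card U) ^ t"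
      by (simp add: power_mult_distrib)
    also have "\<dots> < 1 * real (card U) ^ t"
      using small assms(1,2) by (intro mult_strict_right_mono) (auto simp: card_gt_0_iff)
    finally show False by simp
  qed
  then obtain xs where "xs \<in> ?L U" "inj_on (\<lambda>y. g y \<inter> set xs) Y" by blast
  then show thesis using that[of "set xs"] card_length[of xs] by auto
qed

section \<open>Graphs as adjacency relations\<close>

text \<open>The relation lives on the whole type and vertex sets are passed as arguments, so induced
  subgraphs need no new relation.\<close>

locale sgraph =
  fixes A :: "'a \<Rightarrow> 'a \<Rightarrow> bool"
  assumes sym: "A u v \<Longrightarrow> A v u" and irr: "\<not> A u u"
begin

definition nb :: "'a set \<Rightarrow> 'a \<Rightarrow> 'a set" where
  "nb W v = {u\<in>W. A v u}"

definition colourable :: "'a set \<Rightarrow> nat \<Rightarrow> bool" where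
  "colourable W k \<longleftrightarrow> (\<exists>c::'a \<Rightarrow> nat. (\<forall>v\<in>W. c v < k) \<and> (\<forall>u\<in>W. \<forall>v\<in>W. A u v \<longrightarrow> c u \<noteq> c v))"

definition indep :: "'a set \<Rightarrow> bool" where
  "indep I \<longleftrightarrow> (\<forall>u\<in>I. \<forall>v\<in>I. \<not> A u v)"

definition clique :: "'a set \<Rightarrow> bool" where
  "clique K \<longleftrightarrow> (\<forall>u\<in>K. \<forall>v\<in>K. u \<noteq> v \<longrightarrow> A u v)"

definition triangle_free :: "'a set \<Rightarrow> bool" where
  "triangle_free W \<longleftrightarrow> (\<forall>u\<in>W. \<forall>v\<in>W. \<forall>w\<in>W. \<not> (A u v \<and> A v w \<and> A u w))"

lemma in_nb [simp]: "u \<in> nb W v \<longleftrightarrow> u \<in> W \<and> A v u"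
  by (simp add: nb_def)

lemma nb_subset: "nb W v \<subseteq> W"
  by (auto simp: nb_def)

lemma finite_nb [simp]: "finite W \<Longrightarrow> finite (nb W v)"
  by (simp add: nb_def)

lemma colourable_mono: "colourable W k \<Longrightarrow> W' \<subseteq> W \<Longrightarrow> k \<le> k' \<Longrightarrow> colourable W' k'"
  unfolding colourable_def by (meson order_less_le_trans subsetD)

lemma colourable_Un:
  assumes "colourable X a" "colourable Y b"
  shows "colourable (X \<union> Y) (a + b)"
proof -
  obtain c where c: "\<forall>v\<in>X. c v < a" "\<forall>u\<in>X. \<forall>v\<in>X. A u v \<longrightarrow> c u \<noteq> c v"
    using assms(1) unfolding colourable_def by blast
  obtain c' where c': "\<forall>v\<in>Y. c' v < b" "\<forall>u\<in>Y. \<forall>v\<in>Y. A u v \<longrightarrow> c' u \<noteq> c' v"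
    using assms(2) unfolding colourable_def by blast
  let ?c = "\<lambda>v. if v \<in> X then c v else a + c' v"
  have 1: "\<forall>v\<in>X \<union> Y. ?c v < a + b" using c(1) c'(1) by (auto simp: trans_less_add1)
  have 2: "?c u \<noteq> ?c v" if uv: "u \<in> X \<union> Y" "v \<in> X \<union> Y" "A u v" for u v
  proof (cases "u \<in> X"; cases "v \<in> X")
    assume "u \<in> X" "v \<notin> X"
    then show ?thesis using c(1) by force
  next
    assume "u \<notin> X" "v \<in> X"
    then show ?thesis using c(1) by force
  qed (use uv c(2) c'(2) in auto)
  show ?thesis unfolding colourable_def
  proof (intro exI conjI ballI impI)
    show "?c v < a + b" if "v \<in> X \<union> Y" for v using 1 that by (rule bspec)
    show "?c u \<noteq> ?c v" if "u \<in> X \<union> Y" "v \<in> X \<union> Y" "A u v" for u v using that by (rule 2)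
  qed
qed

lemma colourable_indep: "indep I \<Longrightarrow> colourable I 1"
  unfolding colourable_def indep_def by (intro exI[of _ "\<lambda>_. 0"]) auto

lemma colourable_UN_indep:
  assumes "finite J" "\<And>j. j \<in> J \<Longrightarrow> indep (C j)"
  shows "colourable (\<Union>j\<in>J. C j) (card J)"
  using assms
proof (induction J rule: finite_induct)
  case empty
  show ?case by (simp add: colourable_def)
next
  case (insert j J)
  have "colourable (C j \<union> (\<Union>j\<in>J. C j)) (1 + card J)"
    by (intro colourable_Un colourable_indep insert) (use insert.prems in auto)
  then show ?case using insert.hyps by simp
qed

lemma clique_subset: "clique K \<Longrightarrow> L \<subseteq> K \<Longrightarrow> clique L"
  unfolding clique_def by blast

lemma clique_insert: "clique K \<Longrightarrow> (\<And>v. v \<in> K \<Longrightarrow> A u v) \<Longrightarrow> clique (insert u K)"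
  unfolding clique_def using sym by auto

lemma card_nonnbs: "finite W \<Longrightarrow> card {u\<in>W. \<not> A v u} + card (nb W v) = card W"
proof -
  assume "finite W"
  then have "card ({u\<in>W. \<not> A v u} \<union> nb W v) = card {u\<in>W. \<not> A v u} + card (nb W v)"
    by (intro card_Un_disjoint) auto
  moreover have "{u\<in>W. \<not> A v u} \<union> nb W v = W" by auto
  ultimately show ?thesis by simp
qed

lemma nb_disjoint:
  assumes "triangle_free W" "u \<in> W" "v \<in> W" "A u v"
  shows "nb W u \<inter> nb W v = {}"
proof (rule ccontr)
  assume "nb W u \<inter> nb W v \<noteq> {}"
  then obtain w where "w \<in> W" "A u w" "A v w" by auto
  then show False using assms unfolding triangle_free_def by blast
qed

lemma sum_card_nb:
  assumes "finite W" "finite I"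
  shows "(\<Sum>i\<in>I. real (card (nb W (f i)))) = (\<Sum>u\<in>W. real (card {i\<in>I. A (f i) u}))"
proof -
  have "(\<Sum>i\<in>I. card (nb W (f i))) = (\<Sum>i\<in>I. \<Sum>u\<in>W. if A (f i) u then 1 else 0)"
    using assms(1) by (simp add: nb_def sum.If_cases Int_def)
  also have "\<dots> = (\<Sum>u\<in>W. \<Sum>i\<in>I. if A (f i) u then 1 else 0)" by (rule sum.swap)
  also have "\<dots> = (\<Sum>u\<in>W. card {i\<in>I. A (f i) u})"
    using assms(2) by (simp add: sum.If_cases Int_def)
  finally show ?thesis by (simp flip: of_nat_sum)
qed

end

lemma card_sym_diff:
  assumes "finite X" "finite Y"
  shows "real (card (X - Y \<union> (Y - X))) = real (card X) + real (card Y) - 2 * real (card (X \<inter> Y))"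
proof -
  have "card (X - Y \<union> (Y - X)) = card (X - Y) + card (Y - X)"
    using assms by (intro card_Un_disjoint) auto
  moreover have "card X = card (X - Y) + card (X \<inter> Y)" "card Y = card (Y - X) + card (X \<inter> Y)"
    using assms by (metis card_Diff_subset_Int card_mono finite_Int inf_le1 le_add_diff_inverse2 Int_commute)+
  ultimately show ?thesis by simp
qed

lemma card_sym_diff_triangle:
  assumes "finite X" "finite Y" "finite Z"
  shows "card (X - Z \<union> (Z - X)) \<le> card (X - Y \<union> (Y - X)) + card (Y - Z \<union> (Z - Y))"
proof -
  have "card (X - Z \<union> (Z - X)) \<le> card ((X - Y \<union> (Y - X)) \<union> (Y - Z \<union> (Z - Y)))"
    using assms by (intro card_mono) auto
  also have "\<dots> \<le> card (X - Y \<union> (Y - X)) + card (Y - Z \<union> (Z - Y))" by (rule card_Un_le)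
  finally show ?thesis .
qed

context sgraph
begin

text \<open>Take a largest family with pairwise distance at least \<open>\<rho>\<close> and send
  each vertex to a nearby member. Adjacent vertices are \<open>2 * \<rho>\<close> apart, so by the
  triangle inequality for symmetric differences each class is independent.\<close>

lemma colourable_or_far_family:
  fixes \<rho> :: real
  assumes "finite W" "\<And>v. v \<in> W \<Longrightarrow> finite (f v)" "0 < \<rho>"
    and adj: "\<And>u v. u \<in> W \<Longrightarrow> v \<in> W \<Longrightarrow> A u v \<Longrightarrow> 2 * \<rho> \<le> card (f u - f v \<union> (f v - f u))"
  obtains "colourable W M"
  | Y where "Y \<subseteq> W" "card Y = M" "\<And>y y'. y \<in> Y \<Longrightarrow> y' \<in> Y \<Longrightarrow> y \<noteq> y' \<Longrightarrow> \<rho> \<le> card (f y - f y' \<union> (f y' - f y))"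
proof -
  let ?\<Delta> = "\<lambda>u v. card (f u - f v \<union> (f v - f u))"
  define far where "far Y \<longleftrightarrow> Y \<subseteq> W \<and> (\<forall>y\<in>Y. \<forall>y'\<in>Y. y \<noteq> y' \<longrightarrow> \<rho> \<le> ?\<Delta> y y')" for Y
  have "far {}" unfolding far_def by simp
  moreover have bound: "card Y \<le> card W" if "far Y" for Y
    using that assms(1) unfolding far_def by (simp add: card_mono)
  ultimately obtain Y where Y: "far Y" "\<And>Y'. far Y' \<Longrightarrow> card Y' \<le> card Y"
    using ex_has_greatest_nat[of far "{}" card "Suc (card W)"] by (auto simp: less_Suc_eq_le)
  have YW: "Y \<subseteq> W" and finY: "finite Y" using Y(1) assms(1) finite_subset unfolding far_def by auto
  show thesis
  proof (cases "M \<le> card Y")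
    case True
    then obtain Y' where "Y' \<subseteq> Y" "card Y' = M" using obtain_subset_with_card_n by blast
    then show thesis using that(2)[of Y'] Y(1) unfolding far_def by blast
  next
    case False
    have near: "\<exists>y\<in>Y. ?\<Delta> v y < \<rho>" if v: "v \<in> W" for v
    proof (cases "v \<in> Y")
      case True
      then show ?thesis using assms(3) by (intro bexI[of _ v]) auto
    next
      case vY: False
      then have "\<not> far (insert v Y)" using Y(2)[of "insert v Y"] finY by auto
      then obtain y y' where "y \<in> insert v Y" "y' \<in> insert v Y" "y \<noteq> y'" "?\<Delta> y y' < \<rho>"
        using v YW unfolding far_def by fastforce
      then show ?thesis using Y(1) unfolding far_def by (metis Un_commute insert_iff not_less)
    qed
    then obtain p where p: "\<And>v. v \<in> W \<Longrightarrow> p v \<in> Y \<and> ?\<Delta> v (p v) < \<rho>" by metis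
    have "indep {v\<in>W. p v = y}" for y
      unfolding indep_def
    proof (intro ballI notI)
      fix u v assume uv: "u \<in> {v\<in>W. p v = y}" "v \<in> {v\<in>W. p v = y}" "A u v"
      then have "?\<Delta> u v \<le> ?\<Delta> u y + ?\<Delta> y v"
        using p[of u] YW by (intro card_sym_diff_triangle assms(2)) auto
      moreover have "?\<Delta> y v = ?\<Delta> v y" by (simp add: Un_commute)
      moreover have "?\<Delta> u y < \<rho>" "?\<Delta> v y < \<rho>" using p[of u] p[of v] uv by auto
      ultimately have "?\<Delta> u v < 2 * \<rho>" by linarith
      then show False using adj[of u v] uv by simp
    qed
    then have "colourable (\<Union>y\<in>Y. {v\<in>W. p v = y}) (card Y)" by (intro colourable_UN_indep finY)
    then have "colourable W M" using False p by (elim colourable_mono) auto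
    then show thesis by (rule that(1))
  qed
qed

end

section \<open>Colouring locally bipartite graphs\<close>

context sgraph
begin

definition expand :: "'a set \<Rightarrow> 'a set \<Rightarrow> 'a set" where
  "expand U I = I \<union> {w\<in>U. \<exists>u\<in>I. A u w}"

lemma expand_mono: "U \<subseteq> W \<Longrightarrow> I \<subseteq> J \<Longrightarrow> expand U I \<subseteq> expand W J"
  unfolding expand_def by blast

lemma expand_pow_mono: "U \<subseteq> W \<Longrightarrow> (expand U ^^ i) I \<subseteq> (expand W ^^ i) I"
  by (induction i) (simp_all add: expand_mono)

lemma expand_pow_incr: "i \<le> j \<Longrightarrow> (expand U ^^ i) I \<subseteq> (expand U ^^ j) I"
proof (induction j)
  case (Suc j)
  then show ?case by (cases "i = Suc j") (auto simp: expand_def)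
qed simp

lemma expand_pow_subset: "I \<subseteq> U \<Longrightarrow> (expand U ^^ i) I \<subseteq> U"
  by (induction i) (auto simp: expand_def)

text \<open>The iterate of \<open>expand W\<close> is the ball of radius \<open>R\<close> in the
  graph induced on \<open>W\<close>. Two-colourability of all these balls excludes odd cycles of
  length up to \<open>2R + 1\<close>.\<close>

definition locally_bipartite :: "nat \<Rightarrow> 'a set \<Rightarrow> bool" where
  "locally_bipartite R W \<longleftrightarrow>
     (\<forall>v\<in>W. \<exists>X Y. indep X \<and> indep Y \<and> (expand W ^^ R) {v} \<subseteq> X \<union> Y)"

text \<open>A ball of slow growth around \<open>v\<close>, enlarged so that its boundary avoids \<open>Z\<close>.\<close>

lemma slow_growth:
  fixes \<eta> :: real
  assumes "finite U" "v \<in> U" "U \<subseteq> Z \<union> S" "indep Z" "0 < \<eta>" "finite S" "card S < (1 + \<eta>) ^ m"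
  obtains I where "v \<in> I" "I \<subseteq> U" "I \<subseteq> (expand U ^^ (2 * m + 1)) {v}"
    "{w\<in>U - I. \<exists>u\<in>I. A u w} \<subseteq> S" "card {w\<in>U - I. \<exists>u\<in>I. A u w} \<le> \<eta> * card (S \<inter> I)"
proof -
  define B where "B i = (expand U ^^ i) {v}" for i
  define g where "g i = real (card (S \<inter> B i))" for i
  \<comment> \<open>Otherwise the intersection with \<open>S\<close> grows by the factor
    \<open>1 + \<eta>\<close> at each of the radii 0, 2, ..., 2m and outgrows \<open>S\<close>. The
    radius moves in steps of two because \<open>I\<close> reaches one step beyond the chosen ball
    and its boundary two.\<close>
  have "\<exists>i\<le>m. g (2 * i + 2) \<le> (1 + \<eta>) * g (2 * i)"
  proof (rule ccontr)
    assume "\<not> ?thesis"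
    then have grow: "(1 + \<eta>) * g (2 * i) < g (2 * i + 2)" if "i \<le> m" for i
      using that by (meson not_le)
    have "(1 + \<eta>) ^ j \<le> g (2 * j + 2)" if "j \<le> m" for j
      using that
    proof (induction j)
      case 0
      \<comment> \<open>\<open>v\<close> may lie outside \<open>S\<close>, so \<open>g 0\<close> may
        be 0; the growth starts from \<open>g 2\<close>, a positive integer.\<close>
      have "0 \<le> (1 + \<eta>) * g 0" unfolding g_def using assms(5) by simp
      then have "0 < g 2" using grow[of 0] by (simp add: numeral_2_eq_2)
      then have "1 \<le> g 2" unfolding g_def by simp
      then show ?case by (simp add: numeral_2_eq_2)
    next
      case (Suc j)
      have "(1 + \<eta>) ^ Suc j \<le> (1 + \<eta>) * g (2 * Suc j)" using Suc assms(5) by simp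
      also have "\<dots> \<le> g (2 * Suc j + 2)" using grow[of "Suc j"] Suc.prems by simp
      finally show ?case .
    qed
    from this[of m] have "(1 + \<eta>) ^ m \<le> g (2 * m + 2)" by simp
    also have "\<dots> \<le> card S" unfolding g_def using assms(6) by (simp add: card_mono)
    finally show False using assms(7) by simp
  qed
  then obtain i where i: "i \<le> m" "g (2 * i + 2) \<le> (1 + \<eta>) * g (2 * i)" by auto
  \<comment> \<open>Absorbing the \<open>Z\<close>-vertices next to the ball keeps \<open>Z\<close>
    out of the boundary, since \<open>Z\<close> is independent. The boundary then consists of new
    vertices of \<open>S\<close> within radius \<open>2 * i + 2\<close>.\<close>
  define I where "I = B (2 * i) \<union> {z\<in>Z \<inter> U. \<exists>u\<in>B (2 * i). A u z}"
  have BU: "B j \<subseteq> U" for j unfolding B_def using assms(2) by (intro expand_pow_subset) auto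
  have B_Suc: "B (Suc j) = expand U (B j)" for j unfolding B_def by simp
  have I1: "I \<subseteq> B (Suc (2 * i))" unfolding I_def B_Suc expand_def by auto
  let ?bd = "{w\<in>U - I. \<exists>u\<in>I. A u w}"
  have bd_B: "?bd \<subseteq> B (2 * i + 2)"
    using I1 by (auto simp: B_Suc[of "Suc (2 * i)", simplified] expand_def)
  have bd_S: "w \<in> S" if w: "w \<in> ?bd" for w
  proof (rule ccontr)
    assume "w \<notin> S"
    then have wZ: "w \<in> Z" "w \<in> U" "w \<notin> I" using w assms(3) by auto
    obtain u where u: "u \<in> I" "A u w" using w by auto
    show False
    proof (cases "u \<in> B (2 * i)")
      case True
      then show False using u wZ unfolding I_def by blast
    next
      case False
      then have "u \<in> Z" using u unfolding I_def by blast
      then show False using u wZ assms(4) unfolding indep_def by blast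
    qed
  qed
  have finB: "finite (B j)" for j using BU assms(1) finite_subset by blast
  have "?bd \<union> (S \<inter> B (2 * i)) \<subseteq> S \<inter> B (2 * i + 2)"
  proof -
    have "B (2 * i) \<subseteq> B (2 * i + 2)" unfolding B_def by (rule expand_pow_incr) simp
    moreover have "?bd \<subseteq> S" using bd_S by (rule subsetI)
    ultimately show ?thesis using bd_B by blast
  qed
  then have "card (?bd \<union> (S \<inter> B (2 * i))) \<le> card (S \<inter> B (2 * i + 2))"
    by (intro card_mono finite_Int disjI2 finB) auto
  moreover have "card (?bd \<union> (S \<inter> B (2 * i))) = card ?bd + card (S \<inter> B (2 * i))"
    using assms(1) finB by (intro card_Un_disjoint) (auto simp: I_def)
  ultimately have "card ?bd + g (2 * i) \<le> g (2 * i + 2)" unfolding g_def by simp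
  also have "\<dots> \<le> (1 + \<eta>) * g (2 * i)" by (rule i)
  finally have "card ?bd \<le> \<eta> * g (2 * i)" by (simp add: algebra_simps)
  also have "\<dots> \<le> \<eta> * card (S \<inter> I)"
    unfolding g_def I_def using assms(5,6) by (intro mult_left_mono) (auto intro!: card_mono)
  finally have c: "card ?bd \<le> \<eta> * card (S \<inter> I)" .
  show thesis
  proof (rule that[of I])
    show "v \<in> I" unfolding I_def B_def
      using expand_pow_incr[of 0 "2 * i" U "{v}"] by auto
    show "I \<subseteq> U" using I1 BU by blast
    show "I \<subseteq> (expand U ^^ (2 * m + 1)) {v}"
      using I1 expand_pow_incr[of "Suc (2 * i)" "2 * m + 1" U "{v}"] i(1) unfolding B_def by auto
    show "?bd \<subseteq> S" using bd_S by blast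
  qed (rule c)
qed

text \<open>Slow balls are cut off one after another, each time moving the boundary into
  \<open>M\<close>. Without the boundaries the balls are mutually nonadjacent, so their
  two-colourings merge; the boundaries are paid for by the disjoint sets
  \<open>S \<inter> I\<close>.\<close>

lemma carve:
  fixes \<eta> :: real
  assumes "finite W" "locally_bipartite (2 * m + 1) W" "indep Z" "0 < \<eta>" "finite S"
    "card S < (1 + \<eta>) ^ m" "U \<subseteq> W" "U \<subseteq> Z \<union> S"
  shows "\<exists>X Y M. X \<union> Y \<union> M = U \<and> indep X \<and> indep Y \<and> M \<subseteq> S \<and> card M \<le> \<eta> * card (S \<inter> U)"
proof -
  have "finite U" using assms(1,7) finite_subset by blast
  then show ?thesis using assms(7,8)
  proof (induction U rule: finite_psubset_induct)
    case (psubset U)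
    show ?case
    proof (cases "U = {}")
      case True
      then show ?thesis by (intro exI[of _ "{}"]) (auto simp: indep_def)
    next
      case False
      then obtain v where v: "v \<in> U" by auto
      obtain I where I: "v \<in> I" "I \<subseteq> U" "I \<subseteq> (expand U ^^ (2 * m + 1)) {v}"
        "{w\<in>U - I. \<exists>u\<in>I. A u w} \<subseteq> S" "card {w\<in>U - I. \<exists>u\<in>I. A u w} \<le> \<eta> * card (S \<inter> I)"
        using slow_growth[OF psubset.hyps v psubset.prems(2) assms(3-6)] by blast
      let ?bd = "{w\<in>U - I. \<exists>u\<in>I. A u w}"
      have "v \<in> W" using v psubset.prems(1) by auto
      then obtain P Q where PQ: "indep P" "indep Q" "(expand W ^^ (2 * m + 1)) {v} \<subseteq> P \<union> Q"
        using assms(2) unfolding locally_bipartite_def by blast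
      have IPQ: "I \<subseteq> P \<union> Q"
        using I(3) PQ(3) expand_pow_mono[OF psubset.prems(1), of "2 * m + 1" "{v}"] by blast
      have "U - I \<subset> U" using I(1) v by auto
      then obtain X Y M where XYM: "X \<union> Y \<union> M = U - I" "indep X" "indep Y" "M \<subseteq> S"
        "card M \<le> \<eta> * card (S \<inter> (U - I))"
        using psubset.IH[of "U - I"] psubset.prems by blast
      have finU: "finite U" by (rule psubset.hyps)
      have ind: "indep ((I \<inter> P') \<union> (X' - ?bd))" if "indep P'" "indep X'" "X' \<subseteq> U - I" for P' X'
        using that sym unfolding indep_def by blast
      show ?thesis
      proof (intro exI conjI)
        show "((I \<inter> P) \<union> (X - ?bd)) \<union> ((I \<inter> Q) \<union> (Y - ?bd)) \<union> (M \<union> ?bd) = U"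
          using IPQ XYM(1) I(2) by blast
        show "indep ((I \<inter> P) \<union> (X - ?bd))" "indep ((I \<inter> Q) \<union> (Y - ?bd))"
          using PQ XYM by (blast intro!: ind)+
        show "M \<union> ?bd \<subseteq> S" using XYM(4) I(4) by blast
        have "card (M \<union> ?bd) \<le> card M + card ?bd" by (rule card_Un_le)
        then have "card (M \<union> ?bd) \<le> \<eta> * card (S \<inter> (U - I)) + \<eta> * card (S \<inter> I)"
          using XYM(5) I(5) by linarith
        also have "\<dots> = \<eta> * card (S \<inter> U)"
        proof -
          have "S \<inter> U = (S \<inter> (U - I)) \<union> (S \<inter> I)" using I(2) by blast
          then have "card (S \<inter> U) = card (S \<inter> (U - I)) + card (S \<inter> I)"
            using assms(5) by (metis (no_types, lifting) card_Un_disjoint finite_Int Diff_disjoint Int_assoc Int_commute Int_left_commute inf_bot_right)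
          then show ?thesis by (simp add: distrib_left)
        qed
        finally show "card (M \<union> ?bd) \<le> \<eta> * card (S \<inter> U)" .
      qed
    qed
  qed
qed

text \<open>Each carving spends one colour and shrinks the part outside the independent set by \<open>\<eta>\<close>;
  this is the colouring scheme of Kierstead, Szemeredi and Trotter.\<close>

lemma colourable_locally_bipartite:
  fixes \<eta> :: real
  assumes "finite W" "locally_bipartite (2 * m + 1) W" "0 < \<eta>"
    "card W < (1 + \<eta>) ^ m" "\<eta> ^ k * card W < 1"
  shows "colourable W (k + 1)"
proof -
  have "colourable (Z \<union> S) (k + 1)" if "indep Z" "Z \<union> S \<subseteq> W" "\<eta> ^ k * card S < 1" for Z S
    using that
  proof (induction k arbitrary: Z S)
    case 0
    then have "finite S" using assms(1) finite_subset by (metis le_sup_iff)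
    then have "S = {}" using 0 by simp
    then show ?case using 0 colourable_indep by simp
  next
    case (Suc k)
    have finS: "finite S" and SW: "card S \<le> card W"
      using Suc.prems(2) assms(1) finite_subset by (auto intro: card_mono)
    obtain X Y M where XYM: "X \<union> Y \<union> M = Z \<union> S" "indep X" "indep Y" "card M \<le> \<eta> * card (S \<inter> (Z \<union> S))"
      using carve[OF assms(1,2) Suc.prems(1) assms(3) finS _ Suc.prems(2) subset_refl] SW assms(4) by force
    have "\<eta> ^ k * card M \<le> \<eta> ^ k * (\<eta> * card S)"
      using XYM(4) assms(3) by (intro mult_left_mono) (auto simp: Int_absorb2)
    also have "\<dots> < 1" using Suc.prems(3) by (simp add: mult_ac)
    \<comment> \<open>\<open>X\<close> takes one colour, \<open>Y\<close> becomes the independent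
      part and the small remainder \<open>M\<close> replaces \<open>S\<close>.\<close>
    finally have "colourable (Y \<union> M) (k + 1)"
      using Suc.IH[of Y M] XYM Suc.prems(2) by blast
    with XYM(2) have "colourable (X \<union> (Y \<union> M)) (1 + (k + 1))"
      by (rule colourable_Un[OF colourable_indep])
    then show ?case using XYM(1) by (simp add: Un_assoc)
  qed
  from this[of "{}" W] show ?thesis using assms by (simp add: indep_def)
qed

end

section \<open>Dense maximal triangle-free graphs\<close>

text \<open>\<open>common\<close> is what maximality means for triangle-free graphs. The constant
  \<open>10 ^ 12\<close> makes fixed multiples of \<open>d\<close> negligible; for instance
  \<open>540000 * d\<close> must stay below \<open>n / 10 ^ 6\<close>.\<close>

locale dense_tf = sgraph A for A :: "'a \<Rightarrow> 'a \<Rightarrow> bool" +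
  fixes V :: "'a set" and d :: real
  assumes finV: "finite V" and V_ne: "V \<noteq> {}" and tf: "triangle_free V"
    and deg: "v \<in> V \<Longrightarrow> card V / 3 - d \<le> card (nb V v)"
    and common: "u \<in> V \<Longrightarrow> v \<in> V \<Longrightarrow> u \<noteq> v \<Longrightarrow> \<not> A u v \<Longrightarrow> \<exists>w\<in>V. A u w \<and> A v w"
    and d_nonneg: "0 \<le> d" and d_small: "10 ^ 12 * d \<le> card V"
begin

abbreviation N where "N \<equiv> nb V"
abbreviation n where "n \<equiv> real (card V)"

lemma n_pos: "0 < n"
  using finV V_ne by (simp add: card_gt_0_iff)

lemma finN [simp]: "finite (N v)"
  using finV by simp

lemma no_triangle: "u \<in> V \<Longrightarrow> v \<in> V \<Longrightarrow> w \<in> V \<Longrightarrow> A u v \<Longrightarrow> A v w \<Longrightarrow> A u w \<Longrightarrow> False"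
  using tf unfolding triangle_free_def by blast

section \<open>Counting edges into indexed triples, and crowns\<close>

definition hits :: "('i \<Rightarrow> 'a) \<Rightarrow> 'i set \<Rightarrow> 'a \<Rightarrow> 'i set" where
  "hits f I u = {i\<in>I. A (f i) u}"

lemma hits_subset: "hits f I u \<subseteq> I"
  unfolding hits_def by auto

lemma finite_hits [simp]: "finite I \<Longrightarrow> finite (hits f I u)"
  unfolding hits_def by simp

text \<open>Indices are counted, not vertices: the three families may overlap and \<open>z\<close>
  need not be injective.\<close>

definition hit_count :: "('i \<Rightarrow> 'a) \<Rightarrow> ('i \<Rightarrow> 'a) \<Rightarrow> ('i \<Rightarrow> 'a) \<Rightarrow> 'i set \<Rightarrow> 'a \<Rightarrow> nat" where
  "hit_count x y z I u = card (hits x I u) + card (hits y I u) + card (hits z I u)"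

lemma sum_hit_count:
  assumes "finite I"
  shows "(\<Sum>u\<in>V. real (hit_count x y z I u))
    = (\<Sum>i\<in>I. real (card (N (x i))) + real (card (N (y i))) + real (card (N (z i))))"
  unfolding hit_count_def hits_def using assms
  by (simp add: sum.distrib sum_card_nb[OF finV])

text \<open>The degrees of one triple add up to at least \<open>n - 3 * d\<close>, while every
  vertex contributes at most \<open>card I\<close> to the total and a deficient one at least one
  less.\<close>

lemma hit_count_deficit:
  assumes "finite I" "x ` I \<subseteq> V" "y ` I \<subseteq> V" "z ` I \<subseteq> V"
    and le: "\<And>u. u \<in> V \<Longrightarrow> hit_count x y z I u \<le> card I"
  shows "card {u\<in>V. hit_count x y z I u < card I} \<le> 3 * card I * d"
proof -
  let ?L = "{u\<in>V. hit_count x y z I u < card I}"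
  have "(\<Sum>i\<in>I. 3 * (n / 3 - d)) \<le> (\<Sum>i\<in>I. real (card (N (x i))) + real (card (N (y i))) + real (card (N (z i))))"
  proof (rule sum_mono)
    fix i assume "i \<in> I"
    then have "x i \<in> V" "y i \<in> V" "z i \<in> V" using assms(2-4) by auto
    then show "3 * (n / 3 - d) \<le> real (card (N (x i))) + real (card (N (y i))) + real (card (N (z i)))"
      using deg[of "x i"] deg[of "y i"] deg[of "z i"] by simp
  qed
  also have "\<dots> = (\<Sum>u\<in>V. real (hit_count x y z I u))" using sum_hit_count[OF assms(1)] by simp
  also have "\<dots> \<le> (\<Sum>u\<in>V. real (card I) - (if u \<in> ?L then 1 else 0))"
  proof (rule sum_mono)
    fix u assume "u \<in> V"
    then show "real (hit_count x y z I u) \<le> real (card I) - (if u \<in> ?L then 1 else 0)"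
      using le[of u] by auto
  qed
  also have "\<dots> = n * card I - card ?L"
    using finV by (simp add: sum_subtractf sum.If_cases Int_def)
  finally show ?thesis by (simp add: algebra_simps)
qed

text \<open>The same double count read for a single triple: the others use at least
  \<open>n - 3 * d\<close> each, which leaves about \<open>n\<close> for triple \<open>i\<close> and
  so little more than \<open>n / 3\<close> for each of its members.\<close>

lemma hit_count_degree:
  assumes "finite I" "x ` I \<subseteq> V" "y ` I \<subseteq> V" "z ` I \<subseteq> V" "i \<in> I"
    and le: "\<And>u. u \<in> V \<Longrightarrow> hit_count x y z I u \<le> card I"
  shows "card (N (x i)) \<le> n / 3 + 3 * card I * d" "card (N (y i)) \<le> n / 3 + 3 * card I * d"
    "card (N (z i)) \<le> n / 3 + 3 * card I * d"
proof -
  let ?f = "\<lambda>i. real (card (N (x i))) + real (card (N (y i))) + real (card (N (z i)))"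
  have V: "x j \<in> V" "y j \<in> V" "z j \<in> V" if "j \<in> I" for j using assms(2-4) that by auto
  have "(\<Sum>j\<in>I. ?f j) = (\<Sum>u\<in>V. real (hit_count x y z I u))" using sum_hit_count[OF assms(1)] by simp
  also have "\<dots> \<le> (\<Sum>u\<in>V. real (card I))" using le by (intro sum_mono) simp
  finally have "(\<Sum>j\<in>I. ?f j) \<le> n * card I" by simp
  moreover have "(\<Sum>j\<in>I. ?f j) = ?f i + (\<Sum>j\<in>I - {i}. ?f j)" using assms(1,5) by (rule sum.remove)
  moreover have "(\<Sum>j\<in>I - {i}. n - 3 * d) \<le> (\<Sum>j\<in>I - {i}. ?f j)"
  proof (rule sum_mono)
    fix j assume "j \<in> I - {i}"
    then show "n - 3 * d \<le> ?f j"
      using deg[of "x j"] deg[of "y j"] deg[of "z j"] V[of j] by auto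
  qed
  moreover have "(\<Sum>j\<in>I - {i}. n - 3 * d) = (real (card I) - 1) * (n - 3 * d)"
    using assms(1,5) card_gt_0_iff[of I] by (auto simp: of_nat_diff)
  ultimately have "?f i \<le> n * card I - (real (card I) - 1) * (n - 3 * d)" by linarith
  also have "\<dots> = n + 3 * card I * d - 3 * d" by (simp add: algebra_simps)
  finally have f: "?f i \<le> n + 3 * card I * d - 3 * d" .
  have dg: "n / 3 - d \<le> card (N (x i))" "n / 3 - d \<le> card (N (y i))" "n / 3 - d \<le> card (N (z i))"
    using deg V[OF assms(5)] by auto
  show "card (N (x i)) \<le> n / 3 + 3 * card I * d" "card (N (y i)) \<le> n / 3 + 3 * card I * d"
    "card (N (z i)) \<le> n / 3 + 3 * card I * d"
    using f dg d_nonneg by linarith+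
qed

text \<open>The pairs \<open>x i\<close>, \<open>y i\<close> are the nonadjacent pairs of a complete bipartite graph minus a
  perfect matching; \<open>z i\<close> is a common neighbour.\<close>

definition crown :: "('i \<Rightarrow> 'a) \<Rightarrow> ('i \<Rightarrow> 'a) \<Rightarrow> ('i \<Rightarrow> 'a) \<Rightarrow> 'i set \<Rightarrow> bool" where
  "crown x y z I \<longleftrightarrow> finite I \<and> x ` I \<subseteq> V \<and> y ` I \<subseteq> V \<and> z ` I \<subseteq> V \<and>
     (\<forall>i\<in>I. A (x i) (z i) \<and> A (y i) (z i)) \<and> (\<forall>i\<in>I. \<forall>j\<in>I. i \<noteq> j \<longrightarrow> A (x i) (y j))"

lemma crown_subset: "crown x y z I \<Longrightarrow> J \<subseteq> I \<Longrightarrow> crown x y z J"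
  unfolding crown_def by (meson finite_subset image_mono subset_trans subsetD)

lemma crown_hits:
  assumes "crown x y z I" "u \<in> V"
  shows "hits x I u \<inter> hits z I u = {}" "hits y I u \<inter> hits z I u = {}"
    "i \<in> hits x I u \<Longrightarrow> j \<in> hits y I u \<Longrightarrow> i = j"
proof -
  have V: "x i \<in> V" "y i \<in> V" "z i \<in> V" if "i \<in> I" for i
    using assms(1) that unfolding crown_def by auto
  have A: "A (x i) (z i)" "A (y i) (z i)" if "i \<in> I" for i
    using assms(1) that unfolding crown_def by simp_all
  have "False" if "i \<in> hits x I u \<inter> hits z I u" for i
    using that no_triangle[of "x i" "z i" u] V[of i] A[of i] assms(2) unfolding hits_def by simp
  then show "hits x I u \<inter> hits z I u = {}" by (rule equals0I)
  have "False" if "i \<in> hits y I u \<inter> hits z I u" for i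
    using that no_triangle[of "y i" "z i" u] V[of i] A[of i] assms(2) unfolding hits_def by simp
  then show "hits y I u \<inter> hits z I u = {}" by (rule equals0I)
  show "i = j" if "i \<in> hits x I u" "j \<in> hits y I u"
  proof (rule ccontr)
    assume "i \<noteq> j"
    then have "A (x i) (y j)" "i \<in> I" "j \<in> I" "A (x i) u" "A (y j) u"
      using assms(1) that unfolding crown_def hits_def by simp_all
    then show False using no_triangle[of "x i" "y j" u] V[of i] V[of j] assms(2) by simp
  qed
qed

text \<open>A vertex that sees \<open>x i\<close> and \<open>y j\<close> with
  \<open>i \<noteq> j\<close> would close a triangle. Only the case \<open>XY\<close> can push the
  count above \<open>card I\<close>: two for the pair and up to \<open>card I - 1\<close> for the
  \<open>z\<close>-vertices. The later arguments turn on bounding this case.\<close>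

lemma crown_hit_cases:
  assumes "crown x y z I" "u \<in> V"
  obtains (X) "hits y I u = {}" "card (hits x I u) + card (hits z I u) = card (hits x I u \<union> hits z I u)"
  | (Y) "hits x I u = {}" "card (hits y I u) + card (hits z I u) = card (hits y I u \<union> hits z I u)"
  | (XY) i where "i \<in> I" "hits x I u = {i}" "hits y I u = {i}" "hits z I u \<subseteq> I - {i}"
proof -
  have fin: "finite I" using assms(1) unfolding crown_def by auto
  note h = crown_hits[OF assms]
  show thesis
  proof (cases "hits y I u = {}")
    case True
    then show thesis using X h(1) fin by (simp add: card_Un_disjoint)
  next
    case yne: False
    show thesis
    proof (cases "hits x I u = {}")
      case True
      then show thesis using Y h(2) fin by (simp add: card_Un_disjoint)
    next
      case False
      then obtain i where i: "i \<in> hits x I u" by auto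
      then have "hits y I u = {i}" using h(3) yne by blast
      moreover from this have "hits x I u = {i}" using h(3) i by blast
      moreover have "i \<in> I" using i unfolding hits_def by simp
      moreover have "i \<notin> hits z I u" using h(1) i by (metis disjoint_iff)
      then have "hits z I u \<subseteq> I - {i}" using hits_subset[of z I u] by (simp add: subset_Diff_insert)
      ultimately show thesis using XY by blast
    qed
  qed
qed

text \<open>The neighbourhoods of \<open>x\<close>, \<open>y\<close>, \<open>z\<close> almost partition \<open>V\<close>.\<close>

definition tight :: "'a \<Rightarrow> 'a \<Rightarrow> 'a \<Rightarrow> bool" where
  "tight x y z \<longleftrightarrow> x \<in> V \<and> y \<in> V \<and> z \<in> V \<and> A x z \<and> A y z \<and>
     card {u\<in>V. \<not> ((A x u \<and> \<not> A y u \<and> \<not> A z u) \<or> (\<not> A x u \<and> A y u \<and> \<not> A z u) \<or> (\<not> A x u \<and> \<not> A y u \<and> A z u))}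
       \<le> 27 * d"

text \<open>The hypothesis \<open>few\<close> keeps the case \<open>XY\<close> below
  \<open>card I\<close>. A vertex of full count then uses every index exactly once, in particular
  \<open>i\<close>, and the deficient vertices number at most \<open>3 * 9 * d\<close>, the
  \<open>27 * d\<close> of \<open>tight\<close>.\<close>

lemma tight_if_few_hits:
  assumes cr: "crown x y z I" and "card I \<le> 9" "i \<in> I"
    and few: "\<And>j u. j \<in> I \<Longrightarrow> u \<in> V \<Longrightarrow> A (x j) u \<Longrightarrow> A (y j) u \<Longrightarrow> card (hits z (I - {j}) u) + 3 \<le> card I"
  shows "tight (x i) (y i) (z i)"
proof -
  have fin: "finite I" and im: "x ` I \<subseteq> V" "y ` I \<subseteq> V" "z ` I \<subseteq> V"
    using cr unfolding crown_def by auto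
  have zI: "hits z I u \<subseteq> I - {j} \<Longrightarrow> hits z I u \<subseteq> hits z (I - {j}) u" for u j
    unfolding hits_def by auto
  let ?ok = "\<lambda>u. (A (x i) u \<and> \<not> A (y i) u \<and> \<not> A (z i) u) \<or> (\<not> A (x i) u \<and> A (y i) u \<and> \<not> A (z i) u)
    \<or> (\<not> A (x i) u \<and> \<not> A (y i) u \<and> A (z i) u)"
  have main: "hit_count x y z I u \<le> card I \<and> (hit_count x y z I u = card I \<longrightarrow> ?ok u)" if u: "u \<in> V" for u
    using cr u
  proof (cases rule: crown_hit_cases)
    case X
    have sub: "hits x I u \<union> hits z I u \<subseteq> I" by (simp add: hits_subset)
    have c: "hit_count x y z I u = card (hits x I u \<union> hits z I u)" unfolding hit_count_def using X by simp
    have "?ok u" if "hit_count x y z I u = card I"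
    proof -
      have "hits x I u \<union> hits z I u = I" using card_subset_eq[OF fin sub] that c by simp
      then have "i \<in> hits x I u \<or> i \<in> hits z I u" "i \<notin> hits y I u" using assms(3) X by auto
      then show ?thesis using crown_hits(1)[OF cr u] assms(3) unfolding hits_def by blast
    qed
    then show ?thesis using c card_mono[OF fin sub] by simp
  next
    case Y
    have sub: "hits y I u \<union> hits z I u \<subseteq> I" by (simp add: hits_subset)
    have c: "hit_count x y z I u = card (hits y I u \<union> hits z I u)" unfolding hit_count_def using Y by simp
    have "?ok u" if "hit_count x y z I u = card I"
    proof -
      have "hits y I u \<union> hits z I u = I" using card_subset_eq[OF fin sub] that c by simp
      then have "i \<in> hits y I u \<or> i \<in> hits z I u" "i \<notin> hits x I u" using assms(3) Y by auto
      then show ?thesis using crown_hits(2)[OF cr u] assms(3) unfolding hits_def by blast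
    qed
    then show ?thesis using c card_mono[OF fin sub] by simp
  next
    case (XY j)
    have "A (x j) u" "A (y j) u" using XY unfolding hits_def by auto
    then have "card (hits z (I - {j}) u) + 3 \<le> card I" using few XY(1) u by blast
    moreover have "card (hits z I u) \<le> card (hits z (I - {j}) u)"
      using zI[OF XY(4)] fin by (intro card_mono) auto
    ultimately have "hit_count x y z I u < card I" unfolding hit_count_def using XY by simp
    then show ?thesis by simp
  qed
  have "{u\<in>V. \<not> ?ok u} \<subseteq> {u\<in>V. hit_count x y z I u < card I}"
  proof
    fix u assume "u \<in> {u\<in>V. \<not> ?ok u}"
    then have u: "u \<in> V" "\<not> ?ok u" by blast+
    have "hit_count x y z I u \<noteq> card I" using main[OF u(1)] u(2) by argo
    then show "u \<in> {u\<in>V. hit_count x y z I u < card I}"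
      using main[OF u(1), THEN conjunct1] u(1) by simp
  qed
  then have "card {u\<in>V. \<not> ?ok u} \<le> card {u\<in>V. hit_count x y z I u < card I}"
    using finV by (intro card_mono) simp_all
  also have "\<dots> \<le> 3 * card I * d"
    by (rule hit_count_deficit[OF fin im]) (rule main[THEN conjunct1])
  also have "\<dots> \<le> 27 * d" using assms(2) d_nonneg by (intro mult_right_mono) auto
  finally show ?thesis
    using cr assms(3) unfolding tight_def crown_def by auto
qed

text \<open>No vertex sees some \<open>z i\<close> from both halves, so a vertex with the full count sees all \<open>y i\<close> of one
  half or none at all; then two far-apart neighbourhoods \<open>N (y i)\<close> have too small a union.\<close>

lemma no_split_crown:
  assumes cr: "crown x y z (H \<union> H')" and "H \<inter> H' = {}" "card H = 3" "card H' = 3"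
    and zz: "\<And>i j. i \<in> H \<Longrightarrow> j \<in> H' \<Longrightarrow> A (z i) (z j)"
    and far: "\<And>i j. i \<in> H \<union> H' \<Longrightarrow> j \<in> H \<union> H' \<Longrightarrow> i \<noteq> j \<Longrightarrow>
      (1/3 - 1/10^4) * n \<le> card (N (y i) - N (y j) \<union> (N (y j) - N (y i)))"
  shows False
proof -
  let ?I = "H \<union> H'"
  have fin: "finite ?I" and im: "x ` ?I \<subseteq> V" "y ` ?I \<subseteq> V" "z ` ?I \<subseteq> V"
    using cr unfolding crown_def by auto
  have cI: "card ?I = 6" using fin assms(2-4) by (simp add: card_Un_disjoint)
  have half: "hits z ?I u \<subseteq> H \<or> hits z ?I u \<subseteq> H'" if u: "u \<in> V" for u
  proof (rule ccontr)
    assume "\<not> ?thesis"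
    then obtain i j where "i \<in> H" "j \<in> H'" "A (z i) u" "A (z j) u"
      unfolding hits_def by blast
    then show False using no_triangle[of "z i" "z j" u] zz im u by blast
  qed
  have cz: "card (hits z ?I u) \<le> 3" if "u \<in> V" for u
    using half[OF that] card_mono[of H "hits z ?I u"] card_mono[of H' "hits z ?I u"] fin assms(3,4) by auto
  have main: "hit_count x y z ?I u \<le> card ?I \<and> (hit_count x y z ?I u = card ?I \<longrightarrow>
      hits y ?I u = {} \<or> H \<subseteq> hits y ?I u \<or> H' \<subseteq> hits y ?I u)" if u: "u \<in> V" for u
    using cr u
  proof (cases rule: crown_hit_cases)
    case X
    have "hits x ?I u \<union> hits z ?I u \<subseteq> ?I" by (simp add: hits_subset)
    then show ?thesis using X card_mono[OF fin, of "hits x ?I u \<union> hits z ?I u"]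
      unfolding hit_count_def by auto
  next
    case Y
    have sub: "hits y ?I u \<union> hits z ?I u \<subseteq> ?I" by (simp add: hits_subset)
    have c: "hit_count x y z ?I u = card (hits y ?I u \<union> hits z ?I u)" unfolding hit_count_def using Y by simp
    have "H \<subseteq> hits y ?I u \<or> H' \<subseteq> hits y ?I u" if "hit_count x y z ?I u = card ?I"
    proof -
      have "hits y ?I u \<union> hits z ?I u = ?I" using card_subset_eq[OF fin sub] that c by simp
      then show ?thesis using half[OF u] assms(2) by blast
    qed
    then show ?thesis using c card_mono[OF fin sub] by simp
  next
    \<comment> \<open>The \<open>z\<close>-hits lie in one half of size 3, so the count is at most
      \<open>1 + 1 + 3 < 6\<close>.\<close>
    case (XY j)
    then show ?thesis using cz[OF u] cI unfolding hit_count_def by simp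
  qed
  obtain p q where pq: "p \<in> H" "q \<in> H" "p \<noteq> q"
    using assms(3) card_le_Suc0_iff_eq[of H] fin by (auto simp: numeral_3_eq_3)
  obtain r s where rs: "r \<in> H'" "s \<in> H'" "r \<noteq> s"
    using assms(4) card_le_Suc0_iff_eq[of H'] fin by (auto simp: numeral_3_eq_3)
  let ?L = "{u\<in>V. hit_count x y z ?I u < card ?I}"
  have le: "hit_count x y z ?I u \<le> card ?I" if "u \<in> V" for u using main[OF that] by (rule conjunct1)
  have L: "card ?L \<le> 18 * d" using hit_count_deficit[OF fin im le] cI by simp
  have up: "card (N (y i)) \<le> n / 3 + 18 * d" if "i \<in> ?I" for i
    using hit_count_degree(2)[OF fin im that le] cI by simp
  have lo: "n / 3 - d \<le> card (N (y i))" if "i \<in> ?I" for i using deg im(2) that by auto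
  have inter: "card (N (y i) \<inter> N (y j)) \<le> n / 6 + n / (2 * 10^4) + 18 * d" if "i \<in> ?I" "j \<in> ?I" "i \<noteq> j" for i j
    using card_sym_diff[of "N (y i)" "N (y j)"] far[OF that] up[OF that(1)] up[OF that(2)] by (simp add: field_simps)
  have sub: "N (y p) \<union> N (y q) \<subseteq> (N (y p) \<inter> N (y q)) \<union> (N (y r) \<inter> N (y s)) \<union> ?L"
  proof
    fix u assume u: "u \<in> N (y p) \<union> N (y q)"
    then have uV: "u \<in> V" by auto
    have "hits y ?I u \<noteq> {}" using u pq unfolding hits_def by auto
    then have "u \<in> ?L \<or> H \<subseteq> hits y ?I u \<or> H' \<subseteq> hits y ?I u"
      using main[OF uV] uV le_less by blast
    then show "u \<in> (N (y p) \<inter> N (y q)) \<union> (N (y r) \<inter> N (y s)) \<union> ?L"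
      using pq rs uV unfolding hits_def by auto
  qed
  have "card (N (y p) \<union> N (y q)) \<le> card ((N (y p) \<inter> N (y q)) \<union> (N (y r) \<inter> N (y s)) \<union> ?L)"
    using sub finV by (intro card_mono) auto
  also have "\<dots> \<le> card (N (y p) \<inter> N (y q)) + card (N (y r) \<inter> N (y s)) + card ?L"
    by (meson add_mono card_Un_le order_refl order_trans)
  finally have "real (card (N (y p) \<union> N (y q))) \<le> card (N (y p) \<inter> N (y q)) + card (N (y r) \<inter> N (y s)) + card ?L"
    by linarith
  moreover have "card (N (y p) \<union> N (y q)) + card (N (y p) \<inter> N (y q)) = card (N (y p)) + card (N (y q))"
    using card_Un_Int[of "N (y p)" "N (y q)"] by simp
  \<comment> \<open>Moving the intersection to the right gives about \<open>2n/3\<close> on the left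
    against three intersections of size about \<open>n/6\<close> on the right.\<close>
  ultimately have "2 * (n / 3 - d) \<le> 3 * (n / 6 + n / (2 * 10^4) + 18 * d) + 18 * d"
    using inter[of p q] inter[of r s] lo[of p] lo[of q] pq rs L by auto
  then show False using d_small n_pos by simp
qed

text \<open>If some vertex sees \<open>x i\<close>, \<open>y i\<close> and almost all other \<open>z j\<close>, it may replace \<open>z i\<close>; three such
  replacements produce a split crown.\<close>

lemma crown_tight:
  assumes cr: "crown x y z I" and "card I = 9"
    and far: "\<And>i j. i \<in> I \<Longrightarrow> j \<in> I \<Longrightarrow> i \<noteq> j \<Longrightarrow>
      (1/3 - 1/10^4) * n \<le> card (N (y i) - N (y j) \<union> (N (y j) - N (y i)))"
  obtains i where "i \<in> I" "tight (x i) (y i) (z i)"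
proof -
  \<comment> \<open>This is the failure of \<open>few\<close> at index \<open>i\<close>:
    \<open>v\<close> can take the place of \<open>z i\<close>, and \<open>J'\<close> consists of all
    but one of the other indices, with \<open>v\<close> adjacent to each \<open>z j\<close>.\<close>
  define bad where "bad J i v J' \<longleftrightarrow> i \<in> J \<and> v \<in> V \<and> A (x i) v \<and> A (y i) v \<and> J' \<subseteq> J - {i} \<and>
      card J' + 2 = card J \<and> (\<forall>j\<in>J'. A (z j) v)" for J i v J'
  have step: "\<exists>i v J'. bad J i v J'" if nt: "\<not> (\<exists>i\<in>I. tight (x i) (y i) (z i))" and JI: "J \<subseteq> I" and J2: "2 \<le> card J" for J
  proof (rule ccontr)
    assume nb: "\<not> ?thesis"
    have crJ: "crown x y z J" using crown_subset[OF cr JI] .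
    then have finJ: "finite J" unfolding crown_def by auto
    have cJ: "card J \<le> 9" using JI assms(2) cr unfolding crown_def by (metis card_mono)
    obtain i where "i \<in> J" using J2 by fastforce
    moreover have "card (hits z (J - {j}) u) + 3 \<le> card J"
      if j: "j \<in> J" "u \<in> V" "A (x j) u" "A (y j) u" for j u
    proof (rule ccontr)
      assume "\<not> ?thesis"
      then have "card J - 2 \<le> card (hits z (J - {j}) u)" by simp
      then obtain J' where "J' \<subseteq> hits z (J - {j}) u" "card J' = card J - 2"
        by (rule obtain_subset_with_card_n)
      then have "bad J j u J'" using j J2 unfolding bad_def hits_def by (simp add: subset_iff)
      then show False using nb by simp
    qed
    ultimately have "tight (x i) (y i) (z i)" by (rule tight_if_few_hits[OF crJ cJ])
    then show False using nt JI \<open>i \<in> J\<close> by blast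
  qed
  show thesis
  proof (rule ccontr)
    assume "\<not> thesis"
    then have nt: "\<not> (\<exists>i\<in>I. tight (x i) (y i) (z i))" using that by blast
    \<comment> \<open>Each replacement uses up two indices, so 9 shrinks to 7, 5 and 3. Three
      replaced indices and three survivors remain, and the \<open>z\<close>-vertices of the
      survivors are adjacent to all replacements.\<close>
    obtain i1 v1 J1 where b1: "bad I i1 v1 J1" using step[OF nt, of I] assms(2) by auto
    then have J1: "J1 \<subseteq> I" "card J1 = 7" unfolding bad_def using assms(2) by auto
    obtain i2 v2 J2 where b2: "bad J1 i2 v2 J2" using step[OF nt J1(1)] J1(2) by auto
    then have J2: "J2 \<subseteq> J1" "card J2 = 5" unfolding bad_def using J1(2) by auto
    obtain i3 v3 J3 where b3: "bad J2 i3 v3 J3" using step[OF nt subset_trans[OF J2(1) J1(1)]] J2(2) by auto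
    then have J3: "J3 \<subseteq> J2" "card J3 = 3" unfolding bad_def using J2(2) by auto
    have i: "i1 \<in> I" "i2 \<in> J1" "i3 \<in> J2" "i1 \<notin> J1" "i2 \<notin> J2" "i3 \<notin> J3"
      using b1 b2 b3 unfolding bad_def by auto
    then have ne: "i1 \<noteq> i2" "i1 \<noteq> i3" "i2 \<noteq> i3" using J1 J2 by auto
    have nJ3: "i1 \<notin> J3" "i2 \<notin> J3" using i J2 J3 by auto
    let ?H = "{i1, i2, i3}"
    define z' where "z' = z(i1 := v1, i2 := v2, i3 := v3)"
    have z'J: "z' j = z j" if "j \<in> J3" for j using that nJ3 i unfolding z'_def by auto
    have z'H: "z' i1 = v1" "z' i2 = v2" "z' i3 = v3" using ne unfolding z'_def by auto
    have sub: "?H \<union> J3 \<subseteq> I" using i J1 J2 J3 by auto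
    have "crown x y z (?H \<union> J3)" using crown_subset[OF cr sub] .
    then have cr': "crown x y z' (?H \<union> J3)"
      using b1 b2 b3 z'J z'H unfolding crown_def bad_def by auto
    have zz: "A (z' i) (z' j)" if "i \<in> ?H" "j \<in> J3" for i j
    proof -
      have "A (z j) v1" "A (z j) v2" "A (z j) v3"
        using that(2) b1 b2 b3 J2 J3 unfolding bad_def by auto
      then show ?thesis using that z'J[OF that(2)] z'H sym by auto
    qed
    have H: "?H \<inter> J3 = {}" "card ?H = 3" using ne nJ3 i(6) by auto
    show False
      by (rule no_split_crown[OF cr' H J3(2) zz far]) (use sub in blast)+
  qed
qed

end

text \<open>Cauchy-Schwarz for the number of sets \<open>G y\<close> containing a point of \<open>R - K\<close>.\<close>

lemma common_part_bound:
  fixes \<alpha> \<beta> :: real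
  assumes "finite R" "finite Y" "2 \<le> card Y"
    and G: "\<And>y. y \<in> Y \<Longrightarrow> G y \<subseteq> R \<and> K \<subseteq> G y \<and> \<alpha> \<le> card (G y)"
    and int: "\<And>y y'. y \<in> Y \<Longrightarrow> y' \<in> Y \<Longrightarrow> y \<noteq> y' \<Longrightarrow> card (G y \<inter> G y') \<le> \<beta>"
    and "card K \<le> \<alpha>"
  shows "(\<alpha> - card K)\<^sup>2 \<le> (real (card R) - card K) * (card R / card Y + \<beta> - card K)"
proof -
  define m where "m = real (card Y)"
  define k where "k = real (card K)"
  define h where "h v = real (card {y\<in>Y. v \<in> G y})" for v
  have m: "2 \<le> m" unfolding m_def using assms(3) by simp
  have "Y \<noteq> {}" using assms(3) by auto
  then obtain y0 where y0: "y0 \<in> Y" by auto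
  have KR: "K \<subseteq> R" using G[OF y0] by blast
  have finK: "finite K" using KR assms(1) finite_subset by blast
  have finG: "finite (G y)" if "y \<in> Y" for y using G[OF that] assms(1) finite_subset by blast
  have "Y - {y0} \<noteq> {}"
    using assms(2,3) y0 by (metis card_Diff_singleton card.empty diff_is_0_eq not_less_eq_eq numeral_2_eq_2 One_nat_def)
  then obtain y1 where y1: "y1 \<in> Y" "y1 \<noteq> y0" by auto
  have "card K \<le> card (G y0 \<inter> G y1)" using G[OF y0] G[OF y1(1)] finG[OF y0] by (intro card_mono) auto
  then have k\<beta>: "k \<le> \<beta>" using int[OF y0 y1(1)] y1(2) unfolding k_def by auto
  have h1: "(\<Sum>v\<in>R - K. h v) = (\<Sum>y\<in>Y. real (card (G y - K)))"
  proof -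
    have "(\<Sum>v\<in>R - K. h v) = (\<Sum>v\<in>R - K. \<Sum>y\<in>Y. if v \<in> G y then 1 else 0)"
      unfolding h_def using assms(2) by (simp add: sum.If_cases Int_def)
    also have "\<dots> = (\<Sum>y\<in>Y. \<Sum>v\<in>R - K. if v \<in> G y then 1 else 0)" by (rule sum.swap)
    also have "\<dots> = (\<Sum>y\<in>Y. real (card (G y - K)))"
    proof (rule sum.cong[OF refl])
      fix y assume "y \<in> Y"
      then have "(R - K) \<inter> {v. v \<in> G y} = G y - K" using G by blast
      then show "(\<Sum>v\<in>R - K. if v \<in> G y then 1 else 0) = real (card (G y - K))"
        using assms(1) by (simp add: sum.If_cases)
    qed
    finally show ?thesis .
  qed
  have h2: "(\<Sum>v\<in>R - K. (h v)\<^sup>2) = (\<Sum>y\<in>Y. \<Sum>y'\<in>Y. real (card (G y \<inter> G y' - K)))"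
  proof -
    have "(h v)\<^sup>2 = (\<Sum>y\<in>Y. \<Sum>y'\<in>Y. if v \<in> G y \<inter> G y' then 1 else 0)" for v
    proof -
      have "h v = (\<Sum>y\<in>Y. if v \<in> G y then 1 else 0)"
        unfolding h_def using assms(2) by (simp add: sum.If_cases Int_def)
      then have "(h v)\<^sup>2 = (\<Sum>y\<in>Y. \<Sum>y'\<in>Y. (if v \<in> G y then 1 else 0) * (if v \<in> G y' then 1 else 0))"
        by (simp add: power2_eq_square sum_product)
      also have "\<dots> = (\<Sum>y\<in>Y. \<Sum>y'\<in>Y. if v \<in> G y \<inter> G y' then 1 else 0)"
        by (intro sum.cong refl) auto
      finally show ?thesis .
    qed
    then have "(\<Sum>v\<in>R - K. (h v)\<^sup>2) = (\<Sum>v\<in>R - K. \<Sum>y\<in>Y. \<Sum>y'\<in>Y. if v \<in> G y \<inter> G y' then 1 else 0)" by simp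
    also have "\<dots> = (\<Sum>y\<in>Y. \<Sum>v\<in>R - K. \<Sum>y'\<in>Y. if v \<in> G y \<inter> G y' then 1 else 0)" by (rule sum.swap)
    also have "\<dots> = (\<Sum>y\<in>Y. \<Sum>y'\<in>Y. \<Sum>v\<in>R - K. if v \<in> G y \<inter> G y' then 1 else 0)"
      by (intro sum.cong refl sum.swap)
    also have "\<dots> = (\<Sum>y\<in>Y. \<Sum>y'\<in>Y. real (card (G y \<inter> G y' - K)))"
    proof (intro sum.cong refl)
      fix y y' assume "y \<in> Y" "y' \<in> Y"
      then have "(R - K) \<inter> {v. v \<in> G y \<inter> G y'} = G y \<inter> G y' - K" using G by blast
      then show "(\<Sum>v\<in>R - K. if v \<in> G y \<inter> G y' then 1 else 0) = real (card (G y \<inter> G y' - K))"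
        using assms(1) by (simp add: sum.If_cases)
    qed
    finally show ?thesis .
  qed
  have lower: "m * (\<alpha> - k) \<le> (\<Sum>v\<in>R - K. h v)"
  proof -
    have "(\<Sum>y\<in>Y. \<alpha> - k) \<le> (\<Sum>y\<in>Y. real (card (G y - K)))"
    proof (rule sum_mono)
      fix y assume y: "y \<in> Y"
      have "card (G y - K) = card (G y) - card K" using G[OF y] finK by (intro card_Diff_subset) auto
      moreover have "card K \<le> card (G y)" using G[OF y] finG[OF y] by (intro card_mono) auto
      ultimately show "\<alpha> - k \<le> real (card (G y - K))" using G[OF y] unfolding k_def by simp
    qed
    then show ?thesis using h1 unfolding m_def by simp
  qed
  \<comment> \<open>\<open>K\<close> lies in every \<open>G y\<close>, so it is removed from all
    sets before Cauchy-Schwarz is applied. Of the ordered pairs, the \<open>m\<close> equal ones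
    cost at most \<open>card R\<close> each and the others at most
    \<open>\<beta> - k\<close>.\<close>
  have upper: "(\<Sum>v\<in>R - K. (h v)\<^sup>2) \<le> m * (card R + m * (\<beta> - k))"
  proof -
    have "(\<Sum>y'\<in>Y. real (card (G y \<inter> G y' - K))) \<le> card R + m * (\<beta> - k)" if y: "y \<in> Y" for y
    proof -
      have "(\<Sum>y'\<in>Y. real (card (G y \<inter> G y' - K)))
          = real (card (G y \<inter> G y - K)) + (\<Sum>y'\<in>Y - {y}. real (card (G y \<inter> G y' - K)))"
        using assms(2) y by (rule sum.remove)
      also have "\<dots> \<le> real (card R) + (\<Sum>y'\<in>Y - {y}. \<beta> - k)"
      proof (intro add_mono sum_mono)
        show "real (card (G y \<inter> G y - K)) \<le> real (card R)"
          using G[OF y] assms(1) by (auto intro: card_mono)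
        fix y' assume y': "y' \<in> Y - {y}"
        have sub: "K \<subseteq> G y \<inter> G y'" using G[OF y] G[of y'] y' by blast
        have "card (G y \<inter> G y' - K) = card (G y \<inter> G y') - card K"
          using sub finK by (intro card_Diff_subset)
        moreover have "card K \<le> card (G y \<inter> G y')" using sub finG[OF y] by (intro card_mono) auto
        ultimately show "real (card (G y \<inter> G y' - K)) \<le> \<beta> - k"
          using int[of y y'] y y' unfolding k_def by auto
      qed
      also have "\<dots> \<le> real (card R) + m * (\<beta> - k)"
      proof -
        have "real (card (Y - {y})) * (\<beta> - k) \<le> m * (\<beta> - k)"
          using k\<beta> assms(2) unfolding m_def by (intro mult_right_mono) (auto intro: card_mono)
        then show ?thesis by simp
      qed
      finally show ?thesis .
    qed
    then have "(\<Sum>v\<in>R - K. (h v)\<^sup>2) \<le> (\<Sum>y\<in>Y. card R + m * (\<beta> - k))"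
      unfolding h2 by (intro sum_mono)
    then show ?thesis unfolding m_def by simp
  qed
  have cRK: "real (card (R - K)) = card R - k"
    using KR assms(1) finK card_mono[OF assms(1) KR] unfolding k_def by (simp add: card_Diff_subset)
  have "(m * (\<alpha> - k))\<^sup>2 \<le> (\<Sum>v\<in>R - K. h v)\<^sup>2"
    using lower assms(6) m unfolding k_def by (intro power_mono) auto
  also have "\<dots> \<le> (\<Sum>v\<in>R - K. (h v)\<^sup>2) * card (R - K)" by (rule sum_squared_le_sum_of_squares)
  also have "\<dots> \<le> (m * (card R + m * (\<beta> - k))) * card (R - K)" using upper by (intro mult_right_mono) auto
  also have "\<dots> = m\<^sup>2 * ((card R - k) * (card R / m + \<beta> - k))"
    unfolding cRK using m by (simp add: field_simps power2_eq_square)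
  finally have "m\<^sup>2 * (\<alpha> - k)\<^sup>2 \<le> m\<^sup>2 * ((card R - k) * (card R / m + \<beta> - k))"
    by (simp add: power_mult_distrib)
  then show ?thesis using m unfolding k_def m_def by (simp add: zero_less_mult_iff)
qed

text \<open>Without error terms and with \<open>b = n/6 - k\<close>, the hypothesis
  \<open>main\<close> reads \<open>(n/6 + b)^2 \<le> (n/2 + b) * b\<close>. The squares of
  \<open>b\<close> cancel and \<open>b \<ge> n/6\<close> remains, which forces \<open>k\<close> to
  be near 0.\<close>

lemma common_part_small:
  fixes n k r \<beta> :: real
  assumes "0 < n" "k \<le> \<beta>" "\<beta> \<le> n / 6 + n / 20000 + n / 10^9" "r \<le> 2 * n / 3 + n / 10^9" "k \<le> r"
    and main: "(n / 3 - n / 10^9 - k)\<^sup>2 \<le> (r - k) * (r / 10^4 + \<beta> - k)"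
  shows "k \<le> n / 1000"
proof (rule ccontr)
  assume "\<not> ?thesis"
  define b where "b = n / 6 - k"
  have b: "b \<le> n / 6 - n / 1000" "- n / 10^4 \<le> b"
    using \<open>\<not> k \<le> n / 1000\<close> assms(1-3) unfolding b_def by simp_all
  have "(r - k) * (r / 10^4 + \<beta> - k) \<le> (n / 2 + b + n / 10^9) * (b + 12 * n / 10^5)"
  proof (rule mult_mono)
    show "r - k \<le> n / 2 + b + n / 10^9" "r / 10^4 + \<beta> - k \<le> b + 12 * n / 10^5"
      using assms(1-5) unfolding b_def by simp_all
    show "0 \<le> n / 2 + b + n / 10^9" using b assms(1) by simp
    show "0 \<le> r / 10^4 + \<beta> - k" using assms(1,2,5) \<open>\<not> k \<le> n / 1000\<close> by simp
  qed
  then have "(n / 6 + b - n / 10^9)\<^sup>2 \<le> (n / 2 + b + n / 10^9) * (b + 12 * n / 10^5)"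
    using main unfolding b_def by simp
  moreover have "n * b \<le> n * (n / 6 - n / 1000)" using b(1) assms(1) by simp
  moreover have "n * (- n / 10^4) \<le> n * b" using b(2) assms(1) by (intro mult_left_mono) auto
  moreover have "0 < n * n" using assms(1) by simp
  moreover have "(n / 6 + b - n / 10^9)\<^sup>2 - (n / 2 + b + n / 10^9) * (b + 12 * n / 10^5)
      = ((1/6 - 1/10^9)\<^sup>2 - (1/2 + 1/10^9) * (12/10^5)) * (n * n)
        + (2 * (1/6 - 1/10^9) - (1/2 + 1/10^9) - 12/10^5) * (n * b)"
    by (simp add: power2_eq_square field_simps)
  ultimately show False by (simp add: power2_eq_square)
qed

section \<open>From many colours to tight triples with a common vertex\<close>

context dense_tf
begin

lemma d_le: "c * d \<le> c * n / 10 ^ 12" if "0 \<le> c"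
proof -
  have "d \<le> n / 10 ^ 12" using d_small by simp
  then have "c * d \<le> c * (n / 10 ^ 12)" using that by (rule mult_left_mono)
  then show ?thesis by simp
qed

lemma card_sym_diff_adj:
  assumes "u \<in> V" "v \<in> V" "A u v"
  shows "2 * (n / 3 - d) \<le> card (N u - N v \<union> (N v - N u))"
  using card_sym_diff[of "N u" "N v"] nb_disjoint[OF tf assms] deg[OF assms(1)] deg[OF assms(2)] by simp

text \<open>\<open>common\<close> supplies \<open>z i\<close> once \<open>i\<close> and
  \<open>y i\<close> are distinct. Three elements of \<open>S\<close> guarantee that: if
  \<open>y i = i\<close>, then \<open>j\<close>, \<open>i\<close> and \<open>y l\<close> form a
  triangle for two further elements \<open>j\<close>, \<open>l\<close>.\<close>

lemma shattered_crown:
  assumes SV: "S \<subseteq> V" and S: "3 \<le> card S" "finite S"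
    and y: "\<And>i. i \<in> S \<Longrightarrow> y i \<in> V \<and> N (y i) \<inter> S = S - {i}"
  obtains z where "crown (\<lambda>i. i) y z S"
proof -
  have adj: "A i (y j)" "\<not> A i (y i)" if "i \<in> S" "j \<in> S" "i \<noteq> j" for i j
  proof -
    have "i \<in> N (y j) \<inter> S" "i \<notin> N (y i) \<inter> S" using y[OF that(1)] y[OF that(2)] that by simp_all
    then show "A i (y j)" "\<not> A i (y i)" using sym that(1) SV by auto
  qed
  have "\<exists>z\<in>V. A i z \<and> A (y i) z" if i: "i \<in> S" for i
  proof -
    have "2 \<le> card (S - {i})" using S i by simp
    then obtain T where "T \<subseteq> S - {i}" "card T = 2" by (rule obtain_subset_with_card_n)
    then obtain j l where jl: "j \<in> S" "l \<in> S" "j \<noteq> l" "j \<noteq> i" "l \<noteq> i"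
      by (auto simp: card_2_iff)
    have "y i \<noteq> i"
    proof
      assume e: "y i = i"
      have "A j i" using adj(1)[of j i] i jl e by simp
      moreover have "A j (y l)" "A i (y l)" using adj(1)[of j l] adj(1)[of i l] i jl by simp_all
      ultimately show False using no_triangle[of j i "y l"] y[of l] i jl SV by auto
    qed
    moreover have "\<not> A i (y i)" using adj(2)[of i j] i jl by simp
    ultimately show ?thesis using common[of i "y i"] y[OF i] i SV by auto
  qed
  then obtain z where z: "\<And>i. i \<in> S \<Longrightarrow> z i \<in> V \<and> A i (z i) \<and> A (y i) (z i)" by metis
  have "crown (\<lambda>i. i) y z S"
    unfolding crown_def using z y adj(1) S(2) SV by (auto simp: image_subset_iff)
  then show thesis by (rule that)
qed

text \<open>If more than \<open>9 * 1000 ^ 8\<close> members of a far family had no tight triple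
  with a sample point, their neighbourhoods would shatter nine sample points and give a crown, hence
  a tight triple after all. So almost all members have one, and some sample point \<open>x\<close>
  serves many of them.\<close>

lemma colourable_or_tight_family:
  obtains "colourable V (10 ^ 27)"
  | x Y z where "card Y = 20000" "\<And>y. y \<in> Y \<Longrightarrow> tight x y (z y)"
    "\<And>y y'. y \<in> Y \<Longrightarrow> y' \<in> Y \<Longrightarrow> y \<noteq> y' \<Longrightarrow> (1/3 - 1/10^4) * n \<le> card (N y - N y' \<union> (N y' - N y))"
proof -
  let ?\<rho> = "(1/3 - 1/10^4) * n"
  have "0 < ?\<rho>" using n_pos by simp
  moreover have "2 * ?\<rho> \<le> card (N u - N v \<union> (N v - N u))" if "u \<in> V" "v \<in> V" "A u v" for u v
    using card_sym_diff_adj[OF that] d_le[of 1] n_pos by simp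
  ultimately consider (col) "colourable V (10 ^ 27)"
    | (far) Y where "Y \<subseteq> V" "card Y = 10 ^ 27"
      "\<And>y y'. y \<in> Y \<Longrightarrow> y' \<in> Y \<Longrightarrow> y \<noteq> y' \<Longrightarrow> ?\<rho> \<le> card (N y - N y' \<union> (N y' - N y))"
    using colourable_or_far_family[OF finV, of N ?\<rho> "10 ^ 27"] finN by blast
  then show thesis
  proof cases
    case col
    then show thesis by (rule that(1))
  next
    case far
    have finY: "finite Y" using far(1) finV finite_subset by blast
    have "real (card V) * (3 / 10) \<le> card {u\<in>V. (u \<in> N y) \<noteq> (u \<in> N y')}"
      if "y \<in> Y" "y' \<in> Y" "y \<noteq> y'" for y y'
    proof -
      have "{u\<in>V. (u \<in> N y) \<noteq> (u \<in> N y')} = N y - N y' \<union> (N y' - N y)" by auto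
      then show ?thesis using far(3)[OF that] n_pos by simp
    qed
    moreover have "(real (card Y))\<^sup>2 * (1 - 3 / 10) ^ 1000 < 1"
    proof -
      \<comment> \<open>The bound \<open>(1/2) ^ 500\<close> is far below \<open>10 ^ -54\<close>,
        which the \<open>10 ^ 54\<close> ordered pairs require.\<close>
      have "(7 / 10 :: real) ^ 1000 = ((7 / 10)\<^sup>2) ^ 500" by (simp flip: power_mult)
      also have "\<dots> \<le> (1 / 2) ^ 500" by (intro power_mono) (auto simp: power2_eq_square)
      finally have "(real (card Y))\<^sup>2 * (7 / 10) ^ 1000 \<le> (10 ^ 27)\<^sup>2 * (1 / 2) ^ 500"
        unfolding far(2) by (intro mult_mono) auto
      also have "\<dots> < 1" by (simp add: power_divide)
      finally show ?thesis by simp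
    qed
    ultimately obtain T where T: "T \<subseteq> V" "card T \<le> 1000" "inj_on (\<lambda>y. N y \<inter> T) Y"
      using separating_sample[OF finV V_ne finY, of "3 / 10" N 1000] by (auto simp: mult.commute)
    have finT: "finite T" using T(1) finV finite_subset by blast
    define Good where "Good = {y\<in>Y. \<exists>x\<in>T. \<exists>z. tight x y z}"
    have "card (Y - Good) \<le> 9 * 1000 ^ 8"
    proof (rule ccontr)
      assume "\<not> ?thesis"
      moreover have "card ((\<lambda>y. N y \<inter> T) ` (Y - Good)) = card (Y - Good)"
        using T(3) by (intro card_image inj_on_subset[OF T(3)]) auto
      ultimately have "9 * 1000 ^ (9 - 1) < card ((\<lambda>y. N y \<inter> T) ` (Y - Good))" by simp
      then obtain S where S: "S \<subseteq> T" "card S = 9" "shatters ((\<lambda>y. N y \<inter> T) ` (Y - Good)) S"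
        by (rule sauer_shelah[OF finT T(2), rotated 3]) auto
      have "\<exists>y\<in>Y - Good. N y \<inter> S = S - {i}" if "i \<in> S" for i
      proof -
        obtain f where "f \<in> (\<lambda>y. N y \<inter> T) ` (Y - Good)" "f \<inter> S = S - {i}"
          using S(3) unfolding shatters_def by (meson Diff_subset)
        then obtain y where "y \<in> Y - Good" "N y \<inter> T \<inter> S = S - {i}" by blast
        moreover have "N y \<inter> T \<inter> S = N y \<inter> S" using S(1) by blast
        ultimately show ?thesis by auto
      qed
      then obtain y where y: "\<And>i. i \<in> S \<Longrightarrow> y i \<in> Y - Good \<and> N (y i) \<inter> S = S - {i}" by metis
      have finS: "finite S" using S(1) finT finite_subset by blast
      obtain z where cr: "crown (\<lambda>i. i) y z S"
        by (rule shattered_crown[of S y]) (use S T(1) far(1) y finS in auto)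
      have "?\<rho> \<le> card (N (y i) - N (y j) \<union> (N (y j) - N (y i)))" if ij: "i \<in> S" "j \<in> S" "i \<noteq> j" for i j
      proof -
        have "S - {i} \<noteq> S - {j}" using ij by blast
        then have "y i \<noteq> y j" using y[OF ij(1)] y[OF ij(2)] by metis
        then show ?thesis using far(3) y ij by blast
      qed
      then obtain i where "i \<in> S" "tight i (y i) (z i)" by (rule crown_tight[OF cr S(2)])
      then show False using y[of i] S(1) unfolding Good_def by blast
    qed
    moreover have "card Y = card (Y - Good) + card Good"
      using finY unfolding Good_def by (simp add: card_Diff_subset card_mono)
    ultimately have Good: "10 ^ 27 \<le> 9 * 1000 ^ 8 + card Good" using far(2) by simp
    \<comment> \<open>Twice 10000, because later only the members \<open>y\<close> on one side of a
      given vertex are used.\<close>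
    have "\<exists>x\<in>T. 20000 \<le> card {y\<in>Y. \<exists>z. tight x y z}"
    proof (rule ccontr)
      assume no: "\<not> ?thesis"
      have "Good = (\<Union>x\<in>T. {y\<in>Y. \<exists>z. tight x y z})" unfolding Good_def by blast
      then have "card Good \<le> (\<Sum>x\<in>T. card {y\<in>Y. \<exists>z. tight x y z})" by (simp add: card_UN_le finT)
      also have "\<dots> \<le> (\<Sum>x\<in>T. 20000)" using no by (intro sum_mono) auto
      also have "\<dots> \<le> 20000 * 1000" using T(2) by simp
      finally show False using Good by simp
    qed
    then obtain x where "20000 \<le> card {y\<in>Y. \<exists>z. tight x y z}" by blast
    then obtain Y' where Y': "Y' \<subseteq> {y\<in>Y. \<exists>z. tight x y z}" "card Y' = 20000"
      by (rule obtain_subset_with_card_n)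
    then have "\<forall>y\<in>Y'. \<exists>z. tight x y z" by blast
    then obtain z where z: "\<And>y. y \<in> Y' \<Longrightarrow> tight x y (z y)" by metis
    have Y'Y: "Y' \<subseteq> Y" using Y'(1) by blast
    show thesis
    proof (rule that(2)[of Y' x z])
      show "card Y' = 20000" by (rule Y'(2))
      show "tight x y (z y)" if "y \<in> Y'" for y using that by (rule z)
      show "?\<rho> \<le> card (N y - N y' \<union> (N y' - N y))" if "y \<in> Y'" "y' \<in> Y'" "y \<noteq> y'" for y y'
        using far(3)[OF subsetD[OF Y'Y that(1)] subsetD[OF Y'Y that(2)] that(3)] .
    qed
  qed
qed

lemma tight_degrees:
  assumes "tight x y z"
  shows "card (N x) \<le> n / 3 + 56 * d" "card (N y) \<le> n / 3 + 56 * d" "card (N z) \<le> n / 3 + 56 * d"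
    "card (N x \<inter> N y) \<le> 27 * d"
proof -
  let ?ok = "\<lambda>u. (A x u \<and> \<not> A y u \<and> \<not> A z u) \<or> (\<not> A x u \<and> A y u \<and> \<not> A z u) \<or> (\<not> A x u \<and> \<not> A y u \<and> A z u)"
  let ?B = "{u\<in>V. \<not> ?ok u}"
  have xyz: "x \<in> V" "y \<in> V" "z \<in> V" "A x z" "A y z" and B: "card ?B \<le> 27 * d"
    using assms unfolding tight_def by blast+
  have finB: "finite ?B" using finV by simp
  have "N x \<inter> N y \<subseteq> ?B" by auto
  then have "card (N x \<inter> N y) \<le> card ?B" by (rule card_mono[OF finB])
  then show xy: "card (N x \<inter> N y) \<le> 27 * d" using B by linarith
  have "N x \<inter> N z = {}" "N y \<inter> N z = {}" using nb_disjoint[OF tf] xyz by blast+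
  then have "card (N x \<union> N y \<union> N z) = card (N x \<union> N y) + card (N z)" by (intro card_Un_disjoint) auto
  moreover have "card (N x \<union> N y \<union> N z) \<le> card V" using finV nb_subset by (intro card_mono) auto
  moreover have "card (N x \<union> N y) + card (N x \<inter> N y) = card (N x) + card (N y)"
    using card_Un_Int[of "N x" "N y"] by simp
  ultimately have "real (card (N x)) + card (N y) + card (N z) \<le> n + 27 * d" using xy by linarith
  then show "card (N x) \<le> n / 3 + 56 * d" "card (N y) \<le> n / 3 + 56 * d" "card (N z) \<le> n / 3 + 56 * d"
    using deg[OF xyz(1)] deg[OF xyz(2)] deg[OF xyz(3)] d_nonneg by simp_all
qed

text \<open>Two adjacent typical vertices outside \<open>N x\<close> see opposite members of each pair \<open>y\<close>, \<open>z y\<close>. Hence the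
  neighbours of \<open>u\<close> outside \<open>N x\<close> lie in the intersection of many pairwise far-apart sets.\<close>

lemma tight_family_sparse:
  assumes "card Y = 20000" and t: "\<And>y. y \<in> Y \<Longrightarrow> tight x y (z y)"
    and far: "\<And>y y'. y \<in> Y \<Longrightarrow> y' \<in> Y \<Longrightarrow> y \<noteq> y' \<Longrightarrow> (1/3 - 1/10^4) * n \<le> card (N y - N y' \<union> (N y' - N y))"
  obtains B where "B \<subseteq> V" "card B \<le> n / 10 ^ 6" "\<And>u. u \<in> V - N x - B \<Longrightarrow> card (N u - N x) \<le> n / 990"
proof -
  let ?ok = "\<lambda>y u. (A x u \<and> \<not> A y u \<and> \<not> A (z y) u) \<or> (\<not> A x u \<and> A y u \<and> \<not> A (z y) u) \<or> (\<not> A x u \<and> \<not> A y u \<and> A (z y) u)"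
  let ?B = "\<lambda>y. {u\<in>V. \<not> ?ok y u}"
  define B where "B = (\<Union>y\<in>Y. ?B y)"
  define R where "R = V - N x"
  have finY: "finite Y" using assms(1) by (metis card.infinite zero_neq_numeral)
  then obtain y0 where y0: "y0 \<in> Y" using assms(1) by fastforce
  have finR: "finite R" unfolding R_def using finV by simp
  have V: "x \<in> V" "y \<in> V" "z y \<in> V" "A x (z y)" "A y (z y)" and By: "card (?B y) \<le> 27 * d" if "y \<in> Y" for y
    using t[OF that] unfolding tight_def by blast+
  have finB: "finite (?B y)" for y using finV by simp
  have BV: "B \<subseteq> V" unfolding B_def by blast
  have "real (card B) \<le> (\<Sum>y\<in>Y. real (card (?B y)))"
    unfolding B_def using card_UN_le[OF finY, of ?B] by (simp flip: of_nat_sum)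
  also have "\<dots> \<le> (\<Sum>y\<in>Y. 27 * d)" by (intro sum_mono By)
  also have "\<dots> = 540000 * d" using assms(1) by simp
  finally have cB: "card B \<le> 540000 * d" .
  then have cB': "card B \<le> n / 10 ^ 6" using d_le[of 540000] n_pos by simp
  have cR: "real (card R) = n - card (N x)"
    unfolding R_def using finV nb_subset[of V x] by (simp add: card_Diff_subset card_mono of_nat_diff)
  have cR1: "card R \<le> 2 * n / 3 + d" using cR deg[OF V(1)[OF y0]] by simp
  have inY: "card (N y \<inter> N y') \<le> n / 6 + n / 20000 + 56 * d" if "y \<in> Y" "y' \<in> Y" "y \<noteq> y'" for y y'
    using card_sym_diff[of "N y" "N y'"] far[OF that] tight_degrees(2)[OF t[OF that(1)]]
      tight_degrees(2)[OF t[OF that(2)]] by (simp add: field_simps)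
  \<comment> \<open>This intersection avoids \<open>N x\<close>, \<open>N y\<close> and
    \<open>N y'\<close>, whose union has at least about \<open>n/3 + 2n/3 - n/6\<close>
    elements.\<close>
  have inZ: "card (N (z y) \<inter> N (z y')) \<le> n / 6 + n / 20000 + 200 * d" if yy: "y \<in> Y" "y' \<in> Y" "y \<noteq> y'" for y y'
  proof -
    have "N x \<inter> N (z y) = {}" "N y \<inter> N (z y) = {}" "N y' \<inter> N (z y') = {}"
      using nb_disjoint[OF tf] V[OF yy(1)] V[OF yy(2)] by simp_all
    then have "N (z y) \<inter> N (z y') \<inter> (N x \<union> (N y \<union> N y')) = {}" by blast
    then have "card ((N (z y) \<inter> N (z y')) \<union> (N x \<union> (N y \<union> N y')))
        = card (N (z y) \<inter> N (z y')) + card (N x \<union> (N y \<union> N y'))"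
      by (intro card_Un_disjoint) auto
    moreover have "card ((N (z y) \<inter> N (z y')) \<union> (N x \<union> (N y \<union> N y'))) \<le> card V"
      using finV nb_subset by (intro card_mono) auto
    moreover have "card (N x \<union> (N y \<union> N y')) + card (N x \<inter> (N y \<union> N y')) = card (N x) + card (N y \<union> N y')"
      using card_Un_Int[of "N x" "N y \<union> N y'"] by simp
    moreover have "card (N x \<inter> (N y \<union> N y')) \<le> card (N x \<inter> N y) + card (N x \<inter> N y')"
      by (metis Int_Un_distrib card_Un_le)
    moreover have "card (N y \<union> N y') + card (N y \<inter> N y') = card (N y) + card (N y')"
      using card_Un_Int[of "N y" "N y'"] by simp
    moreover note inY[OF yy] tight_degrees(4)[OF t[OF yy(1)]] tight_degrees(4)[OF t[OF yy(2)]]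
      deg[OF V(1)[OF yy(1)]] deg[OF V(2)[OF yy(1)]] deg[OF V(2)[OF yy(2)]]
    ultimately show ?thesis using d_nonneg by linarith
  qed
  have sparse: "card (N u - N x) \<le> n / 990" if u: "u \<in> V - N x - B" for u
  proof -
    \<comment> \<open>Outside \<open>N x\<close> and \<open>B\<close> each vertex sees exactly one
      of \<open>y\<close> and \<open>z y\<close>, and adjacent vertices cannot see the same one. So
      a neighbour of \<open>u\<close> there lies on the side opposite to \<open>u\<close>.\<close>
    define G where "G y = (if A y u then N (z y) else N y) \<inter> R" for y
    define K where "K = (N u - N x) - B"
    have uV: "u \<in> V" "\<not> A x u" "u \<notin> B" using u by auto
    have dich: "?ok y u" if "y \<in> Y" for y using uV that unfolding B_def by blast
    have KG: "K \<subseteq> G y" if y: "y \<in> Y" for y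
    proof
      fix v assume v: "v \<in> K"
      then have vV: "v \<in> V" "A u v" "\<not> A x v" "v \<notin> B" unfolding K_def by auto
      have okv: "?ok y v" using vV y unfolding B_def by blast
      have "\<not> (A y u \<and> A y v)" "\<not> (A (z y) u \<and> A (z y) v)"
        using no_triangle[of y u v] no_triangle[of "z y" u v] uV vV V[OF y] by blast+
      then have "if A y u then A (z y) v else A y v" using dich[OF y] okv uV(2) vV(3) by argo
      then show "v \<in> G y" using vV unfolding G_def R_def by (simp split: if_splits)
    qed
    have KR: "K \<subseteq> R" unfolding K_def R_def using nb_subset by blast
    have cG: "n / 3 - 28 * d \<le> card (G y)" if y: "y \<in> Y" for y
    proof -
      have "N (z y) \<inter> R = N (z y)" unfolding R_def using nb_disjoint[OF tf V(1)[OF y] V(3)[OF y] V(4)[OF y]] nb_subset by blast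
      moreover have "card (N y \<inter> R) + card (N x \<inter> N y) = card (N y)"
      proof -
        have "N y = (N y \<inter> R) \<union> (N x \<inter> N y)" unfolding R_def by auto
        moreover have "card ((N y \<inter> R) \<union> (N x \<inter> N y)) = card (N y \<inter> R) + card (N x \<inter> N y)"
          unfolding R_def by (intro card_Un_disjoint) auto
        ultimately show ?thesis by simp
      qed
      ultimately show ?thesis
        unfolding G_def using deg[OF V(2)[OF y]] deg[OF V(3)[OF y]] tight_degrees(4)[OF t[OF y]] d_nonneg by auto
    qed
    \<comment> \<open>The pairwise bounds hold only between sets of the same kind, so a class with
      at least half of the indices is kept.\<close>
    define Y1 where "Y1 = {y\<in>Y. A y u}"
    have "card Y1 + card (Y - Y1) = 20000"
      using finY assms(1) card_mono[OF finY, of Y1] unfolding Y1_def by (simp add: card_Diff_subset)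
    then have "10000 \<le> card Y1 \<or> 10000 \<le> card (Y - Y1)" by linarith
    then obtain Y3 where "Y3 = Y1 \<or> Y3 = Y - Y1" "10000 \<le> card Y3" by blast
    moreover from this(2) obtain Y2 where "Y2 \<subseteq> Y3" "card Y2 = 10000"
      by (rule obtain_subset_with_card_n)
    moreover have "Y1 \<subseteq> Y" unfolding Y1_def by blast
    ultimately have Y2: "Y2 \<subseteq> Y" "card Y2 = 10000" "Y2 \<subseteq> Y1 \<or> Y2 \<subseteq> Y - Y1" by blast+
    have finY2: "finite Y2" using Y2(1) finY finite_subset by blast
    define \<beta> where "\<beta> = n / 6 + n / 20000 + 200 * d"
    have int: "card (G y \<inter> G y') \<le> \<beta>" if yy: "y \<in> Y2" "y' \<in> Y2" "y \<noteq> y'" for y y'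
    proof -
      have yyY: "y \<in> Y" "y' \<in> Y" using yy Y2(1) by auto
      have "A y u = A y' u" using Y2(3) yy unfolding Y1_def by blast
      then have "G y \<inter> G y' \<subseteq> (if A y u then N (z y) \<inter> N (z y') else N y \<inter> N y')" unfolding G_def by auto
      then have "card (G y \<inter> G y') \<le> card (if A y u then N (z y) \<inter> N (z y') else N y \<inter> N y')"
        by (intro card_mono) auto
      then show ?thesis unfolding \<beta>_def using inY[OF yyY yy(3)] inZ[OF yyY yy(3)] d_nonneg by (auto split: if_splits)
    qed
    obtain T where "T \<subseteq> Y2" "card T = 2" using Y2(2) obtain_subset_with_card_n[of 2 Y2] by auto
    then obtain p q where pq: "p \<in> Y2" "q \<in> Y2" "p \<noteq> q" by (auto simp: card_2_iff)
    have "K \<subseteq> G p \<inter> G q" using KG[of p] KG[of q] pq Y2(1) by blast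
    moreover have "finite (G p \<inter> G q)" unfolding G_def using finR by simp
    ultimately have "card K \<le> card (G p \<inter> G q)" by (rule card_mono[rotated])
    then have K\<beta>: "card K \<le> \<beta>" using int[OF pq] by linarith
    have "card K \<le> n / 3 - n / 10 ^ 9"
      using K\<beta> d_le[of 200] n_pos unfolding \<beta>_def by simp
    moreover have "n / 3 - n / 10 ^ 9 \<le> card (G y)" if "y \<in> Y2" for y
      using cG[of y] that Y2(1) d_le[of 28] n_pos by auto
    ultimately have "(n / 3 - n / 10^9 - card K)\<^sup>2 \<le> (real (card R) - card K) * (card R / card Y2 + \<beta> - card K)"
      using Y2 KG by (intro common_part_bound[of R Y2 G] finR finY2 int) (auto simp: G_def subset_iff)
    then have "card K \<le> n / 1000"
      using Y2(2) cR1 K\<beta> n_pos d_le[of 200] d_le[of 1] card_mono[OF finR KR] unfolding \<beta>_def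
      by (intro common_part_small[of n _ \<beta> "card R"]) (auto simp: \<beta>_def)
    moreover have "card (N u - N x) \<le> card K + card B"
    proof -
      have "card (N u - N x) \<le> card (K \<union> B)"
        unfolding K_def using finV BV finite_subset by (intro card_mono) auto
      then show ?thesis using card_Un_le[of K B] by linarith
    qed
    ultimately show ?thesis using cB' n_pos by simp
  qed
  show thesis using that[OF BV cB' sparse] .
qed

end

section \<open>The nearly complete bipartite core\<close>

context dense_tf
begin

text \<open>Vertices outside \<open>N x\<close> and \<open>B\<close> send almost \<open>n/3\<close>
  edges into \<open>N x\<close>, which has size about \<open>n/3\<close>, so the graph between the
  two is nearly complete. Counting its missing pairs shows that few vertices of \<open>N x\<close>
  have low degree; the others form \<open>Q\<close>.\<close>

lemma colourable_or_core:
  obtains "colourable V (10 ^ 27)"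
  | Q where "Q \<subseteq> V" "Q \<noteq> {}" "\<And>a a'. a \<in> Q \<Longrightarrow> a' \<in> Q \<Longrightarrow> n / 3 + 2 * d < card (N a \<inter> N a')"
    "card (V - Q - (\<Union>a\<in>Q. N a)) \<le> n / 100"
proof (rule colourable_or_tight_family)
  assume "colourable V (10 ^ 27)"
  then show thesis by (rule that(1))
next
  fix x Y z
  assume cY: "card Y = 20000" and t: "\<And>y. y \<in> Y \<Longrightarrow> tight x y (z y)"
    and far: "\<And>y y'. y \<in> Y \<Longrightarrow> y' \<in> Y \<Longrightarrow> y \<noteq> y' \<Longrightarrow> (1/3 - 1/10^4) * n \<le> card (N y - N y' \<union> (N y' - N y))"
  obtain B where B: "B \<subseteq> V" "card B \<le> n / 10 ^ 6" "\<And>u. u \<in> V - N x - B \<Longrightarrow> card (N u - N x) \<le> n / 990"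
    by (rule tight_family_sparse[OF cY, of x z]) (rule t, assumption, rule far, assumption+, rule that, assumption+)
  have "Y \<noteq> {}" using cY by auto
  then obtain y0 where "y0 \<in> Y" by auto
  then have xt: "tight x y0 (z y0)" by (rule t)
  then have xV: "x \<in> V" unfolding tight_def by blast
  have cx: "n / 3 - d \<le> card (N x)" "card (N x) \<le> n / 3 + 56 * d"
    using deg[OF xV] tight_degrees(1)[OF xt] by simp_all
  \<comment> \<open>Two neighbourhoods of size \<open>13/24 n\<close> inside the roughly
    \<open>2n/3\<close> vertices outside \<open>N x\<close> share about \<open>5/12 n\<close>, well
    above \<open>n/3\<close>. A vertex below this bound misses at least \<open>n/9\<close> of
    \<open>S\<close>.\<close>
  define Q where "Q = {a\<in>N x. 13 / 24 * n \<le> card (N a)}"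
  define W where "W = N x - Q"
  define S where "S = V - N x - B"
  have finS: "finite S" and finW: "finite W" unfolding S_def W_def using finV by simp_all
  have cR: "card (V - N x) = n - card (N x)"
    using finV nb_subset[of V x] by (simp add: card_Diff_subset card_mono of_nat_diff)
  have "card (V - N x) \<le> card S + card B"
  proof -
    have "card (V - N x) \<le> card (S \<union> B)"
      unfolding S_def using finV B(1) finite_subset by (intro card_mono) auto
    then show ?thesis using card_Un_le[of S B] by linarith
  qed
  then have cS: "2 * n / 3 - 56 * d - n / 10 ^ 6 \<le> card S" using cR cx B(2) by linarith
  have cS': "card S \<le> 2 * n / 3 + d"
  proof -
    have "card S \<le> card (V - N x)" unfolding S_def using finV by (intro card_mono) auto
    then show ?thesis using cR cx by linarith
  qed
  have Na: "N a \<subseteq> V - N x" if "a \<in> N x" for a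
    using nb_disjoint[OF tf xV, of a] that nb_subset by auto
  have Nx_inter: "n / 3 - d - n / 990 \<le> card (N x \<inter> N v)" if v: "v \<in> S" for v
  proof -
    have "v \<in> V" using v unfolding S_def by auto
    moreover have "card (N v) = card (N v - N x) + card (N x \<inter> N v)"
    proof -
      have "N v = (N v - N x) \<union> (N x \<inter> N v)" by blast
      moreover have "card ((N v - N x) \<union> (N x \<inter> N v)) = card (N v - N x) + card (N x \<inter> N v)"
        by (intro card_Un_disjoint) auto
      ultimately show ?thesis by simp
    qed
    ultimately show ?thesis using deg[of v] B(3)[of v] v unfolding S_def by auto
  qed
  have W: "card W \<le> n / 150"
  proof -
    have "(\<Sum>a\<in>W. n / 9) \<le> (\<Sum>a\<in>W. real (card {v\<in>S. \<not> A a v}))"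
    proof (rule sum_mono)
      fix a assume a: "a \<in> W"
      then have "card (N a) < 13 / 24 * n" unfolding W_def Q_def by auto
      moreover have "card {v\<in>S. \<not> A a v} + card (nb S a) = card S" using card_nonnbs[OF finS] .
      moreover have "card (nb S a) \<le> card (N a)" by (intro card_mono) (auto simp: S_def)
      ultimately show "n / 9 \<le> real (card {v\<in>S. \<not> A a v})"
        using cS d_le[of 56] n_pos by simp
    qed
    also have "\<dots> = real (\<Sum>a\<in>W. card {v\<in>S. \<not> A a v})" by simp
    also have "(\<Sum>a\<in>W. card {v\<in>S. \<not> A a v}) = (\<Sum>v\<in>S. card {a\<in>W. \<not> A a v})"
      by (rule sum_multicount_gen[OF finW finS]) simp
    also have "real \<dots> = (\<Sum>v\<in>S. real (card {a\<in>W. \<not> A a v}))" by simp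
    also have "\<dots> \<le> (\<Sum>v\<in>S. n / 980)"
    proof (rule sum_mono)
      fix v assume v: "v \<in> S"
      have "card {a\<in>W. \<not> A a v} \<le> card (N x - N v)"
        unfolding W_def using sym by (intro card_mono) auto
      moreover have "card (N x) = card (N x - N v) + card (N x \<inter> N v)"
        by (metis card_Diff_subset_Int card_mono finN finite_Int inf_le1 le_add_diff_inverse2)
      ultimately show "real (card {a\<in>W. \<not> A a v}) \<le> n / 980"
        using Nx_inter[OF v] cx d_le[of 57] n_pos by simp
    qed
    also have "\<dots> = card S * (n / 980)" by simp
    also have "\<dots> \<le> (67 / 100 * n) * (n / 980)"
      using cS' d_le[of 1] n_pos by (intro mult_right_mono) auto
    finally have "(real (card W) / 9) * n \<le> (67 / 98000 * n) * n" by (simp add: field_simps)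
    then have "real (card W) / 9 \<le> 67 / 98000 * n" using n_pos by simp
    then show ?thesis using n_pos by simp
  qed
  show thesis
  proof (rule that(2)[of Q])
    show "Q \<subseteq> V" unfolding Q_def using nb_subset by auto
    show "Q \<noteq> {}"
    proof
      assume "Q = {}"
      then have "W = N x" unfolding W_def by simp
      then show False using W cx d_le[of 1] n_pos by simp
    qed
    show "n / 3 + 2 * d < card (N a \<inter> N a')" if aa: "a \<in> Q" "a' \<in> Q" for a a'
    proof -
      have "card (N a \<union> N a') \<le> card (V - N x)"
        using Na[of a] Na[of a'] aa finV unfolding Q_def by (intro card_mono) auto
      moreover have "card (N a \<union> N a') + card (N a \<inter> N a') = card (N a) + card (N a')"
        using card_Un_Int[of "N a" "N a'"] by simp
      moreover have "13 / 24 * n \<le> card (N a)" "13 / 24 * n \<le> card (N a')" using aa unfolding Q_def by auto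
      ultimately show ?thesis using cR cx d_le[of 3] n_pos by simp
    qed
    have "V - Q - (\<Union>a\<in>Q. N a) \<subseteq> W \<union> B"
    proof
      fix u assume u: "u \<in> V - Q - (\<Union>a\<in>Q. N a)"
      show "u \<in> W \<union> B"
      proof (rule ccontr)
        assume nu: "u \<notin> W \<union> B"
        then have uS: "u \<in> S" using u unfolding S_def W_def by blast
        have "N x \<inter> N u \<subseteq> W"
        proof
          fix a assume a: "a \<in> N x \<inter> N u"
          then have "A a u" using sym by simp
          then have "a \<notin> Q" using u by auto
          then show "a \<in> W" using a unfolding W_def by simp
        qed
        then have "card (N x \<inter> N u) \<le> card W" using finW by (rule card_mono[rotated])
        then show False using Nx_inter[OF uS] W d_le[of 1] n_pos by simp
      qed
    qed
    then have "card (V - Q - (\<Union>a\<in>Q. N a)) \<le> card (W \<union> B)"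
      using finW B(1) finV finite_subset by (intro card_mono) auto
    also have "\<dots> \<le> card W + card B" by (rule card_Un_le)
    finally show "card (V - Q - (\<Union>a\<in>Q. N a)) \<le> n / 100" using W B(2) n_pos by simp
  qed
qed

end

section \<open>Colouring around the core: the sets \<open>P\<close>, \<open>Q\<close> and
  \<open>D\<close>\<close>

locale dense_tf_core = dense_tf +
  fixes Q :: "'a set"
  assumes QV: "Q \<subseteq> V" and Q_ne: "Q \<noteq> {}"
    and Qpair: "a \<in> Q \<Longrightarrow> a' \<in> Q \<Longrightarrow> n / 3 + 2 * d < card (N a \<inter> N a')"
    and rest_small: "card (V - Q - (\<Union>a\<in>Q. N a)) \<le> n / 100"
begin

definition P :: "'a set" where "P = (\<Union>a\<in>Q. N a)"
definition D :: "'a set" where "D = V - Q - P"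

lemma P_V: "P \<subseteq> V" and D_V: "D \<subseteq> V"
  unfolding P_def D_def using nb_subset by auto

lemma finP [simp]: "finite P" and finD [simp]: "finite D"
  using P_V D_V finV finite_subset by blast+

lemma cD: "card D \<le> n / 100"
  using rest_small unfolding D_def P_def .

lemma indep_Q: "indep Q"
  unfolding indep_def
proof (intro ballI notI)
  fix a a' assume aa: "a \<in> Q" "a' \<in> Q" "A a a'"
  then have "N a \<inter> N a' = {}" using nb_disjoint[OF tf] QV by blast
  then have "n / 3 + 2 * d < 0" using Qpair[OF aa(1,2)] by simp
  then show False using n_pos d_nonneg by simp
qed

text \<open>For adjacent \<open>v\<close>, \<open>v'\<close> in \<open>P\<close> with neighbours
  \<open>a\<close>, \<open>a'\<close> in \<open>Q\<close>, the sets \<open>N v\<close>,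
  \<open>N v'\<close> and \<open>N a \<inter> N a'\<close> are pairwise disjoint and together too
  large: the \<open>2 * d\<close> in \<open>Qpair\<close> outweighs the defects of \<open>v\<close>
  and \<open>v'\<close>.\<close>

lemma indep_P: "indep P"
  unfolding indep_def
proof (intro ballI notI)
  fix v v' assume v: "v \<in> P" "v' \<in> P" "A v v'"
  then obtain a a' where a: "a \<in> Q" "a' \<in> Q" "A a v" "A a' v'" and vV: "v \<in> V" "v' \<in> V"
    unfolding P_def by auto
  have aV: "a \<in> V" "a' \<in> V" using a QV by auto
  have dis: "N v \<inter> N v' = {}" "N a \<inter> N v = {}" "N a' \<inter> N v' = {}"
    using nb_disjoint[OF tf] v(3) a vV aV by simp_all
  have "card (N v \<union> N v' \<union> (N a \<inter> N a')) = card (N v) + card (N v') + card (N a \<inter> N a')"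
    using dis by (subst card_Un_disjoint; (subst card_Un_disjoint)?) auto
  moreover have "card (N v \<union> N v' \<union> (N a \<inter> N a')) \<le> card V"
    using finV nb_subset by (intro card_mono) auto
  ultimately show False using deg[OF vV(1)] deg[OF vV(2)] Qpair[OF a(1,2)] by linarith
qed

lemma cP: "card P \<le> 2 * n / 3 + d"
proof (cases "P = {}")
  case True
  then show ?thesis using n_pos d_nonneg by simp
next
  case False
  then obtain v where v: "v \<in> P" by auto
  have "P \<inter> N v = {}" using indep_P v unfolding indep_def by auto
  then have "card (P \<union> N v) = card P + card (N v)" by (intro card_Un_disjoint) auto
  moreover have "card (P \<union> N v) \<le> card V" using finV P_V nb_subset by (intro card_mono) auto
  ultimately show ?thesis using deg[of v] v P_V by auto
qed

lemma D_Q: "u \<in> D \<Longrightarrow> a \<in> Q \<Longrightarrow> \<not> A u a"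
  using sym D_V unfolding D_def P_def by auto

lemma N_D: "u \<in> D \<Longrightarrow> N u \<subseteq> P \<union> D"
  using D_Q unfolding D_def by auto

lemma card_N_D: "u \<in> D \<Longrightarrow> card (N u) = card (N u \<inter> P) + card (N u \<inter> D)"
proof -
  assume u: "u \<in> D"
  have "N u = (N u \<inter> P) \<union> (N u \<inter> D)" using N_D[OF u] by blast
  moreover have "card ((N u \<inter> P) \<union> (N u \<inter> D)) = card (N u \<inter> P) + card (N u \<inter> D)"
    by (intro card_Un_disjoint) (auto simp: D_def)
  ultimately show ?thesis by simp
qed

lemma cNP: "u \<in> D \<Longrightarrow> n / 3 - d - n / 100 \<le> card (N u \<inter> P)"
proof -
  assume u: "u \<in> D"
  have "card (N u \<inter> D) \<le> card D" by (intro card_mono) auto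
  then show ?thesis using card_N_D[OF u] deg[of u] u D_V cD by auto
qed

lemma adj_D:
  assumes "u \<in> D" "v \<in> D" "A u v"
  shows "N u \<inter> P \<inter> (N v \<inter> P) = {}" "card (N u \<inter> P) + card (N v \<inter> P) \<le> 2 * n / 3 + d"
proof -
  show d: "N u \<inter> P \<inter> (N v \<inter> P) = {}" using nb_disjoint[OF tf] assms D_V by blast
  have "card (N u \<inter> P \<union> N v \<inter> P) = card (N u \<inter> P) + card (N v \<inter> P)"
    using d by (intro card_Un_disjoint) auto
  moreover have "card (N u \<inter> P \<union> N v \<inter> P) \<le> card P" by (intro card_mono) auto
  ultimately show "card (N u \<inter> P) + card (N v \<inter> P) \<le> 2 * n / 3 + d" using cP by linarith
qed

text \<open>The threshold \<open>12 * d\<close> is the bound of \<open>hit_count_deficit\<close> for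
  four triples.\<close>

definition D1 :: "'a set" where "D1 = {b\<in>D. 12 * d < card (N b \<inter> D)}"

text \<open>Each \<open>z i\<close> falls into \<open>D\<close>. A vertex of \<open>D\<close> has
  about \<open>n/3\<close> or more neighbours in \<open>P\<close>, disjoint from those of its
  neighbours in \<open>D\<close>. In the remaining \<open>n/3\<close> there is no room for two
  far-apart neighbourhoods, so it sees at most one \<open>y i\<close> and one \<open>z i\<close>. If
  it sees some \<open>y i\<close>, its count is at most 3, hence deficient; this leaves
  \<open>y i\<close> too few neighbours in \<open>D\<close> for \<open>D1\<close>.\<close>

lemma no_far_crown:
  assumes cr: "crown (\<lambda>i. i) y z S" and cS: "card S = 4" and SP: "S \<subseteq> P" and y: "y ` S \<subseteq> D1"
    and far: "\<And>i j. i \<in> S \<Longrightarrow> j \<in> S \<Longrightarrow> i \<noteq> j \<Longrightarrow>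
      3 / 10 * n \<le> card (N (y i) \<inter> P - N (y j) \<inter> P \<union> (N (y j) \<inter> P - N (y i) \<inter> P))"
  shows False
proof -
  have fin: "finite S" and im: "(\<lambda>i. i) ` S \<subseteq> V" "y ` S \<subseteq> V" "z ` S \<subseteq> V"
    and xz: "\<And>i. i \<in> S \<Longrightarrow> A i (z i)" and yz: "\<And>i. i \<in> S \<Longrightarrow> A (y i) (z i)"
    using cr unfolding crown_def by auto
  have yD: "y i \<in> D" if "i \<in> S" for i using y that unfolding D1_def by auto
  have zD: "z i \<in> D" if i: "i \<in> S" for i
  proof -
    have "z i \<notin> P" using xz[OF i] i SP indep_P unfolding indep_def by blast
    moreover have "z i \<notin> Q" using D_Q[OF yD[OF i]] yz[OF i] by blast
    ultimately show ?thesis using im(3) i unfolding D_def by auto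
  qed
  note err = d_le[of 20] n_pos
  have inter: "card (N (y i) \<inter> P \<inter> (N (y j) \<inter> P)) \<le> n / 3 - 15 / 100 * n + n / 100 + 2 * d"
    if ij: "i \<in> S" "j \<in> S" "i \<noteq> j" for i j
  proof -
    have "card (N (y l) \<inter> P) \<le> n / 3 + 2 * d + n / 100" if l: "l \<in> S" for l
      using adj_D(2)[OF yD[OF l] zD[OF l] yz[OF l]] cNP[OF zD[OF l]] by linarith
    from this[OF ij(1)] this[OF ij(2)] show ?thesis
      using card_sym_diff[of "N (y i) \<inter> P" "N (y j) \<inter> P"] far[OF ij] by simp
  qed
  have one_y: "i = j" if u: "u \<in> D" and ij: "i \<in> hits y S u" "j \<in> hits y S u" for i j u
  proof (rule ccontr)
    assume ne: "i \<noteq> j"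
    have iS: "i \<in> S" "j \<in> S" "A (y i) u" "A (y j) u" using ij unfolding hits_def by auto
    have "(N (y i) \<inter> P \<union> N (y j) \<inter> P) \<inter> (N u \<inter> P) = {}"
      using adj_D(1)[OF yD[OF iS(1)] u iS(3)] adj_D(1)[OF yD[OF iS(2)] u iS(4)] by blast
    then have "card ((N (y i) \<inter> P \<union> N (y j) \<inter> P) \<union> (N u \<inter> P)) = card (N (y i) \<inter> P \<union> N (y j) \<inter> P) + card (N u \<inter> P)"
      by (intro card_Un_disjoint) auto
    moreover have "card ((N (y i) \<inter> P \<union> N (y j) \<inter> P) \<union> (N u \<inter> P)) \<le> card P" by (intro card_mono) auto
    moreover have "card (N (y i) \<inter> P \<union> N (y j) \<inter> P) + card (N (y i) \<inter> P \<inter> (N (y j) \<inter> P)) = card (N (y i) \<inter> P) + card (N (y j) \<inter> P)"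
      using card_Un_Int[of "N (y i) \<inter> P" "N (y j) \<inter> P"] by simp
    moreover note inter[OF iS(1,2) ne] cNP[OF u] cNP[OF yD[OF iS(1)]] cNP[OF yD[OF iS(2)]] cP
    ultimately have "15 / 100 * n \<le> 6 * d + 5 * (n / 100)" by linarith
    then show False using err d_nonneg by simp
  qed
  have one_z: "i = j" if u: "u \<in> D" and ij: "i \<in> hits z S u" "j \<in> hits z S u" for i j u
  proof (rule ccontr)
    assume ne: "i \<noteq> j"
    have iS: "i \<in> S" "j \<in> S" "A (z i) u" "A (z j) u" using ij unfolding hits_def by auto
    have "(N (z i) \<inter> P \<union> N (z j) \<inter> P) \<inter> (N u \<inter> P) = {}"
      using adj_D(1)[OF zD[OF iS(1)] u iS(3)] adj_D(1)[OF zD[OF iS(2)] u iS(4)] by blast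
    then have "card ((N (z i) \<inter> P \<union> N (z j) \<inter> P) \<union> (N u \<inter> P)) = card (N (z i) \<inter> P \<union> N (z j) \<inter> P) + card (N u \<inter> P)"
      by (intro card_Un_disjoint) auto
    moreover have "card ((N (z i) \<inter> P \<union> N (z j) \<inter> P) \<union> (N u \<inter> P)) \<le> card P" by (intro card_mono) auto
    moreover have "card (N (z i) \<inter> P \<union> N (z j) \<inter> P) + card (N (z i) \<inter> P \<inter> (N (z j) \<inter> P)) = card (N (z i) \<inter> P) + card (N (z j) \<inter> P)"
      using card_Un_Int[of "N (z i) \<inter> P" "N (z j) \<inter> P"] by simp
    \<comment> \<open>The neighbourhoods of \<open>z i\<close> and \<open>z j\<close> in
      \<open>P\<close> overlap only outside those of \<open>y i\<close> and \<open>y j\<close>, so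
      their intersection is small as well.\<close>
    moreover have "card (N (z i) \<inter> P \<inter> (N (z j) \<inter> P)) + card (N (y i) \<inter> P \<union> N (y j) \<inter> P) \<le> card P"
    proof -
      have "(N (z i) \<inter> P \<inter> (N (z j) \<inter> P)) \<inter> (N (y i) \<inter> P \<union> N (y j) \<inter> P) = {}"
        using adj_D(1)[OF yD[OF iS(1)] zD[OF iS(1)] yz[OF iS(1)]]
          adj_D(1)[OF yD[OF iS(2)] zD[OF iS(2)] yz[OF iS(2)]] by blast
      then have "card ((N (z i) \<inter> P \<inter> (N (z j) \<inter> P)) \<union> (N (y i) \<inter> P \<union> N (y j) \<inter> P))
          = card (N (z i) \<inter> P \<inter> (N (z j) \<inter> P)) + card (N (y i) \<inter> P \<union> N (y j) \<inter> P)"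
        by (intro card_Un_disjoint) auto
      moreover have "card ((N (z i) \<inter> P \<inter> (N (z j) \<inter> P)) \<union> (N (y i) \<inter> P \<union> N (y j) \<inter> P)) \<le> card P"
        by (intro card_mono) auto
      ultimately show ?thesis by linarith
    qed
    moreover have "card (N (y i) \<inter> P \<union> N (y j) \<inter> P) + card (N (y i) \<inter> P \<inter> (N (y j) \<inter> P)) = card (N (y i) \<inter> P) + card (N (y j) \<inter> P)"
      using card_Un_Int[of "N (y i) \<inter> P" "N (y j) \<inter> P"] by simp
    moreover note inter[OF iS(1,2) ne] cNP[OF u] cNP[OF yD[OF iS(1)]] cNP[OF yD[OF iS(2)]]
      cNP[OF zD[OF iS(1)]] cNP[OF zD[OF iS(2)]] cP
    ultimately have "15 / 100 * n \<le> 20 * d + 8 * (n / 100)" using d_nonneg by linarith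
    then show False using err by simp
  qed
  have le1: "card X \<le> 1" if "\<And>i j. i \<in> X \<Longrightarrow> j \<in> X \<Longrightarrow> i = j" "finite X" for X :: "'a set"
    using that card_le_Suc0_iff_eq[of X] by auto
  have main: "hit_count (\<lambda>i. i) y z S u \<le> card S \<and> (u \<in> D \<and> hits y S u \<noteq> {} \<longrightarrow> hit_count (\<lambda>i. i) y z S u < card S)"
    if u: "u \<in> V" for u
    using cr u
  proof (cases rule: crown_hit_cases)
    case X
    have "hits (\<lambda>i. i) S u \<union> hits z S u \<subseteq> S" by (simp add: hits_subset)
    then have "card (hits (\<lambda>i. i) S u \<union> hits z S u) \<le> card S" by (rule card_mono[OF fin])
    then show ?thesis using X unfolding hit_count_def by simp
  next
    case Y
    have "hits y S u \<union> hits z S u \<subseteq> S" by (simp add: hits_subset)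
    then have "card (hits y S u \<union> hits z S u) \<le> card S" by (rule card_mono[OF fin])
    moreover have "card (hits y S u) \<le> 1 \<and> card (hits z S u) \<le> 1" if "u \<in> D"
      using le1[of "hits y S u"] le1[of "hits z S u"] one_y[OF that] one_z[OF that] fin by simp
    ultimately show ?thesis using Y cS unfolding hit_count_def by auto
  next
    case (XY i)
    have iu: "A i u" "A (y i) u" using XY unfolding hits_def by auto
    have "u \<notin> P" using iu(1) XY(1) SP indep_P unfolding indep_def by blast
    moreover have "u \<notin> Q" using D_Q[OF yD[OF XY(1)]] iu(2) by blast
    ultimately have uD: "u \<in> D" using u unfolding D_def by simp
    have "card (hits z S u) \<le> 1" using le1[of "hits z S u"] one_z[OF uD] fin by simp
    then show ?thesis using XY cS unfolding hit_count_def by simp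
  qed
  have "S \<noteq> {}" using cS by auto
  then obtain i where i: "i \<in> S" by auto
  have "N (y i) \<inter> D \<subseteq> {u\<in>V. hit_count (\<lambda>i. i) y z S u < card S}"
  proof
    fix u assume "u \<in> N (y i) \<inter> D"
    then have "u \<in> V" "u \<in> D" "i \<in> hits y S u" using i unfolding hits_def by auto
    then show "u \<in> {u\<in>V. hit_count (\<lambda>i. i) y z S u < card S}" using main[of u] by blast
  qed
  then have "card (N (y i) \<inter> D) \<le> card {u\<in>V. hit_count (\<lambda>i. i) y z S u < card S}"
    using finV by (intro card_mono) simp_all
  also have "\<dots> \<le> 3 * card S * d" by (rule hit_count_deficit[OF fin im]) (rule main[THEN conjunct1])
  finally have "card (N (y i) \<inter> D) \<le> 12 * d" using cS by simp
  moreover have "12 * d < card (N (y i) \<inter> D)" using y i unfolding D1_def by auto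
  ultimately show False by simp
qed

text \<open>The sampling argument again, now with the traces \<open>N b \<inter> P\<close> and a
  sample inside \<open>P\<close>. Crowns of four indices suffice, and \<open>4 * 1000 ^ 3\<close> is
  below \<open>10 ^ 10\<close>.\<close>

lemma colourable_D1: "colourable D1 (10 ^ 10)"
proof -
  let ?f = "\<lambda>b. N b \<inter> P"
  let ?\<Delta> = "\<lambda>u v. card (?f u - ?f v \<union> (?f v - ?f u))"
  have D1D: "D1 \<subseteq> D" unfolding D1_def by auto
  then have fin1: "finite D1" using finD finite_subset by blast
  have "0 < 3 / 10 * n" using n_pos by simp
  moreover have "2 * (3 / 10 * n) \<le> ?\<Delta> u v" if uv: "u \<in> D1" "v \<in> D1" "A u v" for u v
  proof -
    have uvD: "u \<in> D" "v \<in> D" using uv D1D by auto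
    show ?thesis
      using card_sym_diff[of "?f u" "?f v"] adj_D(1)[OF uvD uv(3)] cNP[OF uvD(1)] cNP[OF uvD(2)]
        d_le[of 2] n_pos by simp
  qed
  ultimately consider (col) "colourable D1 (10 ^ 10)"
    | (far) Y where "Y \<subseteq> D1" "card Y = 10 ^ 10"
      "\<And>y y'. y \<in> Y \<Longrightarrow> y' \<in> Y \<Longrightarrow> y \<noteq> y' \<Longrightarrow> 3 / 10 * n \<le> ?\<Delta> y y'"
    using colourable_or_far_family[OF fin1, of ?f "3 / 10 * n" "10 ^ 10"] by auto
  then show ?thesis
  proof cases
    case far
    have finY: "finite Y" using far(1) fin1 finite_subset by blast
    have frac: "2 / 5 * card P \<le> 3 / 10 * n" using cP d_le[of 1] n_pos by simp
    have "2 / 5 * card P \<le> card {u\<in>P. (u \<in> N y) \<noteq> (u \<in> N y')}" if "y \<in> Y" "y' \<in> Y" "y \<noteq> y'" for y y'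
    proof -
      have "{u\<in>P. (u \<in> N y) \<noteq> (u \<in> N y')} = ?f y - ?f y' \<union> (?f y' - ?f y)" by auto
      then show ?thesis using far(3)[OF that] frac by simp
    qed
    moreover have "(real (card Y))\<^sup>2 * (1 - 2 / 5) ^ 1000 < 1"
    proof -
      have "(3 / 5 :: real) ^ 1000 = ((3 / 5)\<^sup>2) ^ 500" by (simp flip: power_mult)
      also have "\<dots> \<le> (1 / 2) ^ 500" by (intro power_mono) (auto simp: power2_eq_square)
      finally have "(real (card Y))\<^sup>2 * (3 / 5) ^ 1000 \<le> (10 ^ 10)\<^sup>2 * (1 / 2) ^ 500"
        unfolding far(2) by (intro mult_mono) auto
      also have "\<dots> < 1" by (simp add: power_divide)
      finally show ?thesis by simp
    qed
    moreover have "P \<noteq> {}"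
    proof -
      obtain a where "a \<in> Q" using Q_ne by auto
      then have "N a \<subseteq> P" unfolding P_def by blast
      moreover have "N a \<noteq> {}"
      proof
        assume "N a = {}"
        then have "n / 3 + 2 * d < 0" using Qpair[OF \<open>a \<in> Q\<close> \<open>a \<in> Q\<close>] by simp
        then show False using n_pos d_nonneg by simp
      qed
      ultimately show ?thesis by blast
    qed
    ultimately obtain T where T: "T \<subseteq> P" "card T \<le> 1000" "inj_on (\<lambda>y. N y \<inter> T) Y"
      using separating_sample[OF finP _ finY, of "2 / 5" N 1000] by auto
    have finT: "finite T" using T(1) finP finite_subset by blast
    have "card ((\<lambda>y. N y \<inter> T) ` Y) = card Y" using T(3) by (rule card_image)
    then have "4 * 1000 ^ (4 - 1) < card ((\<lambda>y. N y \<inter> T) ` Y)" using far(2) by simp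
    then obtain S where S: "S \<subseteq> T" "card S = 4" "shatters ((\<lambda>y. N y \<inter> T) ` Y) S"
      by (rule sauer_shelah[OF finT T(2), rotated 3]) auto
    have "\<exists>y\<in>Y. N y \<inter> S = S - {i}" if "i \<in> S" for i
    proof -
      obtain f where "f \<in> (\<lambda>y. N y \<inter> T) ` Y" "f \<inter> S = S - {i}"
        using S(3) unfolding shatters_def by (meson Diff_subset)
      then obtain y where "y \<in> Y" "N y \<inter> T \<inter> S = S - {i}" by blast
      moreover have "N y \<inter> T \<inter> S = N y \<inter> S" using S(1) by blast
      ultimately show ?thesis by auto
    qed
    then obtain y where y: "\<And>i. i \<in> S \<Longrightarrow> y i \<in> Y \<and> N (y i) \<inter> S = S - {i}" by metis
    have finS: "finite S" using S(1) finT finite_subset by blast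
    have SP: "S \<subseteq> P" using S(1) T(1) by blast
    have YV: "Y \<subseteq> V" using far(1) D1D D_V by blast
    obtain z where cr: "crown (\<lambda>i. i) y z S"
      by (rule shattered_crown[of S y]) (use S SP P_V YV y finS in auto)
    have "3 / 10 * n \<le> ?\<Delta> (y i) (y j)" if ij: "i \<in> S" "j \<in> S" "i \<noteq> j" for i j
    proof -
      have "S - {i} \<noteq> S - {j}" using ij by blast
      then have "y i \<noteq> y j" using y[OF ij(1)] y[OF ij(2)] by metis
      then show ?thesis using far(3) y ij by blast
    qed
    moreover have "y ` S \<subseteq> D1" using y far(1) by blast
    ultimately have False using no_far_crown[OF cr S(2) SP] by blast
    then show ?thesis ..
  qed
qed

text \<open>Vertices of \<open>D - D1\<close> have at least \<open>n/3 - 13 * d\<close> neighbours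
  in \<open>P\<close>, and adjacent ones have disjoint sets of them. As \<open>P\<close> has at most
  \<open>2n/3 + d\<close> elements, these sets are complementary up to
  \<open>27 * d = d + 2 * 13 * d\<close>, so the trace on \<open>P\<close> alternates along a walk
  with this error per step.\<close>

lemma ball_D0:
  assumes v: "v \<in> D - D1"
  shows "u \<in> (expand (D - D1) ^^ i) {v} \<Longrightarrow> u \<in> D - D1 \<and>
    (card (N v \<inter> P - N u) \<le> 27 * d * i \<or> card (N v \<inter> P \<inter> N u) \<le> 27 * d * i)"
proof (induction i arbitrary: u)
  case 0
  then show ?case using v by (auto simp: Diff_Int_distrib2)
next
  case (Suc i)
  have step: "27 * d * i \<le> 27 * d * Suc i" using d_nonneg by (simp add: algebra_simps)
  have big: "n / 3 - 13 * d \<le> card (N b \<inter> P)" if b: "b \<in> D - D1" for b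
    using card_N_D[of b] deg[of b] b D_V unfolding D1_def by auto
  consider "u \<in> (expand (D - D1) ^^ i) {v}" | w where "w \<in> (expand (D - D1) ^^ i) {v}" "A w u" "u \<in> D - D1"
  proof -
    have "u \<in> expand (D - D1) ((expand (D - D1) ^^ i) {v})" using Suc.prems by simp
    then have "u \<in> (expand (D - D1) ^^ i) {v} \<or> (u \<in> D - D1 \<and> (\<exists>w\<in>(expand (D - D1) ^^ i) {v}. A w u))"
      unfolding expand_def[of _ "(expand (D - D1) ^^ i) {v}"] by blast
    then show thesis using that by blast
  qed
  then show ?case
  proof cases
    case 1
    then show ?thesis using Suc.IH[OF 1] step by linarith
  next
    case (2 w)
    have w: "w \<in> D - D1" using Suc.IH[OF 2(1)] by blast
    then have uw: "N w \<inter> P \<inter> (N u \<inter> P) = {}" using adj_D(1)[of w u] 2 by blast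
    from Suc.IH[OF 2(1)] have "card (N v \<inter> P - N w) \<le> 27 * d * i \<or> card (N v \<inter> P \<inter> N w) \<le> 27 * d * i"
      by blast
    then show ?thesis
    proof
      assume h: "card (N v \<inter> P - N w) \<le> 27 * d * i"
      have "card (N v \<inter> P \<inter> N u) \<le> card (N v \<inter> P - N w)" using uw by (intro card_mono) auto
      then show ?thesis using h step 2(3) by linarith
    next
      assume h: "card (N v \<inter> P \<inter> N w) \<le> 27 * d * i"
      have "card (N v \<inter> P - N u) \<le> card ((N v \<inter> P \<inter> N w) \<union> (P - (N w \<inter> P \<union> N u \<inter> P)))"
        by (intro card_mono) auto
      also have "\<dots> \<le> card (N v \<inter> P \<inter> N w) + card (P - (N w \<inter> P \<union> N u \<inter> P))" by (rule card_Un_le)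
      finally have "card (N v \<inter> P - N u) \<le> card (N v \<inter> P \<inter> N w) + card (P - (N w \<inter> P \<union> N u \<inter> P))" .
      moreover have "card (P - (N w \<inter> P \<union> N u \<inter> P)) + card (N w \<inter> P) + card (N u \<inter> P) = card P"
      proof -
        have "card (N w \<inter> P \<union> N u \<inter> P) = card (N w \<inter> P) + card (N u \<inter> P)"
          using uw by (intro card_Un_disjoint) auto
        moreover have "card (P - (N w \<inter> P \<union> N u \<inter> P)) = card P - card (N w \<inter> P \<union> N u \<inter> P)"
          by (intro card_Diff_subset) auto
        moreover have "card (N w \<inter> P \<union> N u \<inter> P) \<le> card P" by (intro card_mono) auto
        ultimately show ?thesis by linarith
      qed
      moreover have "27 * d * Suc i = 27 * d * i + 27 * d" by (simp add: algebra_simps)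
      ultimately have "card (N v \<inter> P - N u) \<le> 27 * d * Suc i"
        using h big[OF w] big[OF 2(3)] cP by linarith
      then show ?thesis using 2(3) by blast
    qed
  qed
qed

text \<open>The two alternatives of \<open>ball_D0\<close> are the colour classes. An edge inside
  the first would need two disjoint sets that each nearly contain \<open>N v \<inter> P\<close>; an
  edge inside the second, three nearly disjoint sets of size about \<open>n/3\<close> in
  \<open>P\<close>.\<close>

lemma locally_bipartite_D0:
  assumes R: "54 * d * R + 40 * d < n / 3"
  shows "locally_bipartite R (D - D1)"
  unfolding locally_bipartite_def
proof (intro ballI)
  fix v assume v: "v \<in> D - D1"
  let ?e = "27 * d * R"
  let ?X = "{u\<in>D - D1. card (N v \<inter> P - N u) \<le> ?e}"
  let ?Y = "{u\<in>D - D1. card (N v \<inter> P \<inter> N u) \<le> ?e}"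
  have big: "n / 3 - 13 * d \<le> card (N b \<inter> P)" if b: "b \<in> D - D1" for b
    using card_N_D[of b] deg[of b] b D_V unfolding D1_def by auto
  have "indep ?X"
    unfolding indep_def
  proof (intro ballI notI)
    fix u w assume uw: "u \<in> ?X" "w \<in> ?X" "A u w"
    then have "N u \<inter> P \<inter> (N w \<inter> P) = {}" using adj_D(1)[of u w] by blast
    then have "N v \<inter> P \<subseteq> (N v \<inter> P - N u) \<union> (N v \<inter> P - N w)" by blast
    then have "card (N v \<inter> P) \<le> card ((N v \<inter> P - N u) \<union> (N v \<inter> P - N w))" by (intro card_mono) auto
    also have "\<dots> \<le> card (N v \<inter> P - N u) + card (N v \<inter> P - N w)" by (rule card_Un_le)
    finally have "card (N v \<inter> P) \<le> ?e + ?e" using uw by auto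
    then show False using big[OF v] R d_nonneg by linarith
  qed
  moreover have "indep ?Y"
    unfolding indep_def
  proof (intro ballI notI)
    fix u w assume uw: "u \<in> ?Y" "w \<in> ?Y" "A u w"
    then have dis: "N u \<inter> P \<inter> (N w \<inter> P) = {}" using adj_D(1)[of u w] by blast
    let ?U = "N u \<inter> P \<union> N w \<inter> P"
    have cU: "card ?U = card (N u \<inter> P) + card (N w \<inter> P)" using dis by (intro card_Un_disjoint) auto
    have "card (?U \<union> (N v \<inter> P)) + card (?U \<inter> (N v \<inter> P)) = card ?U + card (N v \<inter> P)"
      using card_Un_Int[of ?U "N v \<inter> P"] by simp
    moreover have "card (?U \<union> (N v \<inter> P)) \<le> card P" by (intro card_mono) auto
    moreover have "card (?U \<inter> (N v \<inter> P)) \<le> card (N v \<inter> P \<inter> N u) + card (N v \<inter> P \<inter> N w)"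
    proof -
      have "card (?U \<inter> (N v \<inter> P)) \<le> card ((N v \<inter> P \<inter> N u) \<union> (N v \<inter> P \<inter> N w))"
        by (intro card_mono) auto
      then show ?thesis using card_Un_le[of "N v \<inter> P \<inter> N u" "N v \<inter> P \<inter> N w"] by linarith
    qed
    moreover have "card (N v \<inter> P \<inter> N u) \<le> ?e" "card (N v \<inter> P \<inter> N w) \<le> ?e" using uw by auto
    ultimately show False using cU big[OF v] big[of u] big[of w] uw cP R d_nonneg by auto
  qed
  moreover have "(expand (D - D1) ^^ R) {v} \<subseteq> ?X \<union> ?Y" using ball_D0[OF v] by blast
  ultimately show "\<exists>X Y. indep X \<and> indep Y \<and> (expand (D - D1) ^^ R) {v} \<subseteq> X \<union> Y" by blast
qed

lemma colourable_core:
  fixes \<eta> :: real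
  assumes "0 < \<eta>" "n < (1 + \<eta>) ^ m" "\<eta> ^ k * n < 1" "54 * d * (2 * m + 1) + 40 * d < n / 3"
  shows "colourable V (10 ^ 27 + k)"
proof -
  have "54 * d * real (2 * m + 1) + 40 * d < n / 3" using assms(4) by simp
  then have lb: "locally_bipartite (2 * m + 1) (D - D1)" by (rule locally_bipartite_D0)
  have "card (D - D1) \<le> card V" using finV D_V by (intro card_mono) auto
  then have c: "card (D - D1) \<le> n" by simp
  have "\<eta> ^ k * card (D - D1) \<le> \<eta> ^ k * n" using c assms(1) by (intro mult_left_mono) auto
  then have "\<eta> ^ k * card (D - D1) < 1" using assms(3) by linarith
  then have "colourable (D - D1) (k + 1)"
    using c assms(1,2) by (intro colourable_locally_bipartite[OF _ lb]) auto
  then have "colourable ((D - D1) \<union> D1) (k + 1 + 10 ^ 10)" using colourable_D1 by (rule colourable_Un)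
  \<comment> \<open>\<open>Q\<close> and \<open>P\<close> take one colour each; with the colours of
    \<open>D1\<close> the total stays far below \<open>10 ^ 27 + k\<close>.\<close>
  then have "colourable (((D - D1) \<union> D1) \<union> (Q \<union> P)) (k + 1 + 10 ^ 10 + (1 + 1))"
    by (rule colourable_Un[OF _ colourable_Un[OF colourable_indep[OF indep_Q] colourable_indep[OF indep_P]]])
  then show ?thesis by (rule colourable_mono) (auto simp: D_def)
qed

end

lemma (in dense_tf) colourable_dense_tf:
  fixes \<eta> :: real
  assumes "0 < \<eta>" "n < (1 + \<eta>) ^ m" "\<eta> ^ k * n < 1" "54 * d * (2 * m + 1) + 40 * d < n / 3"
  shows "colourable V (10 ^ 27 + k)"
proof (rule colourable_or_core)
  assume "colourable V (10 ^ 27)"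
  then show ?thesis by (rule colourable_mono) auto
next
  fix Q assume "Q \<subseteq> V" "Q \<noteq> {}" "\<And>a a'. a \<in> Q \<Longrightarrow> a' \<in> Q \<Longrightarrow> n / 3 + 2 * d < card (N a \<inter> N a')"
    "card (V - Q - (\<Union>a\<in>Q. N a)) \<le> n / 100"
  then interpret dense_tf_core A V d Q by unfold_locales
  show ?thesis using assms by (rule colourable_core)
qed

text \<open>With \<open>N\<close> bounding the number of vertices, \<open>d\<close> the degree defect and \<open>x \<cdot> d\<close> at most the number of
  vertices, these are the conditions under which the locally bipartite part gets \<open>k + 1\<close> colours.\<close>

definition growth_params :: "real \<Rightarrow> real \<Rightarrow> nat \<Rightarrow> bool" where
  "growth_params N x k \<longleftrightarrow>
     (\<exists>\<eta> m. 0 < \<eta> \<and> N < (1 + \<eta>) ^ m \<and> \<eta> ^ k * N < 1 \<and> 10 ^ 12 * (real m + 1) \<le> x)"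

lemma growth_params_large: "growth_params N x k \<Longrightarrow> 10 ^ 12 \<le> x"
  unfolding growth_params_def by auto

text \<open>This supplies \<open>common\<close> for dense triangle-free pieces of a larger graph.
  Adding edges keeps the degree bound, and a colouring of the extension colours the piece.\<close>

lemma (in sgraph) maximal_triangle_free_extension:
  assumes "finite V" "triangle_free V"
  obtains B where "sgraph B" "\<And>u v. u \<in> V \<Longrightarrow> v \<in> V \<Longrightarrow> A u v \<Longrightarrow> B u v" "sgraph.triangle_free B V"
    "\<And>u v. u \<in> V \<Longrightarrow> v \<in> V \<Longrightarrow> u \<noteq> v \<Longrightarrow> \<not> B u v \<Longrightarrow> \<exists>w\<in>V. B u w \<and> B v w"
proof -
  define ok where "ok E \<longleftrightarrow> E \<subseteq> V \<times> V \<and> (\<forall>u v. (u, v) \<in> E \<longrightarrow> (v, u) \<in> E \<and> u \<noteq> v) \<and>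
    (\<forall>u\<in>V. \<forall>v\<in>V. A u v \<longrightarrow> (u, v) \<in> E) \<and> (\<forall>u v w. \<not> ((u, v) \<in> E \<and> (v, w) \<in> E \<and> (u, w) \<in> E))" for E
  let ?E0 = "{(u, v). u \<in> V \<and> v \<in> V \<and> A u v}"
  have "?E0 \<subseteq> V \<times> V" by blast
  moreover have "\<forall>u v. (u, v) \<in> ?E0 \<longrightarrow> (v, u) \<in> ?E0 \<and> u \<noteq> v" by (simp add: sym) (metis irr)
  moreover have "\<forall>u\<in>V. \<forall>v\<in>V. A u v \<longrightarrow> (u, v) \<in> ?E0" by simp
  moreover have "\<forall>u v w. \<not> ((u, v) \<in> ?E0 \<and> (v, w) \<in> ?E0 \<and> (u, w) \<in> ?E0)"
  proof (intro allI notI)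
    fix u v w assume "(u, v) \<in> ?E0 \<and> (v, w) \<in> ?E0 \<and> (u, w) \<in> ?E0"
    then have "u \<in> V" "v \<in> V" "w \<in> V" "A u v" "A v w" "A u w" by simp_all
    then show False using assms(2) unfolding triangle_free_def by blast
  qed
  ultimately have ok0: "ok ?E0" unfolding ok_def by (intro conjI)
  have bound: "card E < Suc (card (V \<times> V))" if "ok E" for E
  proof -
    have "E \<subseteq> V \<times> V" using that unfolding ok_def by (rule conjunct1)
    then have "card E \<le> card (V \<times> V)" using assms(1) by (intro card_mono) simp_all
    then show ?thesis by simp
  qed
  obtain E where E: "ok E" "\<forall>E'. ok E' \<longrightarrow> card E' \<le> card E"
    using ex_has_greatest_nat[of ok, OF ok0, of card "Suc (card (V \<times> V))"] bound by blast
  define B where "B u v \<longleftrightarrow> (u, v) \<in> E" for u v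
  note okE = E(1)[unfolded ok_def]
  have E1: "E \<subseteq> V \<times> V" using okE by (rule conjunct1)
  have E2: "\<forall>u v. (u, v) \<in> E \<longrightarrow> (v, u) \<in> E \<and> u \<noteq> v"
    using okE[THEN conjunct2] by (rule conjunct1)
  have E3: "\<forall>u\<in>V. \<forall>v\<in>V. A u v \<longrightarrow> (u, v) \<in> E"
    using okE[THEN conjunct2, THEN conjunct2] by (rule conjunct1)
  have E4: "\<forall>u v w. \<not> ((u, v) \<in> E \<and> (v, w) \<in> E \<and> (u, w) \<in> E)"
    using okE[THEN conjunct2, THEN conjunct2] by (rule conjunct2)
  have finE: "finite E" using E1 assms(1) by (meson finite_SigmaI finite_subset)
  have EA: "B u v" if "u \<in> V" "v \<in> V" "A u v" for u v using E3 that unfolding B_def by blast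
  have symB: "B v u" if "B u v" for u v using E2 that unfolding B_def by blast
  have irrB: "\<not> B u u" for u using E2 unfolding B_def by blast
  have tB: "\<not> (B u v \<and> B v w \<and> B u w)" for u v w using E4 unfolding B_def by blast
  have sB: "sgraph B" using symB irrB by unfold_locales
  show thesis
  proof (rule that[of B])
    show "B u v" if "u \<in> V" "v \<in> V" "A u v" for u v using that by (rule EA)
    show "sgraph.triangle_free B V" unfolding sgraph.triangle_free_def[OF sB] using tB by blast
    show "\<exists>w\<in>V. B u w \<and> B v w" if uv: "u \<in> V" "v \<in> V" "u \<noteq> v" "\<not> B u v" for u v
    proof (rule ccontr)
      assume no: "\<not> ?thesis"
      \<comment> \<open>Two nonadjacent vertices without a common neighbour could be joined in both
        directions, contradicting the choice of \<open>E\<close>.\<close>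
      let ?E = "insert (u, v) (insert (v, u) E)"
      have no': "\<not> (B u w \<and> B v w)" for w
        using no E1 unfolding B_def by blast
      have mem: "(a, b) \<in> ?E \<longleftrightarrow> B a b \<or> (a = u \<and> b = v) \<or> (a = v \<and> b = u)" for a b
        unfolding B_def by auto
      have "?E \<subseteq> V \<times> V" using E1 uv by simp
      moreover have "\<forall>a b. (a, b) \<in> ?E \<longrightarrow> (b, a) \<in> ?E \<and> a \<noteq> b"
        unfolding mem using symB irrB uv(3) by metis
      moreover have "\<forall>a\<in>V. \<forall>b\<in>V. A a b \<longrightarrow> (a, b) \<in> ?E" unfolding mem using EA by simp
      moreover have "\<forall>a b w. \<not> ((a, b) \<in> ?E \<and> (b, w) \<in> ?E \<and> (a, w) \<in> ?E)"
        unfolding mem using tB no' symB irrB uv(3) by metis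
      ultimately have "ok ?E" unfolding ok_def by (intro conjI)
      then have "card ?E \<le> card E" using E(2) by blast
      moreover have "card E < card ?E"
        using finE uv(4) unfolding B_def by (intro psubset_card_mono) auto
      ultimately show False by simp
    qed
  qed (rule sB)
qed

lemma (in sgraph) colourable_triangle_free:
  fixes d N :: real
  assumes "finite V" "triangle_free V" "\<And>v. v \<in> V \<Longrightarrow> card V / 3 - d \<le> card (nb V v)" "0 \<le> d"
    "growth_params N x k" "card V \<le> N" "x * d \<le> card V"
  shows "colourable V (10 ^ 27 + k)"
proof (cases "V = {}")
  case True
  then show ?thesis by (simp add: colourable_def)
next
  case False
  obtain B where B: "sgraph B" "\<And>u v. u \<in> V \<Longrightarrow> v \<in> V \<Longrightarrow> A u v \<Longrightarrow> B u v" "sgraph.triangle_free B V"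
    "\<And>u v. u \<in> V \<Longrightarrow> v \<in> V \<Longrightarrow> u \<noteq> v \<Longrightarrow> \<not> B u v \<Longrightarrow> \<exists>w\<in>V. B u w \<and> B v w"
    by (rule maximal_triangle_free_extension[OF assms(1,2)]) (rule that, assumption+)
  interpret B: sgraph B by (rule B(1))
  obtain \<eta> m where p: "0 < \<eta>" "N < (1 + \<eta>) ^ m" "\<eta> ^ k * N < 1" "10 ^ 12 * (real m + 1) \<le> x"
    using assms(5) unfolding growth_params_def by blast
  have npos: "0 < real (card V)" using assms(1) False by (simp add: card_gt_0_iff)
  have md: "10 ^ 12 * (real m + 1) * d \<le> card V"
    using mult_right_mono[OF p(4) assms(4)] assms(7) by linarith
  have m0: "0 \<le> real m * d" using assms(4) by simp
  interpret dense_tf B V d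
  proof unfold_locales
    fix v assume v: "v \<in> V"
    have "nb V v \<subseteq> B.nb V v" using B(2) v by auto
    then have "card (nb V v) \<le> card (B.nb V v)" using assms(1) by (intro card_mono) auto
    then show "card V / 3 - d \<le> card (B.nb V v)" using assms(3)[OF v] by linarith
  next
    show "10 ^ 12 * d \<le> card V" using md m0 by (simp add: algebra_simps)
  qed (use assms(1,4) False B in auto)
  have "\<eta> ^ k * card V \<le> \<eta> ^ k * N" using assms(6) p(1) by (intro mult_left_mono) auto
  then have "\<eta> ^ k * card V < 1" using p(3) by linarith
  moreover have "54 * d * real (2 * m + 1) + 40 * d < card V / 3"
    using md m0 npos assms(4) by (simp add: algebra_simps)
  moreover have "card V < (1 + \<eta>) ^ m" using assms(6) p(2) by linarith
  ultimately have "B.colourable V (10 ^ 27 + k)" using p(1) by (intro colourable_dense_tf) simp_all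
  then show ?thesis unfolding B.colourable_def colourable_def using B(2) by blast
qed

section \<open>Dense graphs without large cliques\<close>

text \<open>The model is the complete multipartite graph with \<open>r - 2\<close> parts of size
  \<open>2 * u\<close> and one of size \<open>u\<close>. Nonneighbours are bounded instead of
  degrees because a part is what its vertices miss; the vertex itself is among them. The square of
  \<open>r\<close> pays for errors that accumulate over about \<open>r\<close> vertices at two
  levels.\<close>

locale dense_kfree = sgraph A for A :: "'a \<Rightarrow> 'a \<Rightarrow> bool" +
  fixes V :: "'a set" and r :: nat and u d :: real
  assumes finV: "finite V" and r4: "4 \<le> r"
    and kfree: "K \<subseteq> V \<Longrightarrow> clique K \<Longrightarrow> card K \<noteq> r"
    and cV: "real (card V) = (2 * real r - 3) * u"
    and nonnbs: "v \<in> V \<Longrightarrow> card {w\<in>V. \<not> A v w} \<le> 2 * u + d"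
    and d_nonneg: "0 \<le> d" and d_small: "10 ^ 8 * (real r)\<^sup>2 * d \<le> u" and u_pos: "0 < u"
begin

text \<open>The unit of measure is \<open>u\<close>; all errors are multiples of \<open>e\<close> or \<open>real r * e\<close>.\<close>

definition e :: real where "e = real r * d"
definition Z :: "'a \<Rightarrow> 'a set" where "Z v = {w\<in>V. \<not> A v w}"
definition cn :: "'a set \<Rightarrow> 'a set" where "cn S = {v\<in>V. \<forall>s\<in>S. A s v}"

lemma Z_V: "Z v \<subseteq> V" and cn_V: "cn S \<subseteq> V"
  unfolding Z_def cn_def by auto

lemma finZ [simp]: "finite (Z v)" and fin_cn [simp]: "finite (cn S)"
  using finV unfolding Z_def cn_def by simp_all

lemma finite_sub: "S \<subseteq> V \<Longrightarrow> finite S"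
  using finV finite_subset by blast

lemma cZ: "v \<in> V \<Longrightarrow> card (Z v) \<le> 2 * u + d"
  unfolding Z_def by (rule nonnbs)

lemma r_real: "4 \<le> real r"
  using r4 by simp

lemma e_bounds: "0 \<le> e" "4 * d \<le> e" "4 * e \<le> real r * e" "10 ^ 8 * (real r * e) \<le> u"
proof -
  show e0: "0 \<le> e" unfolding e_def using d_nonneg by simp
  show "4 * d \<le> e" unfolding e_def using r_real d_nonneg by (rule mult_right_mono)
  show "4 * e \<le> real r * e" using r_real e0 by (rule mult_right_mono)
  show "10 ^ 8 * (real r * e) \<le> u" using d_small unfolding e_def by (simp add: power2_eq_square mult_ac)
qed

lemma indep_card: "indep I \<Longrightarrow> I \<subseteq> V \<Longrightarrow> card I \<le> 2 * u + d"
proof (cases "I = {}")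
  case True
  then show ?thesis using u_pos d_nonneg by simp
next
  case False
  assume I: "indep I" "I \<subseteq> V"
  obtain i where i: "i \<in> I" using False by auto
  have "I \<subseteq> Z i" using I i unfolding indep_def Z_def by auto
  then have "card I \<le> card (Z i)" by (intro card_mono) auto
  then show ?thesis using cZ[of i] i I(2) by auto
qed

lemma greedy_clique:
  assumes "S \<subseteq> V" "real k * (2 * u + d) < card S"
  shows "\<exists>K\<subseteq>S. clique K \<and> card K = k + 1"
  using assms
proof (induction k arbitrary: S)
  case 0
  then have "card S \<noteq> 0" by simp
  then obtain v where "v \<in> S" by fastforce
  then show ?case by (intro exI[of _ "{v}"]) (auto simp: clique_def)
next
  case (Suc k)
  have "0 \<le> real (Suc k) * (2 * u + d)" using u_pos d_nonneg by simp
  then have "card S \<noteq> 0" using Suc.prems(2) by linarith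
  then obtain v where v: "v \<in> S" by fastforce
  have "S - Z v \<subseteq> V" using Suc.prems(1) by blast
  moreover have "real k * (2 * u + d) < card (S - Z v)"
  proof -
    have "card S \<le> card ((S - Z v) \<union> Z v)" using finite_sub[OF Suc.prems(1)] by (intro card_mono) auto
    also have "\<dots> \<le> card (S - Z v) + card (Z v)" by (rule card_Un_le)
    finally show ?thesis using Suc.prems cZ[of v] v by (auto simp: algebra_simps)
  qed
  ultimately obtain K where K: "K \<subseteq> S - Z v" "clique K" "card K = k + 1" using Suc.IH by blast
  have adj: "A v w" if "w \<in> K" for w using that K(1) Suc.prems(1) unfolding Z_def by auto
  then have "v \<notin> K" using irr by blast
  moreover have "finite K" using K(1) finite_sub[OF Suc.prems(1)] finite_subset by blast
  ultimately show ?case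
    using clique_insert[OF K(2) adj] K v by (intro exI[of _ "insert v K"]) auto
qed

text \<open>The common neighbourhood of an edge has no clique on \<open>r - 2\<close> vertices, so
  by the greedy bound \<open>Z v \<union> Z w\<close> has at least about \<open>3 * u\<close>
  elements, whereas the two sizes add up to at most about \<open>4 * u\<close>.\<close>

lemma Z_inter:
  assumes "v \<in> V" "w \<in> V" "A v w"
  shows "card (Z v \<inter> Z w) \<le> u + e"
proof -
  let ?M = "V - (Z v \<union> Z w)"
  have M: "card ?M \<le> real (r - 3) * (2 * u + d)"
  proof (rule ccontr)
    assume "\<not> ?thesis"
    then obtain K where K: "K \<subseteq> ?M" "clique K" "card K = r - 3 + 1"
      using greedy_clique[of ?M "r - 3"] by auto
    have adj: "A v k" "A w k" if "k \<in> K" for k using that K(1) unfolding Z_def by auto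
    have finK: "finite K" using K(1) finite_sub[of K] by blast
    have "clique (insert v (insert w K))"
      using clique_insert[OF clique_insert[OF K(2) adj(2)]] adj(1) assms(3) by blast
    moreover have "v \<notin> insert w K" "w \<notin> K" using adj irr assms(3) by blast+
    then have "card (insert v (insert w K)) = r" using finK K(3) r4 by simp
    moreover have "insert v (insert w K) \<subseteq> V" using K(1) assms by blast
    ultimately show False using kfree by blast
  qed
  have "card (Z v \<union> Z w) + card ?M = card V"
    using finV Z_V by (simp add: card_Diff_subset card_mono)
  moreover have "card (Z v \<union> Z w) + card (Z v \<inter> Z w) = card (Z v) + card (Z w)"
    using card_Un_Int[of "Z v" "Z w"] by simp
  moreover have "real (r - 3) * (2 * u + d) = 2 * (real r * u) + e - 6 * u - 3 * d"
    unfolding e_def using r4 by (simp add: of_nat_diff algebra_simps)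
  moreover have "real (card V) = 2 * (real r * u) - 3 * u" using cV by (simp add: algebra_simps)
  ultimately show ?thesis using M cZ[OF assms(1)] cZ[OF assms(2)] d_nonneg by linarith
qed

text \<open>Two adjacent vertices that each miss more than \<open>\<theta>\<close> of
  \<open>X\<close> would miss more than \<open>2 * \<theta> - card X\<close> common vertices,
  contradicting \<open>Z_inter\<close>.\<close>

lemma indep_heavy:
  assumes "X \<subseteq> V" "u + e + card X \<le> 2 * \<theta>"
  shows "indep {v\<in>V. \<theta> < card (Z v \<inter> X)}"
  unfolding indep_def
proof (intro ballI notI)
  fix v w assume vw: "v \<in> {v\<in>V. \<theta> < card (Z v \<inter> X)}" "w \<in> {v\<in>V. \<theta> < card (Z v \<inter> X)}" "A v w"
  have finX: "finite X" by (rule finite_sub[OF assms(1)])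
  have "card (Z v \<inter> X \<union> Z w \<inter> X) + card (Z v \<inter> X \<inter> (Z w \<inter> X)) = card (Z v \<inter> X) + card (Z w \<inter> X)"
    using card_Un_Int[of "Z v \<inter> X" "Z w \<inter> X"] by simp
  moreover have "card (Z v \<inter> X \<union> Z w \<inter> X) \<le> card X" using finX by (intro card_mono) auto
  moreover have "card (Z v \<inter> X \<inter> (Z w \<inter> X)) \<le> card (Z v \<inter> Z w)" by (intro card_mono) auto
  ultimately show False using Z_inter[of v w] vw assms(2) by auto
qed

end

section \<open>Parts relative to a clique on \<open>r - 1\<close> vertices\<close>

context dense_kfree
begin

definition misses :: "'a set \<Rightarrow> 'a \<Rightarrow> 'a set" where
  "misses T v = {t\<in>T. \<not> A t v}"

definition part :: "'a set \<Rightarrow> 'a \<Rightarrow> 'a set" where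
  "part T t = {v\<in>V. misses T v = {t}}"

definition rest :: "'a set \<Rightarrow> 'a set" where
  "rest T = {v\<in>V. 2 \<le> card (misses T v)}"

lemma part_V: "part T t \<subseteq> V" and rest_V: "rest T \<subseteq> V"
  unfolding part_def rest_def by auto

lemma fin_part [simp]: "finite (part T t)" and fin_rest [simp]: "finite (rest T)"
  using finV unfolding part_def rest_def by simp_all

lemma part_adj: "v \<in> part T t \<Longrightarrow> s \<in> T \<Longrightarrow> s \<noteq> t \<Longrightarrow> A s v"
  unfolding part_def misses_def by blast

lemma part_disjoint: "s \<noteq> t \<Longrightarrow> part T s \<inter> part T t = {}"
  unfolding part_def by auto

lemma part_rest: "part T t \<inter> rest T = {}"
  unfolding part_def rest_def by auto

context
  fixes T :: "'a set"
  assumes TV: "T \<subseteq> V" and cliqT: "clique T" and cT: "card T = r - 1"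
begin

lemma finT: "finite T"
  using TV by (rule finite_sub)

lemma cT_real: "real (card T) = real r - 1"
  using cT r4 by (simp add: of_nat_diff)

lemma misses_ne: assumes "v \<in> V" shows "misses T v \<noteq> {}"
proof
  assume "misses T v = {}"
  then have adj: "A t v" if "t \<in> T" for t using that unfolding misses_def by auto
  then have "v \<notin> T" using irr by blast
  then have "card (insert v T) = r" using finT cT r4 by simp
  moreover have "clique (insert v T)" using adj sym by (intro clique_insert cliqT) auto
  ultimately show False using kfree[of "insert v T"] TV assms by blast
qed

lemma V_parts: "V = (\<Union>t\<in>T. part T t) \<union> rest T"
proof
  show "V \<subseteq> (\<Union>t\<in>T. part T t) \<union> rest T"
  proof
    fix v assume v: "v \<in> V"
    have fin: "finite (misses T v)" unfolding misses_def using finT by simp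
    show "v \<in> (\<Union>t\<in>T. part T t) \<union> rest T"
    proof (cases "2 \<le> card (misses T v)")
      case True
      then show ?thesis using v unfolding rest_def by simp
    next
      case False
      then have "card (misses T v) = 1" using misses_ne[OF v] fin card_gt_0_iff[of "misses T v"] by linarith
      then obtain t where t: "misses T v = {t}" by (auto simp: card_1_singleton_iff)
      then have "t \<in> T" unfolding misses_def by blast
      then show ?thesis using t v unfolding part_def by blast
    qed
  qed
  show "(\<Union>t\<in>T. part T t) \<union> rest T \<subseteq> V" using part_V rest_V by blast
qed

lemma t_part: assumes "t \<in> T" shows "t \<in> part T t"
proof -
  have "misses T t = {t}" using assms cliqT irr unfolding misses_def clique_def by auto
  then show ?thesis using assms TV unfolding part_def by blast
qed

lemma indep_part: assumes t: "t \<in> T" shows "indep (part T t)"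
  unfolding indep_def
proof (intro ballI notI)
  fix v w assume vw: "v \<in> part T t" "w \<in> part T t" "A v w"
  have vwV: "v \<in> V" "w \<in> V" using vw part_V by auto
  let ?L = "T - {t}"
  have adj: "A v s" "A w s" if "s \<in> ?L" for s
    using part_adj[OF vw(1), of s] part_adj[OF vw(2), of s] that sym by auto
  have "clique (insert v (insert w ?L))"
    using clique_insert[OF clique_insert[OF clique_subset[OF cliqT, of ?L] adj(2)]] adj(1) vw(3) by blast
  moreover have "v \<notin> insert w ?L" "w \<notin> ?L" using adj vw(3) irr by blast+
  then have "card (insert v (insert w ?L)) = r" using finT cT r4 t by simp
  ultimately show False using kfree[of "insert v (insert w ?L)"] vwV TV by blast
qed

lemma part_subset_Z: "t \<in> T \<Longrightarrow> v \<in> part T t \<Longrightarrow> part T t \<subseteq> Z v"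
  using indep_part[of t] part_V unfolding indep_def Z_def by blast

lemma part_cn: "part T t \<subseteq> cn (T - {t})"
  using part_adj part_V unfolding cn_def by blast

lemma sum_over_parts:
  assumes "W \<subseteq> V"
  shows "real (card W) = (\<Sum>t\<in>T. real (card (part T t \<inter> W))) + card (rest T \<inter> W)"
proof -
  have "W = (\<Union>t\<in>T. part T t \<inter> W) \<union> (rest T \<inter> W)" using V_parts assms by blast
  moreover have "card ((\<Union>t\<in>T. part T t \<inter> W) \<union> (rest T \<inter> W)) = card (\<Union>t\<in>T. part T t \<inter> W) + card (rest T \<inter> W)"
    using finT part_rest by (intro card_Un_disjoint) auto
  moreover have "card (\<Union>t\<in>T. part T t \<inter> W) = (\<Sum>t\<in>T. card (part T t \<inter> W))"
    using finT part_disjoint by (intro card_UN_disjoint) auto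
  ultimately have "card W = (\<Sum>t\<in>T. card (part T t \<inter> W)) + card (rest T \<inter> W)" by simp
  then show ?thesis by simp
qed

lemma sum_parts: "real (card V) = (\<Sum>t\<in>T. real (card (part T t))) + card (rest T)"
  using sum_over_parts[of V] part_V rest_V by (simp add: Int_absorb2)

lemma card_V_eq: "real (card V) = 2 * (real r * u) - 3 * u"
  using cV by (simp add: algebra_simps)

text \<open>Every vertex misses a member of \<open>T\<close>, and those in \<open>rest T\<close>
  miss two, while the members of \<open>T\<close> together miss at most
  \<open>(r - 1) * (2 * u + d)\<close> vertices.\<close>

lemma card_rest: "card (rest T) \<le> u + e - d"
proof -
  have "(\<Sum>t\<in>T. card (Z t)) = (\<Sum>v\<in>V. card (misses T v))"
    unfolding Z_def misses_def by (rule sum_multicount_gen[OF finT finV]) simp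
  moreover have "(\<Sum>v\<in>V. 1 + (if v \<in> rest T then 1 else 0)) \<le> (\<Sum>v\<in>V. card (misses T v))"
  proof (rule sum_mono)
    fix v assume v: "v \<in> V"
    have "finite (misses T v)" unfolding misses_def using finT by simp
    then have "1 \<le> card (misses T v)" using misses_ne[OF v] card_gt_0_iff[of "misses T v"] by linarith
    then show "1 + (if v \<in> rest T then 1 else 0) \<le> card (misses T v)" unfolding rest_def by simp
  qed
  moreover have "(\<Sum>v\<in>V. 1 + (if v \<in> rest T then 1 else 0)) = card V + card (rest T)"
    unfolding sum.distrib using finV rest_V[of T] by (simp add: sum.If_cases Int_absorb1)
  ultimately have "card V + card (rest T) \<le> (\<Sum>t\<in>T. card (Z t))" by linarith
  then have "real (card V) + card (rest T) \<le> (\<Sum>t\<in>T. real (card (Z t)))" by (simp flip: of_nat_add of_nat_sum)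
  also have "\<dots> \<le> (\<Sum>t\<in>T. 2 * u + d)" using cZ TV by (intro sum_mono) auto
  also have "\<dots> = real (card T) * (2 * u + d)" by simp
  also have "\<dots> = 2 * (real r * u) + e - 2 * u - d" unfolding cT_real e_def by (simp add: algebra_simps)
  finally show ?thesis using card_V_eq by linarith
qed

text \<open>Deficit of a part against the largest possible independent set. It also bounds how many
  vertices outside the part a member misses, so the bound on its sum acts as a budget for missing
  adjacencies.\<close>

definition \<delta> :: "'a \<Rightarrow> real" where "\<delta> t = 2 * u + d - card (part T t)"

lemma sum_\<delta>: "(\<Sum>t\<in>T. \<delta> t) \<le> 2 * u + 2 * e - 2 * d"
proof -
  have "(\<Sum>t\<in>T. \<delta> t) = real (card T) * (2 * u + d) - (\<Sum>t\<in>T. real (card (part T t)))"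
    unfolding \<delta>_def by (simp add: sum_subtractf)
  then have "(\<Sum>t\<in>T. \<delta> t) = (2 * (real r * u) + e - 2 * u - d) - (\<Sum>t\<in>T. real (card (part T t)))"
    unfolding cT_real e_def by (simp add: algebra_simps)
  then show ?thesis using sum_parts card_rest card_V_eq by linarith
qed

lemma \<delta>_nonneg: "t \<in> T \<Longrightarrow> 0 \<le> \<delta> t"
  unfolding \<delta>_def using indep_card[OF indep_part part_V] by simp

lemma Z_minus_part: assumes "t \<in> T" "v \<in> part T t" shows "card (Z v - part T t) \<le> \<delta> t"
proof -
  have "card (Z v - part T t) = card (Z v) - card (part T t)"
    using part_subset_Z[OF assms] by (intro card_Diff_subset) auto
  moreover have "card (part T t) \<le> card (Z v)" using part_subset_Z[OF assms] by (intro card_mono) auto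
  ultimately show ?thesis unfolding \<delta>_def using cZ[of v] assms part_V by auto
qed

text \<open>A vertex \<open>y\<close> whose neighbourhood meets all the parts it misses in a transversal clique would
  complete a clique on \<open>r\<close> vertices; a minimal set of parts without transversal is expensive.\<close>

lemma expensive_parts:
  assumes yV: "y \<in> V" and cm: "card (misses T y) \<ge> 2"
  obtains S where "S \<subseteq> misses T y" "S \<noteq> {}"
    "\<And>t. t \<in> S \<Longrightarrow> 2 * u + d \<le> card (part T t \<inter> Z y) + (\<Sum>s\<in>S. \<delta> s)"
proof -
  let ?M = "misses T y"
  have MT: "?M \<subseteq> T" and finM: "finite ?M" unfolding misses_def using finT by auto
  define tr where "tr S \<longleftrightarrow> (\<exists>f. (\<forall>t\<in>S. f t \<in> part T t \<and> A y (f t)) \<and>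
      (\<forall>s\<in>S. \<forall>t\<in>S. s \<noteq> t \<longrightarrow> A (f s) (f t)))" for S
  have "\<not> tr ?M"
  proof
    assume "tr ?M"
    then obtain f where f: "\<And>t. t \<in> ?M \<Longrightarrow> f t \<in> part T t" "\<And>t. t \<in> ?M \<Longrightarrow> A y (f t)"
      "\<And>s t. s \<in> ?M \<Longrightarrow> t \<in> ?M \<Longrightarrow> s \<noteq> t \<Longrightarrow> A (f s) (f t)" unfolding tr_def by blast
    let ?L = "T - ?M"
    have yL: "A y t" if "t \<in> ?L" for t using that sym unfolding misses_def by blast
    have fL: "A t (f s)" if "t \<in> ?L" "s \<in> ?M" for s t
      using part_adj[OF f(1)[OF that(2)], of t] that by blast
    have injf: "inj_on f ?M"
    proof (rule inj_onI)
      fix s t assume st: "s \<in> ?M" "t \<in> ?M" "f s = f t"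
      show "s = t"
      proof (rule ccontr)
        assume "s \<noteq> t"
        then have "part T s \<inter> part T t = {}" by (rule part_disjoint)
        then show False using f(1)[OF st(1)] f(1)[OF st(2)] st(3) by auto
      qed
    qed
    have "clique (f ` ?M \<union> ?L)"
      unfolding clique_def
    proof (intro ballI impI)
      fix a b assume ab: "a \<in> f ` ?M \<union> ?L" "b \<in> f ` ?M \<union> ?L" "a \<noteq> b"
      consider "a \<in> f ` ?M" "b \<in> f ` ?M" | "a \<in> f ` ?M" "b \<in> ?L" | "a \<in> ?L" "b \<in> f ` ?M" | "a \<in> ?L" "b \<in> ?L"
        using ab by blast
      then show "A a b"
      proof cases
        case 1
        then obtain s t where st: "s \<in> ?M" "t \<in> ?M" "a = f s" "b = f t" by blast
        then have "s \<noteq> t" using ab(3) by blast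
        then show ?thesis using f(3)[OF st(1,2)] st(3,4) by simp
      next
        case 2
        then show ?thesis using fL sym by blast
      next
        case 3
        then show ?thesis using fL by blast
      next
        case 4
        then show ?thesis using cliqT ab(3) unfolding clique_def by blast
      qed
    qed
    then have "clique (insert y (f ` ?M \<union> ?L))"
      by (rule clique_insert) (use f(2) yL in blast)
    moreover have "card (insert y (f ` ?M \<union> ?L)) = r"
    proof -
      have "y \<notin> f ` ?M \<union> ?L" using f(2) yL irr by auto
      moreover have "f ` ?M \<inter> ?L = {}" using fL irr by blast
      moreover have "card (f ` ?M) + card ?L = card T"
        using card_image[OF injf] MT finT finM card_mono[OF finT MT] by (simp add: card_Diff_subset)
      ultimately show ?thesis using finM finT cT r4 by (simp add: card_Un_disjoint)
    qed
    moreover have "insert y (f ` ?M \<union> ?L) \<subseteq> V" using yV f(1) part_V TV by blast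
    ultimately show False using kfree by blast
  qed
  then obtain S where S: "S \<subseteq> ?M" "\<not> tr S" "\<And>S'. S' \<subseteq> ?M \<Longrightarrow> \<not> tr S' \<Longrightarrow> card S \<le> card S'"
    using ex_has_least_nat[of "\<lambda>S. S \<subseteq> ?M \<and> \<not> tr S" ?M card] by blast
  have finS: "finite S" using S(1) finM finite_subset by blast
  show thesis
  proof (rule that[of S])
    show "S \<subseteq> ?M" by (rule S)
    show "S \<noteq> {}" using S(2) unfolding tr_def by auto
    fix t assume t: "t \<in> S"
    have tT: "t \<in> T" using t S(1) MT by blast
    have "tr (S - {t})"
    proof (rule ccontr)
      assume n: "\<not> tr (S - {t})"
      have "S - {t} \<subseteq> ?M" using S(1) by blast
      then have "card S \<le> card (S - {t})" using n by (rule S(3))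
      moreover have "card (S - {t}) < card S" using finS t by (rule card_Diff1_less)
      ultimately show False by simp
    qed
    then obtain f where f: "\<And>s. s \<in> S - {t} \<Longrightarrow> f s \<in> part T s" "\<And>s. s \<in> S - {t} \<Longrightarrow> A y (f s)"
      "\<And>s s'. s \<in> S - {t} \<Longrightarrow> s' \<in> S - {t} \<Longrightarrow> s \<noteq> s' \<Longrightarrow> A (f s) (f s')" unfolding tr_def by blast
    \<comment> \<open>By minimality the other parts of \<open>S\<close> have a transversal
      \<open>f\<close>. A vertex of part \<open>t\<close> that cannot extend it is missed by
      \<open>y\<close>, or by some \<open>f s\<close> from outside the part of
      \<open>s\<close>.\<close>
    have "part T t \<subseteq> (part T t \<inter> Z y) \<union> (\<Union>s\<in>S - {t}. Z (f s) - part T s)"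
    proof
      fix v assume v: "v \<in> part T t"
      show "v \<in> (part T t \<inter> Z y) \<union> (\<Union>s\<in>S - {t}. Z (f s) - part T s)"
      proof (rule ccontr)
        assume n: "v \<notin> (part T t \<inter> Z y) \<union> (\<Union>s\<in>S - {t}. Z (f s) - part T s)"
        have vV: "v \<in> V" using v part_V by blast
        have yv: "A y v" using n v vV unfolding Z_def by blast
        have fv: "A (f s) v" if s: "s \<in> S - {t}" for s
        proof -
          have "v \<notin> part T s" using part_disjoint[of s t T] v s by blast
          then show ?thesis using n s vV unfolding Z_def by blast
        qed
        have "tr S"
          unfolding tr_def
        proof (intro exI[of _ "f(t := v)"] conjI ballI impI)
          fix s assume s: "s \<in> S"
          show "(f(t := v)) s \<in> part T s" using f(1)[of s] v s by simp
          show "A y ((f(t := v)) s)" using f(2)[of s] yv s by simp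
        next
          fix s s' assume ss: "s \<in> S" "s' \<in> S" "s \<noteq> s'"
          then show "A ((f(t := v)) s) ((f(t := v)) s')"
            using f(3)[of s s'] fv[of s] fv[of s'] sym by (cases "s = t"; cases "s' = t") auto
        qed
        then show False using S(2) by blast
      qed
    qed
    then have "card (part T t) \<le> card ((part T t \<inter> Z y) \<union> (\<Union>s\<in>S - {t}. Z (f s) - part T s))"
      using finS by (intro card_mono) auto
    also have "\<dots> \<le> card (part T t \<inter> Z y) + card (\<Union>s\<in>S - {t}. Z (f s) - part T s)" by (rule card_Un_le)
    also have "card (\<Union>s\<in>S - {t}. Z (f s) - part T s) \<le> (\<Sum>s\<in>S - {t}. card (Z (f s) - part T s))"
      using finS by (intro card_UN_le) simp
    finally have "real (card (part T t)) \<le> card (part T t \<inter> Z y) + (\<Sum>s\<in>S - {t}. real (card (Z (f s) - part T s)))"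
      by (simp flip: of_nat_add of_nat_sum)
    also have "(\<Sum>s\<in>S - {t}. real (card (Z (f s) - part T s))) \<le> (\<Sum>s\<in>S - {t}. \<delta> s)"
    proof (rule sum_mono)
      fix s assume s: "s \<in> S - {t}"
      then have "s \<in> T" using S(1) MT by blast
      then show "real (card (Z (f s) - part T s)) \<le> \<delta> s" using Z_minus_part f(1)[OF s] by blast
    qed
    finally have "real (card (part T t)) \<le> card (part T t \<inter> Z y) + (\<Sum>s\<in>S - {t}. \<delta> s)" by simp
    moreover have "(\<Sum>s\<in>S. \<delta> s) = \<delta> t + (\<Sum>s\<in>S - {t}. \<delta> s)" using finS t by (rule sum.remove)
    ultimately show "2 * u + d \<le> card (part T t \<inter> Z y) + (\<Sum>s\<in>S. \<delta> s)" unfolding \<delta>_def[of t] by linarith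
  qed
qed

end

end

section \<open>Parts against a largest common neighbourhood\<close>

context dense_kfree
begin

lemma e_simple_bounds: "0 \<le> e" "4 * d \<le> e" "10000 * e \<le> u"
  using e_bounds by simp_all

text \<open>\<open>X\<close> is a largest common neighbourhood of a clique on \<open>r - 2\<close> vertices and \<open>\<epsilon>\<close> the defect of its
  size; \<open>T\<close> is a clique all of whose vertices see a substantial part of \<open>X\<close>.\<close>

context
  fixes T X :: "'a set" and \<epsilon> :: real
  assumes TV: "T \<subseteq> V" and cliqT: "clique T" and cT: "card T = r - 1"
    and XV: "X \<subseteq> V" and indX: "indep X" and cX: "real (card X) = 2 * u + d - \<epsilon>"
    and Xmax: "\<And>L. L \<subseteq> V \<Longrightarrow> clique L \<Longrightarrow> card L = r - 2 \<Longrightarrow> card (cn L) \<le> card X"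
    and light: "\<And>t. t \<in> T \<Longrightarrow> 2 * real (card (Z t \<inter> X)) \<le> card X + u + e"
begin

lemmas fT = finT[OF TV cliqT cT]

lemma finX: "finite X"
  using XV by (rule finite_sub)

text \<open>\<open>T - {t}\<close> is a clique on \<open>r - 2\<close> vertices, so
  \<open>Xmax\<close> bounds its common neighbourhood, which contains the part.\<close>

lemma part_le: assumes t: "t \<in> T" shows "card (part T t) \<le> 2 * u + d - \<epsilon>"
proof -
  have "card (part T t) \<le> card (cn (T - {t}))" using part_cn[OF TV cliqT cT] by (intro card_mono) auto
  also have "\<dots> \<le> card X"
    using TV t cT fT by (intro Xmax clique_subset[OF cliqT]) auto
  finally show ?thesis using cX by linarith
qed

lemma eps_nonneg: "0 \<le> \<epsilon>"
  using indep_card[OF indX XV] cX by linarith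

lemma eps_delta: "t \<in> T \<Longrightarrow> \<epsilon> \<le> \<delta> T t"
  using part_le[of t] \<delta>_def[OF TV cliqT cT] by simp

text \<open>\<open>\<epsilon>\<close> is at most each of the \<open>r - 1 \<ge> 3\<close> deficits,
  whose sum is at most about \<open>2 * u\<close>.\<close>

lemma eps_le: "\<epsilon> \<le> 2 / 3 * u + 2 * d"
proof (rule ccontr)
  assume n: "\<not> ?thesis"
  have "(\<Sum>t\<in>T. \<epsilon>) \<le> (\<Sum>t\<in>T. \<delta> T t)" using eps_delta by (intro sum_mono)
  then have "(real r - 1) * \<epsilon> \<le> 2 * u + 2 * e - 2 * d"
    using sum_\<delta>[OF TV cliqT cT] cT_real[OF TV cliqT cT] by simp
  then have "(real r - 1) * (\<epsilon> - 2 * d) \<le> 2 * u" unfolding e_def by (simp add: algebra_simps)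
  moreover have "3 * (\<epsilon> - 2 * d) \<le> (real r - 1) * (\<epsilon> - 2 * d)"
    using r_real n u_pos by (intro mult_right_mono) auto
  ultimately have "3 * (\<epsilon> - 2 * d) \<le> 2 * u" by (rule order_trans[rotated])
  then show False using n by simp
qed

lemma X_Z: "x \<in> X \<Longrightarrow> X \<subseteq> Z x"
  using indX XV unfolding indep_def Z_def by blast

lemma Z_minus_X: assumes x: "x \<in> X" shows "card (Z x - X) \<le> \<epsilon>"
proof -
  have "card (Z x - X) = card (Z x) - card X" using X_Z[OF x] finX by (intro card_Diff_subset) auto
  moreover have "card X \<le> card (Z x)" using X_Z[OF x] by (intro card_mono) auto
  ultimately show ?thesis using cZ[of x] x XV cX by auto
qed

definition meet :: "'a set" where "meet = {t\<in>T. part T t \<inter> X \<noteq> {}}"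

lemma meet_T: "meet \<subseteq> T" and fin_meet: "finite meet"
  unfolding meet_def using fT by auto

text \<open>A common vertex \<open>x\<close> misses all of \<open>X\<close> and all of the part, so
  the part fits into \<open>Z x\<close>, which exceeds \<open>X\<close> by at most
  \<open>\<epsilon>\<close>.\<close>

lemma meet_excess: assumes t: "t \<in> meet" shows "card (part T t - X) \<le> \<epsilon>"
proof -
  obtain x where x: "x \<in> part T t" "x \<in> X" "t \<in> T" using t unfolding meet_def by blast
  have "part T t \<subseteq> Z x" using part_subset_Z[OF TV cliqT cT x(3,1)] .
  then have "card (part T t - X) \<le> card (Z x - X)" by (intro card_mono) auto
  then show ?thesis using Z_minus_X[OF x(2)] by linarith
qed

lemma card_part_split: "card (part T t) = card (part T t \<inter> X) + card (part T t - X)"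
  by (metis card_Diff_subset_Int card_mono fin_part finite_Int inf_le1 le_add_diff_inverse)

lemma card_X_split: "real (card X) = (\<Sum>t\<in>meet. real (card (part T t \<inter> X))) + card (rest T \<inter> X)"
proof -
  have "(\<Sum>t\<in>T. real (card (part T t \<inter> X))) = (\<Sum>t\<in>meet. real (card (part T t \<inter> X)))"
    using fT meet_T by (intro sum.mono_neutral_right) (auto simp: meet_def)
  then show ?thesis using sum_over_parts[OF TV cliqT cT XV] by simp
qed

lemma sum_parts_split: "(\<Sum>t\<in>T. real (card (part T t)))
    = (\<Sum>t\<in>T - meet. real (card (part T t))) + (\<Sum>t\<in>meet. real (card (part T t - X))) + card X - card (rest T \<inter> X)"
proof -
  have "(\<Sum>t\<in>meet. real (card (part T t))) = (\<Sum>t\<in>meet. real (card (part T t \<inter> X)) + real (card (part T t - X)))"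
    using card_part_split by (intro sum.cong refl) simp
  then have "(\<Sum>t\<in>meet. real (card (part T t))) = real (card X) - card (rest T \<inter> X) + (\<Sum>t\<in>meet. real (card (part T t - X)))"
    using card_X_split by (simp add: sum.distrib)
  moreover have "(\<Sum>t\<in>T. real (card (part T t))) = (\<Sum>t\<in>T - meet. real (card (part T t))) + (\<Sum>t\<in>meet. real (card (part T t)))"
    using fT meet_T by (rule sum.subset_diff[rotated])
  ultimately show ?thesis by simp
qed

text \<open>Each part in \<open>meet\<close> contributes only \<open>\<epsilon>\<close> beyond
  \<open>X\<close> instead of about \<open>2 * u\<close>, so a large \<open>meet\<close> leaves too
  few vertices to fill \<open>V\<close>.\<close>

lemma meet_bound: "(2 * real (card meet) - 4) * u + (real r - 2 * real (card meet)) * \<epsilon> + card (rest T \<inter> X) \<le> 2 * e"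
proof -
  let ?h = "real (card meet)"
  have h: "real (card (T - meet)) = real r - 1 - ?h"
    using cT_real[OF TV cliqT cT] meet_T fT fin_meet card_mono[OF fT meet_T] by (simp add: card_Diff_subset of_nat_diff)
  have "(\<Sum>t\<in>T - meet. real (card (part T t))) \<le> (\<Sum>t\<in>T - meet. 2 * u + d - \<epsilon>)"
    using part_le by (intro sum_mono) auto
  also have "\<dots> = (real r - 1 - ?h) * (2 * u + d - \<epsilon>)" using h by simp
  also have "\<dots> = 2 * (real r * u) + e - real r * \<epsilon> - 2 * u - d + \<epsilon> - 2 * (?h * u) - ?h * d + ?h * \<epsilon>"
    unfolding e_def by (simp add: algebra_simps)
  finally have 1: "(\<Sum>t\<in>T - meet. real (card (part T t))) \<le> \<dots>" .
  have "(\<Sum>t\<in>meet. real (card (part T t - X))) \<le> (\<Sum>t\<in>meet. \<epsilon>)" using meet_excess by (intro sum_mono)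
  then have 2: "(\<Sum>t\<in>meet. real (card (part T t - X))) \<le> ?h * \<epsilon>" by simp
  have 3: "0 \<le> ?h * d" using d_nonneg by simp
  have goal: "(2 * ?h - 4) * u + (real r - 2 * ?h) * \<epsilon> = 2 * (?h * u) - 4 * u + real r * \<epsilon> - 2 * (?h * \<epsilon>)"
    by (simp add: algebra_simps)
  show ?thesis unfolding goal
    using 1 2 3 sum_parts[OF TV cliqT cT] sum_parts_split card_rest[OF TV cliqT cT] card_V_eq[OF TV cliqT cT] cX d_nonneg
    by linarith
qed

text \<open>Three parts in \<open>meet\<close> cost more than \<open>\<epsilon>\<close>, at most
  about \<open>2/3 u\<close>, can return, because
  \<open>2 * card meet - r \<le> 2 * card meet - 4\<close>.\<close>

lemma card_meet_le: "card meet \<le> 2"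
proof (rule ccontr)
  assume "\<not> ?thesis"
  then have h3: "3 \<le> real (card meet)" by simp
  let ?h = "real (card meet)"
  have "?h \<le> card T" using card_mono[OF fT meet_T] by simp
  then have hr: "?h \<le> real r - 1" using cT_real[OF TV cliqT cT] by simp
  have "(2 * ?h - real r) * \<epsilon> \<le> (2 * ?h - 4) * (2 / 3 * u + 2 * d)"
  proof (cases "2 * ?h \<le> real r")
    case True
    then have "(2 * ?h - real r) * \<epsilon> \<le> 0" using eps_nonneg by (simp add: mult_le_0_iff)
    moreover have "0 \<le> (2 * ?h - 4) * (2 / 3 * u + 2 * d)" using h3 u_pos d_nonneg by simp
    ultimately show ?thesis by linarith
  next
    case False
    then show ?thesis using eps_le eps_nonneg r_real h3 by (intro mult_mono) auto
  qed
  moreover have "(2 * ?h - real r) * \<epsilon> = - ((real r - 2 * ?h) * \<epsilon>)" by (simp add: algebra_simps)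
  ultimately have "(2 * ?h - 4) * u \<le> 2 * e + (2 * ?h - 4) * (2 / 3 * u + 2 * d)"
    using meet_bound by linarith
  then have "(2 * ?h - 4) * (u / 3 - 2 * d) \<le> 2 * e" by (simp add: algebra_simps)
  moreover have "2 * (u / 3 - 2 * d) \<le> (2 * ?h - 4) * (u / 3 - 2 * d)"
    using h3 e_simple_bounds u_pos by (intro mult_right_mono) auto
  ultimately have "2 * (u / 3 - 2 * d) \<le> 2 * e" by (rule order_trans[rotated])
  then show False using e_simple_bounds u_pos by simp
qed

text \<open>If no part meets \<open>X\<close>, then \<open>X\<close> lies in \<open>rest T\<close>,
  which is too small. If only that of \<open>t1\<close> does, lightness gives
  \<open>y \<in> X\<close> adjacent to \<open>t1\<close>. The expensive parts missed by
  \<open>y\<close> are disjoint from \<open>X\<close> and use up nearly all of the deficit budget.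
  Then part \<open>t1\<close> has nearly \<open>2 * u\<close> vertices, almost all in
  \<open>X\<close>, so \<open>t1\<close> misses too much of \<open>X\<close>.\<close>

lemma card_meet_ge: "2 \<le> card meet"
proof (rule ccontr)
  assume "\<not> ?thesis"
  then consider "card meet = 0" | "card meet = 1" by linarith
  then show False
  proof cases
    case 1
    then have "meet = {}" using fin_meet by simp
    then have "real (card X) \<le> card (rest T \<inter> X)" using card_X_split by simp
    also have "\<dots> \<le> card (rest T)" by (simp add: card_mono)
    finally show False using cX eps_le card_rest[OF TV cliqT cT] e_simple_bounds u_pos by linarith
  next
    case 2
    then obtain t1 where t1: "meet = {t1}" by (auto simp: card_1_singleton_iff)
    then have t1T: "t1 \<in> T" using meet_T by auto
    have "X - Z t1 \<noteq> {}"
    proof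
      assume "X - Z t1 = {}"
      then have "Z t1 \<inter> X = X" by blast
      then show False using light[OF t1T] cX eps_le e_simple_bounds u_pos by simp
    qed
    then obtain y where y: "y \<in> X" "y \<notin> Z t1" by blast
    have yV: "y \<in> V" using y(1) XV by blast
    have t1y: "A t1 y" using y yV unfolding Z_def by simp
    have "y \<notin> part T t" if "t \<in> T" for t
    proof
      assume yt: "y \<in> part T t"
      then have "t \<in> meet" using that y(1) unfolding meet_def by blast
      then have "t = t1" using t1 by simp
      then have "t1 \<in> misses T y" using yt unfolding part_def by simp
      then show False using t1y unfolding misses_def by simp
    qed
    then have "y \<in> rest T" using V_parts[OF TV cliqT cT] yV by blast
    then have "2 \<le> card (misses T y)" unfolding rest_def by simp
    then obtain S where S: "S \<subseteq> misses T y" "S \<noteq> {}"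
      "\<And>t. t \<in> S \<Longrightarrow> 2 * u + d \<le> card (part T t \<inter> Z y) + (\<Sum>s\<in>S. \<delta> T s)"
      using expensive_parts[OF TV cliqT cT yV] by metis
    have ST: "S \<subseteq> T - {t1}" using S(1) t1y unfolding misses_def by blast
    have finS: "finite S" using ST fT finite_subset by blast
    have dis: "part T t \<inter> X = {}" if "t \<in> S" for t
    proof -
      have "t \<notin> meet" using t1 ST that by blast
      then show ?thesis using ST that unfolding meet_def by blast
    qed
    have sumZ: "(\<Sum>t\<in>S. real (card (part T t \<inter> Z y))) \<le> \<epsilon>"
    proof -
      have "(\<Sum>t\<in>S. card (part T t \<inter> Z y)) = card (\<Union>t\<in>S. part T t \<inter> Z y)"
        using finS part_disjoint by (intro card_UN_disjoint[symmetric]) auto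
      also have "\<dots> \<le> card (Z y - X)" using dis by (intro card_mono) auto
      finally show ?thesis using Z_minus_X[OF y(1)] by (simp flip: of_nat_sum)
    qed
    have tot: "(\<Sum>s\<in>S. \<delta> T s) + \<delta> T t1 + (\<Sum>s\<in>T - {t1} - S. \<delta> T s) \<le> 2 * u + 2 * e - 2 * d"
    proof -
      have "(\<Sum>s\<in>T. \<delta> T s) = \<delta> T t1 + (\<Sum>s\<in>T - {t1}. \<delta> T s)" using fT t1T by (rule sum.remove)
      moreover have "(\<Sum>s\<in>T - {t1}. \<delta> T s) = (\<Sum>s\<in>T - {t1} - S. \<delta> T s) + (\<Sum>s\<in>S. \<delta> T s)"
        using fT ST by (intro sum.subset_diff) auto
      ultimately show ?thesis using sum_\<delta>[OF TV cliqT cT] by linarith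
    qed
    have rest0: "0 \<le> (\<Sum>s\<in>T - {t1} - S. \<delta> T s)" using \<delta>_nonneg[OF TV cliqT cT] by (intro sum_nonneg) auto
    \<comment> \<open>A single expensive part leaves another part outside \<open>S\<close> whose
      deficit is at least \<open>\<epsilon>\<close> and compensates the loss. With two, one of them
      meets \<open>Z y\<close> in at most \<open>\<epsilon> / 2\<close>, and
      \<open>\<epsilon> \<le> \<delta> T t1\<close>.\<close>
    have d1: "\<delta> T t1 \<le> 4 * e"
    proof (cases "card S = 1")
      case True
      then obtain t where t: "S = {t}" by (auto simp: card_1_singleton_iff)
      have "card (T - {t1} - S) = r - 3"
        using fT t1T ST t cT by (simp add: card_Diff_subset)
      then have "card (T - {t1} - S) \<noteq> 0" using r4 by simp
      then have "T - {t1} - S \<noteq> {}" by (intro notI) simp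
      then obtain s where s: "s \<in> T - {t1} - S" by blast
      have "\<epsilon> \<le> \<delta> T s" using eps_delta[of s] s by simp
      also have "\<dots> \<le> (\<Sum>s\<in>T - {t1} - S. \<delta> T s)"
        using \<delta>_nonneg[OF TV cliqT cT] fT s by (intro member_le_sum) auto
      finally have "\<epsilon> \<le> (\<Sum>s\<in>T - {t1} - S. \<delta> T s)" .
      then show ?thesis using tot S(3)[of t] sumZ t e_simple_bounds d_nonneg by simp
    next
      case False
      then have "\<not> card S \<le> Suc 0" using S(2) finS card_gt_0_iff[of S] by linarith
      then obtain t t' where t: "t \<in> S" "t' \<in> S" "t \<noteq> t'"
        unfolding card_le_Suc0_iff_eq[OF finS] by blast
      have "(\<Sum>s\<in>{t, t'}. real (card (part T s \<inter> Z y))) \<le> (\<Sum>s\<in>S. real (card (part T s \<inter> Z y)))"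
        using finS t by (intro sum_mono2) auto
      then have "card (part T t \<inter> Z y) + card (part T t' \<inter> Z y) \<le> \<epsilon>" using sumZ t(3) by simp
      then show ?thesis using tot rest0 S(3)[OF t(1)] S(3)[OF t(2)] eps_delta[OF t1T] e_simple_bounds d_nonneg by linarith
    qed
    have "real (card (part T t1)) = real (card (part T t1 \<inter> X)) + real (card (part T t1 - X))"
      using card_part_split[of t1] by simp
    moreover have "card (part T t1 - X) \<le> \<epsilon>" using meet_excess t1 by simp
    moreover have "card (part T t1 \<inter> X) \<le> card (Z t1 \<inter> X)"
      using part_subset_Z[OF TV cliqT cT t1T t_part[OF TV cliqT cT t1T]] by (intro card_mono) auto
    then have "real (card (part T t1 \<inter> X)) \<le> real (card (Z t1 \<inter> X))" by simp
    ultimately show False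
      using light[OF t1T] d1 eps_delta[OF t1T] \<delta>_def[OF TV cliqT cT, of t1] cX e_simple_bounds u_pos eps_nonneg d_nonneg by linarith
  qed
qed

text \<open>For \<open>r > 4\<close> this is \<open>meet_bound\<close>. For \<open>r = 4\<close>
  both parts in \<open>meet\<close> have excess nearly \<open>\<epsilon>\<close>, so an
  \<open>x\<close> in one part and in \<open>X\<close> is adjacent to some \<open>v\<close> in the
  other part outside \<open>X\<close>. The pair is a clique on \<open>r - 2\<close> vertices, and
  \<open>Xmax\<close> bounds \<open>Z x \<inter> Z v\<close>, hence the trace of the second part on
  \<open>X\<close>, by about \<open>u - \<epsilon>\<close>. Two such traces do not fill
  \<open>X\<close>.\<close>

lemma eps_small: "\<epsilon> \<le> 20 * e"
proof (rule ccontr)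
  assume n: "\<not> ?thesis"
  have m2: "card meet = 2" using card_meet_le card_meet_ge by simp
  have e0: "0 \<le> e" by (rule e_simple_bounds)
  have r4': "r = 4"
  proof (rule ccontr)
    assume "r \<noteq> 4"
    then have "1 * \<epsilon> \<le> (real r - 4) * \<epsilon>" using r4 eps_nonneg by (intro mult_right_mono) auto
    also have "\<dots> \<le> 2 * e" using meet_bound m2 by simp
    finally show False using n e0 by simp
  qed
  obtain t1 t2 where t12: "meet = {t1, t2}" "t1 \<noteq> t2" using m2 by (auto simp: card_2_iff)
  have cV4: "real (card V) = 5 * u" using cV r4' by simp
  have e4: "e = 4 * d" unfolding e_def using r4' by simp
  have tm: "card (T - meet) = 1" using cT r4' m2 meet_T fin_meet by (simp add: card_Diff_subset)
  then obtain t3 where t3: "T - meet = {t3}" by (auto simp: card_1_singleton_iff)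
  have sumX: "real (card X) = card (part T t1 \<inter> X) + card (part T t2 \<inter> X) + card (rest T \<inter> X)"
    using card_X_split t12 by simp
  have "real (card V) = real (card (part T t3)) + (real (card (part T t1 - X)) + card (part T t2 - X)) + card X
      - card (rest T \<inter> X) + card (rest T)"
    using sum_parts[OF TV cliqT cT] sum_parts_split t12 t3 by simp
  moreover have "card (part T t3) \<le> 2 * u + d - \<epsilon>" using part_le t3 by blast
  ultimately have E12: "2 * \<epsilon> - 2 * e \<le> card (part T t1 - X) + card (part T t2 - X)"
    using cV4 cX card_rest[OF TV cliqT cT] e_simple_bounds d_nonneg by linarith
  have small: "card (part T t \<inter> X) \<le> u + 3 * d - \<epsilon>"
    if s: "s \<in> meet" and t: "t \<in> meet" and st: "{s, t} = {t1, t2}" for s t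
  proof -
    have sT: "s \<in> T" "t \<in> T" using s t meet_T by auto
    have "card (part T s - X) + card (part T t - X) = card (part T t1 - X) + card (part T t2 - X)"
      using st t12(2) by (auto simp: doubleton_eq_iff)
    then have E: "\<epsilon> - 2 * e \<le> card (part T s - X)" "\<epsilon> - 2 * e \<le> card (part T t - X)"
      using E12 meet_excess[OF s] meet_excess[OF t] by linarith+
    obtain x where x: "x \<in> part T s" "x \<in> X" using s unfolding meet_def by blast
    have "part T s \<subseteq> Z x" using part_subset_Z[OF TV cliqT cT sT(1) x(1)] .
    then have "card (Z x - X - (part T s - X)) + card (part T s - X) = card (Z x - X)"
      by (subst card_Diff_subset) (auto intro!: card_mono le_add_diff_inverse2)
    then have "card (Z x - X - (part T s - X)) \<le> 2 * e" using E(1) Z_minus_X[OF x(2)] by linarith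
    moreover have "s \<noteq> t" using st t12(2) by (auto simp: doubleton_eq_iff)
    then have "part T s \<inter> part T t = {}" by (rule part_disjoint)
    then have "card (Z x \<inter> (part T t - X)) \<le> card (Z x - X - (part T s - X))" by (intro card_mono) auto
    ultimately have "card (Z x \<inter> (part T t - X)) < card (part T t - X)" using E(2) n e0 by linarith
    then have "Z x \<inter> (part T t - X) \<noteq> part T t - X" by auto
    then obtain v where v: "v \<in> part T t" "v \<notin> X" "v \<notin> Z x" by blast
    have vV: "v \<in> V" and xV: "x \<in> V" using v(1) x(2) part_V XV by auto
    have xv: "A x v" using v(3) vV unfolding Z_def by simp
    have "clique {x, v}" using xv sym unfolding clique_def by auto
    moreover have "card {x, v} = r - 2" using xv irr r4' by (auto simp: card_insert_if)
    ultimately have "card (cn {x, v}) \<le> card X" using vV xV by (intro Xmax) auto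
    moreover have "card (Z x \<union> Z v) + card (cn {x, v}) = card V"
    proof -
      have "cn {x, v} = V - (Z x \<union> Z v)" unfolding cn_def Z_def by auto
      then show ?thesis using finV Z_V by (simp add: card_Diff_subset card_mono)
    qed
    moreover have "card (Z x \<union> Z v) + card (Z x \<inter> Z v) = card (Z x) + card (Z v)"
      using card_Un_Int[of "Z x" "Z v"] by simp
    moreover have "card (part T t \<inter> X) \<le> card (Z x \<inter> Z v)"
      using X_Z[OF x(2)] part_subset_Z[OF TV cliqT cT sT(2) v(1)] by (intro card_mono) auto
    ultimately show ?thesis using cV4 cX cZ[OF xV] cZ[OF vV] by linarith
  qed
  have "card (part T t2 \<inter> X) \<le> u + 3 * d - \<epsilon>" using small[of t1 t2] t12 by simp
  moreover have "card (part T t1 \<inter> X) \<le> u + 3 * d - \<epsilon>" using small[of t2 t1] t12 by (simp add: insert_commute)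
  moreover have "card (rest T \<inter> X) \<le> 2 * e" using meet_bound m2 r4' by simp
  ultimately show False using sumX cX n e4 d_nonneg by linarith
qed

text \<open>\<open>X\<close> replaces the two parts that meet it and is filed under the index
  \<open>t1\<close>. The remaining \<open>r - 3\<close> parts are disjoint from \<open>X\<close> and
  must be nearly full for \<open>V\<close> to have its size.\<close>

lemma near_multipartite:
  obtains J :: "'a set" and I where "finite J" "card J = r - 2" "\<And>j. j \<in> J \<Longrightarrow> I j \<subseteq> V \<and> indep (I j) \<and> 2 * u - 50 * e \<le> card (I j)"
    "\<And>i j. i \<in> J \<Longrightarrow> j \<in> J \<Longrightarrow> i \<noteq> j \<Longrightarrow> I i \<inter> I j = {}"
proof -
  have m2: "card meet = 2" using card_meet_le card_meet_ge by simp
  then obtain t1 t2 where t12: "meet = {t1, t2}" "t1 \<noteq> t2" by (auto simp: card_2_iff)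
  have t1T: "t1 \<in> T" "t2 \<in> T" using t12 meet_T by auto
  have ctm: "real (card (T - meet)) = real r - 3"
    using cT_real[OF TV cliqT cT] m2 meet_T fin_meet fT card_mono[OF fT meet_T] by (simp add: card_Diff_subset of_nat_diff)
  have big: "2 * u - 50 * e \<le> card (part T t)" if t: "t \<in> T - meet" for t
  proof -
    have "(\<Sum>s\<in>T - meet. real (card (part T s))) = card (part T t) + (\<Sum>s\<in>T - meet - {t}. real (card (part T s)))"
      using fT t by (intro sum.remove) auto
    also have "(\<Sum>s\<in>T - meet - {t}. real (card (part T s))) \<le> (\<Sum>s\<in>T - meet - {t}. 2 * u + d)"
      using part_le eps_nonneg by (intro sum_mono) force
    also have "\<dots> = (real r - 4) * (2 * u + d)"
      using card.remove[of "T - meet" t] fT t ctm by simp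
    also have "\<dots> = 2 * (real r * u) + e - 8 * u - 4 * d" unfolding e_def by (simp add: algebra_simps)
    finally have "(\<Sum>s\<in>T - meet. real (card (part T s))) \<le> card (part T t) + (2 * (real r * u) + e - 8 * u - 4 * d)" by simp
    moreover have "(\<Sum>s\<in>meet. real (card (part T s - X))) \<le> 40 * e"
    proof -
      have "(\<Sum>s\<in>meet. real (card (part T s - X))) \<le> (\<Sum>s\<in>meet. 20 * e)"
        using meet_excess eps_small by (intro sum_mono) force
      then show ?thesis using m2 by simp
    qed
    ultimately show ?thesis
      using sum_parts[OF TV cliqT cT] sum_parts_split card_rest[OF TV cliqT cT] card_V_eq[OF TV cliqT cT] cX eps_nonneg e_simple_bounds d_nonneg
      by linarith
  qed
  define I where "I t = (if t = t1 then X else part T t)" for t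
  show thesis
  proof (rule that[of "T - {t2}" I])
    show "finite (T - {t2})" using fT by simp
    show "card (T - {t2}) = r - 2" using cT t1T by simp
    show "I j \<subseteq> V \<and> indep (I j) \<and> 2 * u - 50 * e \<le> card (I j)" if j: "j \<in> T - {t2}" for j
    proof (cases "j = t1")
      case True
      then show ?thesis unfolding I_def using XV indX cX eps_small e_simple_bounds d_nonneg by simp
    next
      case False
      then have "j \<in> T - meet" using j t12 by blast
      then show ?thesis unfolding I_def using False big[of j] part_V indep_part[OF TV cliqT cT, of j] by simp
    qed
    have dis: "part T t \<inter> X = {}" if "t \<in> T - {t2}" "t \<noteq> t1" for t
    proof -
      have "t \<notin> meet" "t \<in> T" using that t12 by blast+
      then show ?thesis unfolding meet_def by blast
    qed
    show "I i \<inter> I j = {}" if ij: "i \<in> T - {t2}" "j \<in> T - {t2}" "i \<noteq> j" for i j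
      using dis[OF ij(1)] dis[OF ij(2)] part_disjoint[OF ij(3), of T] ij(3) unfolding I_def by auto
  qed
qed

end

theorem reducible_or_multipartite:
  obtains C where "C \<subseteq> V" "indep C" "\<And>K. K \<subseteq> V - C \<Longrightarrow> clique K \<Longrightarrow> card K \<noteq> r - 1"
  | J :: "'a set" and I where "finite J" "card J = r - 2" "\<And>j. j \<in> J \<Longrightarrow> I j \<subseteq> V \<and> indep (I j) \<and> 2 * u - 50 * e \<le> card (I j)"
    "\<And>i j. i \<in> J \<Longrightarrow> j \<in> J \<Longrightarrow> i \<noteq> j \<Longrightarrow> I i \<inter> I j = {}"
proof (cases "\<exists>K. K \<subseteq> V \<and> clique K \<and> card K = r - 1")
  case False
  then show thesis using that(1)[of "{}"] by (auto simp: indep_def)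
next
  case True
  then obtain K where K: "K \<subseteq> V" "clique K" "card K = r - 1" by blast
  then obtain k where k: "k \<in> K" using r4 by (cases "K = {}") auto
  define good where "good L \<longleftrightarrow> L \<subseteq> V \<and> clique L \<and> card L = r - 2" for L
  have "good (K - {k})" unfolding good_def using K k clique_subset[OF K(2)] finite_sub[OF K(1)] by auto
  moreover have "card (cn L) < Suc (card V)" for L
    using finV cn_V by (simp add: less_Suc_eq_le card_mono)
  ultimately obtain L where L: "good L" "\<forall>L'. good L' \<longrightarrow> card (cn L') \<le> card (cn L)"
    using ex_has_greatest_nat[of good "K - {k}" "\<lambda>L. card (cn L)" "Suc (card V)"] by blast
  define X where "X = cn L"
  have LV: "L \<subseteq> V" "clique L" "card L = r - 2" using L(1) unfolding good_def by auto
  have XV: "X \<subseteq> V" unfolding X_def by (rule cn_V)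
  have indX: "indep X"
    unfolding indep_def
  proof (intro ballI notI)
    fix v w assume vw: "v \<in> X" "w \<in> X" "A v w"
    have adj: "A v s" "A w s" if "s \<in> L" for s using vw that sym unfolding X_def cn_def by auto
    have "clique (insert v (insert w L))"
      using clique_insert[OF clique_insert[OF LV(2) adj(2)]] adj(1) vw(3) by blast
    moreover have "v \<notin> insert w L" "w \<notin> L" using adj vw(3) irr by blast+
    then have "card (insert v (insert w L)) = r" using finite_sub[OF LV(1)] LV(3) r4 by simp
    moreover have "insert v (insert w L) \<subseteq> V" using vw XV LV(1) by blast
    ultimately show False using kfree by blast
  qed
  \<comment> \<open>The smallest threshold that \<open>indep_heavy\<close> allows; vertices outside
    \<open>C\<close> satisfy \<open>light\<close>.\<close>
  define C where "C = {v\<in>V. (card X + u + e) / 2 < card (Z v \<inter> X)}"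
  have indC: "indep C" unfolding C_def by (rule indep_heavy[OF XV]) simp
  show thesis
  proof (cases "\<exists>T. T \<subseteq> V - C \<and> clique T \<and> card T = r - 1")
    case False
    then show thesis using that(1)[of C] indC unfolding C_def by auto
  next
    case True
    then obtain T where T: "T \<subseteq> V - C" "clique T" "card T = r - 1" by blast
    have TV: "T \<subseteq> V" using T(1) by blast
    have light: "2 * real (card (Z t \<inter> X)) \<le> card X + u + e" if "t \<in> T" for t
      using that T(1) unfolding C_def by (auto simp: not_less)
    have Xmax: "card (cn L') \<le> card X" if "L' \<subseteq> V" "clique L'" "card L' = r - 2" for L'
      using L(2) that unfolding good_def X_def by blast
    have cX: "real (card X) = 2 * u + d - (2 * u + d - card X)" by simp
    show thesis
    proof (rule near_multipartite[OF TV T(2,3) XV indX cX])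
      show "card (cn L') \<le> card X" if "L' \<subseteq> V" "clique L'" "card L' = r - 2" for L'
        using that by (rule Xmax)
      show "2 * real (card (Z t \<inter> X)) \<le> card X + u + e" if "t \<in> T" for t using that by (rule light)
    next
      fix J :: "'a set" and I
      assume a: "finite J" "card J = r - 2"
        "\<And>j. j \<in> J \<Longrightarrow> I j \<subseteq> V \<and> indep (I j) \<and> 2 * u - 50 * e \<le> card (I j)"
        "\<And>i j. i \<in> J \<Longrightarrow> j \<in> J \<Longrightarrow> i \<noteq> j \<Longrightarrow> I i \<inter> I j = {}"
      show thesis by (rule that(2)[OF a])
    qed
  qed
qed

end

section \<open>Colouring nearly multipartite graphs\<close>

lemma (in sgraph) colourable_pieces:
  assumes "0 < K" "\<And>j. j \<in> J \<Longrightarrow> colourable (B j) K"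
    and "\<And>i j. i \<in> J \<Longrightarrow> j \<in> J \<Longrightarrow> i \<noteq> j \<Longrightarrow> B i \<inter> B j = {}"
    and "\<And>v w. v \<in> W \<Longrightarrow> w \<in> W \<Longrightarrow> A v w \<Longrightarrow> \<exists>j\<in>J. v \<in> B j \<and> w \<in> B j"
  shows "colourable W K"
proof -
  have ex: "\<forall>j\<in>J. \<exists>c::'a \<Rightarrow> nat. (\<forall>v\<in>B j. c v < K) \<and> (\<forall>u\<in>B j. \<forall>v\<in>B j. A u v \<longrightarrow> c u \<noteq> c v)"
    using assms(2) unfolding colourable_def by simp
  obtain c :: "'b \<Rightarrow> 'a \<Rightarrow> nat" where
    c: "\<forall>j\<in>J. (\<forall>v\<in>B j. c j v < K) \<and> (\<forall>u\<in>B j. \<forall>v\<in>B j. A u v \<longrightarrow> c j u \<noteq> c j v)"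
    using bchoice[OF ex] by (elim exE)
  define p where "p v = (SOME j. j \<in> J \<and> v \<in> B j)" for v
  have p: "p v = j" if "j \<in> J" "v \<in> B j" for v j
  proof -
    have "p v \<in> J \<and> v \<in> B (p v)" unfolding p_def using that by (intro someI[of "\<lambda>j. j \<in> J \<and> v \<in> B j" j] conjI)
    then show ?thesis using assms(3)[of "p v" j] that by blast
  qed
  \<comment> \<open>A vertex of \<open>W\<close> in no piece has no neighbour in \<open>W\<close>,
    so the colour 0 serves.\<close>
  define c' where "c' v = (if \<exists>j\<in>J. v \<in> B j then c (p v) v else 0)" for v
  have c': "c' v = c j v" if "j \<in> J" "v \<in> B j" for v j
    using that p[OF that] unfolding c'_def by auto
  show ?thesis
    unfolding colourable_def
  proof (intro exI[of _ c'] conjI ballI impI)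
    fix v
    show "c' v < K"
    proof (cases "\<exists>j\<in>J. v \<in> B j")
      case True
      then obtain j where j: "j \<in> J" "v \<in> B j" by blast
      then show ?thesis using c c'[OF j] by simp
    next
      case False
      then show ?thesis unfolding c'_def using assms(1) by simp
    qed
  next
    fix v w assume vw: "v \<in> W" "w \<in> W" "A v w"
    then obtain j where j: "j \<in> J" "v \<in> B j" "w \<in> B j" using assms(4) by blast
    then show "c' v \<noteq> c' w" using c c'[OF j(1,2)] c'[OF j(1,3)] vw(3) by simp
  qed
qed

context dense_kfree
begin

context
  fixes J :: "'a set" and I :: "'a \<Rightarrow> 'a set"
  assumes finJ: "finite J" and cJ: "card J = r - 2"
    and I: "\<And>j. j \<in> J \<Longrightarrow> I j \<subseteq> V \<and> indep (I j) \<and> 2 * u - 50 * e \<le> card (I j)"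
    and dis: "\<And>i j. i \<in> J \<Longrightarrow> j \<in> J \<Longrightarrow> i \<noteq> j \<Longrightarrow> I i \<inter> I j = {}"
begin

abbreviation E where "E \<equiv> real r * e"

lemma E_bounds: "0 \<le> e" "0 \<le> E" "4 * d \<le> e" "4 * e \<le> E" "10000000 * E \<le> u"
  using e_bounds by simp_all

lemma I_le: "j \<in> J \<Longrightarrow> card (I j) \<le> 2 * u + d"
  using I indep_card by blast

lemma finI: "j \<in> J \<Longrightarrow> finite (I j)"
  using I finite_sub by blast

lemma I_miss: assumes j: "j \<in> J" and i: "i \<in> I j" shows "card (Z i - I j) \<le> 51 * e"
proof -
  have sub: "I j \<subseteq> Z i" using I[OF j] i unfolding indep_def Z_def by blast
  then have "card (Z i - I j) = card (Z i) - card (I j)" using finI[OF j] by (intro card_Diff_subset)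
  moreover have "card (I j) \<le> card (Z i)" using sub by (intro card_mono) auto
  moreover have "i \<in> V" using I[OF j] i by blast
  ultimately show ?thesis using cZ[of i] I[OF j] E_bounds by auto
qed

text \<open>Greedy choice: a vertex chosen in one class misses at most \<open>51 * e\<close> of
  another, and at most \<open>r\<close> choices add up to \<open>51 * E\<close>; what
  \<open>S\<close> leaves of \<open>I j\<close> must exceed this.\<close>

lemma transversal:
  assumes "J' \<subseteq> J" "finite S" "\<And>j. j \<in> J' \<Longrightarrow> (\<Sum>s\<in>S. real (card (Z s \<inter> I j))) + 51 * E < card (I j)"
  shows "\<exists>F \<subseteq> (\<Union>j\<in>J'. I j). clique F \<and> card F = card J' \<and> (\<forall>f\<in>F. \<forall>s\<in>S. A s f)"
proof -
  have "finite J'" using assms(1) finJ finite_subset by blast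
  then show ?thesis using assms(1,3)
  proof (induction J' rule: finite_induct)
    case empty
    show ?case by (intro exI[of _ "{}"]) (simp add: clique_def)
  next
    case (insert j J')
    obtain F where F: "F \<subseteq> (\<Union>j\<in>J'. I j)" "clique F" "card F = card J'" "\<forall>f\<in>F. \<forall>s\<in>S. A s f"
      using insert.IH insert.prems by auto
    have jJ: "j \<in> J" "J' \<subseteq> J" using insert.prems(1) by auto
    have finF: "finite F" using F(1) finI jJ(2) insert.hyps(1) finite_subset[OF F(1)] by blast
    have Fmiss: "card (Z f \<inter> I j) \<le> 51 * e" if f: "f \<in> F" for f
    proof -
      obtain i where i: "i \<in> J'" "f \<in> I i" using F(1) f by blast
      have iJ: "i \<in> J" "i \<noteq> j" using i(1) jJ(2) insert.hyps(2) by auto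
      have "Z f \<inter> I j \<subseteq> Z f - I i" using dis[OF iJ(1) jJ(1) iJ(2)] by blast
      then have "card (Z f \<inter> I j) \<le> card (Z f - I i)" by (intro card_mono) auto
      then show ?thesis using I_miss[OF iJ(1) i(2)] by linarith
    qed
    let ?U = "(\<Union>s\<in>S. Z s \<inter> I j) \<union> (\<Union>f\<in>F. Z f \<inter> I j)"
    have "card ?U \<le> card (\<Union>s\<in>S. Z s \<inter> I j) + card (\<Union>f\<in>F. Z f \<inter> I j)" by (rule card_Un_le)
    also have "\<dots> \<le> (\<Sum>s\<in>S. card (Z s \<inter> I j)) + (\<Sum>f\<in>F. card (Z f \<inter> I j))"
      using assms(2) finF by (intro add_mono card_UN_le)
    finally have "real (card ?U) \<le> (\<Sum>s\<in>S. real (card (Z s \<inter> I j))) + (\<Sum>f\<in>F. real (card (Z f \<inter> I j)))"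
      by (simp flip: of_nat_sum of_nat_add)
    also have "(\<Sum>f\<in>F. real (card (Z f \<inter> I j))) \<le> (\<Sum>f\<in>F. 51 * e)" using Fmiss by (intro sum_mono)
    also have "(\<Sum>f\<in>F. 51 * e) = 51 * (real (card F) * e)" by simp
    also have "\<dots> \<le> 51 * E"
    proof -
      have "card F \<le> r" using F(3) card_mono[OF finJ jJ(2)] cJ by simp
      then show ?thesis using E_bounds(1) by (intro mult_left_mono mult_right_mono) auto
    qed
    finally have "card ?U < card (I j)" using insert.prems(2)[of j] by simp
    then have "?U \<noteq> I j" by auto
    then obtain i where i: "i \<in> I j" "i \<notin> ?U" by blast
    have iV: "i \<in> V" using i(1) I[OF jJ(1)] by blast
    have Si: "A s i" if "s \<in> S" for s using i iV that unfolding Z_def by blast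
    have Fi: "A f i" if "f \<in> F" for f using i iV that unfolding Z_def by blast
    have "i \<notin> F" using Fi irr by blast
    show ?case
    proof (intro exI[of _ "insert i F"] conjI)
      show "insert i F \<subseteq> (\<Union>j\<in>insert j J'. I j)" using F(1) i(1) by blast
      show "clique (insert i F)" using clique_insert[OF F(2)] Fi sym by blast
      show "card (insert i F) = card (insert j J')" using F(3) finF \<open>i \<notin> F\<close> insert.hyps by simp
      show "\<forall>f\<in>insert i F. \<forall>s\<in>S. A s f" using F(4) Si by blast
    qed
  qed
qed

lemma no_rich_clique:
  assumes "J' \<subseteq> J" "S \<subseteq> V" "clique S" "card S + card J' = r"
    "\<And>j. j \<in> J' \<Longrightarrow> (\<Sum>s\<in>S. real (card (Z s \<inter> I j))) + 51 * E < card (I j)"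
  shows False
proof -
  have finS: "finite S" using assms(2) by (rule finite_sub)
  obtain F where F: "F \<subseteq> (\<Union>j\<in>J'. I j)" "clique F" "card F = card J'" "\<forall>f\<in>F. \<forall>s\<in>S. A s f"
    using transversal[OF assms(1) finS assms(5)] by blast
  have FV: "F \<subseteq> V" using F(1) I assms(1) by blast
  have "clique (S \<union> F)" using assms(3) F(2,4) sym unfolding clique_def by blast
  moreover have "S \<inter> F = {}" using F(4) irr by blast
  then have "card (S \<union> F) = r" using finS finite_sub[OF FV] F(3) assms(4) by (simp add: card_Un_disjoint)
  ultimately show False using kfree[of "S \<union> F"] FV assms(2) by blast
qed

text \<open>Otherwise the edge would extend by one vertex from each of the \<open>r - 2\<close>
  classes to a clique on \<open>r\<close> vertices.\<close>

lemma no_rich_edge: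
  assumes "v \<in> V" "w \<in> V" "A v w"
  obtains j where "j \<in> J" "card (I j) - 51 * E \<le> real (card (Z v \<inter> I j)) + card (Z w \<inter> I j)"
proof -
  note out = that
  have vw: "v \<noteq> w" using assms(3) irr by blast
  show thesis
  proof (rule ccontr)
    assume n: "\<not> thesis"
    have lt: "real (card (Z v \<inter> I j)) + card (Z w \<inter> I j) < card (I j) - 51 * E" if jJ: "j \<in> J" for j
    proof (rule ccontr)
      assume "\<not> ?thesis"
      then have thesis by (intro out[OF jJ]) simp
      then show False using n by blast
    qed
    show False
    proof (rule no_rich_clique[of J "{v, w}"])
      show "clique {v, w}" using assms(3) sym unfolding clique_def by blast
      show "card {v, w} + card J = r" using vw cJ r4 by simp
      show "(\<Sum>s\<in>{v, w}. real (card (Z s \<inter> I j))) + 51 * E < card (I j)" if "j \<in> J" for j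
        using lt[OF that] vw by simp
    qed (use assms in auto)
  qed
qed

definition UI :: "'a set" where "UI = (\<Union>j\<in>J. I j)"
text \<open>Stands in for the small part of the model.\<close>

definition Qg :: "'a set" where "Qg = {q\<in>V - UI. card (Z q \<inter> UI) \<le> u / 100}"
text \<open>The factor \<open>8/5\<close> lies above \<open>3/2\<close>, which
  \<open>indep_heavy\<close> needs for classes of size about \<open>2 * u\<close>, and below 2, so
  that a vertex that is not heavy and a vertex of \<open>Qg\<close> cannot exhaust a class. Members
  of \<open>I j\<close> are heavy themselves.\<close>

definition heavy :: "'a \<Rightarrow> 'a set" where "heavy j = {v\<in>V. 8 / 5 * u < card (Z v \<inter> I j)}"
definition B :: "'a set" where "B = V - (\<Union>j\<in>J. heavy j)"
text \<open>By \<open>B_UI\<close> a vertex of \<open>B\<close> misses hardly more than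
  \<open>u\<close> within \<open>UI\<close>, and the ends of an edge nearly exhaust some class of
  size about \<open>2 * u\<close>, so each misses about \<open>u\<close> there. Belonging to two
  pieces would need \<open>9/5 u\<close>.\<close>

definition piece :: "'a \<Rightarrow> 'a set" where "piece j = {v\<in>B. 9 / 10 * u \<le> card (Z v \<inter> I j)}"

lemma UI_V: "UI \<subseteq> V" and Qg_V: "Qg \<subseteq> V" and B_V: "B \<subseteq> V"
  unfolding UI_def Qg_def B_def using I by blast+

lemma finUI [simp]: "finite UI" and finQg [simp]: "finite Qg"
  using finite_sub[OF UI_V] finite_sub[OF Qg_V] by simp_all

lemma Z_I_UI: "j \<in> J \<Longrightarrow> card (Z v \<inter> I j) \<le> card (Z v \<inter> UI)"
  unfolding UI_def by (intro card_mono) auto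

lemma Z_I_I: assumes "i \<in> J" "j \<in> J" "i \<noteq> j"
  shows "card (Z v \<inter> I i) + card (Z v \<inter> I j) \<le> card (Z v \<inter> UI)"
proof -
  have "card (Z v \<inter> I i) + card (Z v \<inter> I j) = card ((Z v \<inter> I i) \<union> (Z v \<inter> I j))"
    using dis[OF assms] by (intro card_Un_disjoint[symmetric]) auto
  also have "\<dots> \<le> card (Z v \<inter> UI)" unfolding UI_def using assms by (intro card_mono) auto
  finally show ?thesis .
qed

text \<open>At least \<open>u - e\<close> vertices lie outside the classes. A member of a class
  misses at most \<open>51 * e\<close> of them, and each one not in \<open>Qg\<close> misses more
  than \<open>u / 100\<close> members, so double counting bounds the latter by
  \<open>10200 * E\<close>.\<close>

lemma card_Qg: "u - 10300 * E \<le> card Qg"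
proof -
  let ?Q = "V - UI"
  have finQ: "finite ?Q" using finV by simp
  have "real (card UI) \<le> (\<Sum>j\<in>J. real (card (I j)))"
    unfolding UI_def using card_UN_le[OF finJ, of I] by (simp flip: of_nat_sum)
  also have "\<dots> \<le> (\<Sum>j\<in>J. 2 * u + d)" using I_le by (intro sum_mono)
  also have "\<dots> = (real r - 2) * (2 * u + d)" using cJ r4 by (simp add: of_nat_diff)
  also have "\<dots> = 2 * (real r * u) + e - 4 * u - 2 * d" unfolding e_def by (simp add: algebra_simps)
  finally have cUI: "card UI \<le> 2 * (real r * u) + e - 4 * u - 2 * d" .
  have cVr: "real (card V) = 2 * (real r * u) - 3 * u" using cV by (simp add: algebra_simps)
  have "real (card ?Q) = card V - card UI"
    using UI_V finV by (simp add: card_Diff_subset card_mono of_nat_diff)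
  then have cQ: "u - e \<le> card ?Q" using cUI cVr d_nonneg by linarith
  have "(\<Sum>q\<in>?Q - Qg. u / 100) \<le> (\<Sum>q\<in>?Q. real (card (Z q \<inter> UI)))"
  proof -
    have "(\<Sum>q\<in>?Q - Qg. u / 100) \<le> (\<Sum>q\<in>?Q - Qg. real (card (Z q \<inter> UI)))"
      by (intro sum_mono) (auto simp: Qg_def)
    also have "\<dots> \<le> (\<Sum>q\<in>?Q. real (card (Z q \<inter> UI)))" using finQ by (intro sum_mono2) auto
    finally show ?thesis .
  qed
  also have "\<dots> = (\<Sum>i\<in>UI. real (card {q\<in>?Q. \<not> A q i}))"
  proof -
    have "Z q \<inter> UI = {i\<in>UI. \<not> A q i}" for q unfolding Z_def using UI_V by blast
    then have "(\<Sum>q\<in>?Q. card (Z q \<inter> UI)) = (\<Sum>q\<in>?Q. card {i\<in>UI. \<not> A q i})" by simp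
    also have "\<dots> = (\<Sum>i\<in>UI. card {q\<in>?Q. \<not> A q i})" by (rule sum_multicount_gen[OF finQ finUI]) simp
    finally show ?thesis by (simp flip: of_nat_sum)
  qed
  also have "\<dots> \<le> (\<Sum>i\<in>UI. 51 * e)"
  proof (rule sum_mono)
    fix i assume "i \<in> UI"
    then obtain j where j: "j \<in> J" "i \<in> I j" unfolding UI_def by blast
    have "{q\<in>?Q. \<not> A q i} \<subseteq> Z i - I j" unfolding Z_def UI_def using j sym by blast
    then have "card {q\<in>?Q. \<not> A q i} \<le> card (Z i - I j)" by (intro card_mono) auto
    then show "real (card {q\<in>?Q. \<not> A q i}) \<le> 51 * e" using I_miss[OF j] by linarith
  qed
  also have "\<dots> = 51 * (real (card UI) * e)" by simp
  also have "\<dots> \<le> 51 * ((2 * (real r * u)) * e)"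
    using cUI E_bounds u_pos d_nonneg by (intro mult_left_mono mult_right_mono) auto
  also have "\<dots> = 102 * E * u" by simp
  finally have "real (card (?Q - Qg)) * u \<le> (10200 * E) * u" by simp
  then have bad: "card (?Q - Qg) \<le> 10200 * E" using u_pos by simp
  have "card ?Q \<le> card ((?Q - Qg) \<union> Qg)" using finQ by (intro card_mono) auto
  then have "card ?Q \<le> card (?Q - Qg) + card Qg" using card_Un_le[of "?Q - Qg" Qg] by linarith
  then show ?thesis using cQ bad E_bounds by linarith
qed

lemma heavy_indep: assumes "j \<in> J" shows "indep (heavy j)"
  unfolding heavy_def
  by (rule indep_heavy) (use I[OF assms] I_le[OF assms] E_bounds u_pos d_nonneg in auto)

lemma B_light: "v \<in> B \<Longrightarrow> j \<in> J \<Longrightarrow> card (Z v \<inter> I j) \<le> 8 / 5 * u"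
  unfolding B_def heavy_def by (auto simp: not_less)

lemma Qg_light: "q \<in> Qg \<Longrightarrow> j \<in> J \<Longrightarrow> card (Z q \<inter> I j) \<le> u / 100"
  using Z_I_UI[of j q] unfolding Qg_def by auto

lemma Qg_B: assumes "q \<in> Qg" "v \<in> Qg \<union> B" shows "\<not> A q v"
proof
  assume a: "A q v"
  have V: "q \<in> V" "v \<in> V" using assms Qg_V B_V by auto
  obtain j where j: "j \<in> J" "card (I j) - 51 * E \<le> real (card (Z q \<inter> I j)) + card (Z v \<inter> I j)"
    using no_rich_edge[OF V a] .
  have "card (Z v \<inter> I j) \<le> 8 / 5 * u"
    using assms(2) B_light[of v j] Qg_light[of v j] j(1) u_pos by auto
  then show False using j Qg_light[OF assms(1) j(1)] I[OF j(1)] E_bounds u_pos by auto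
qed

lemma indep_Qg: "indep Qg"
  unfolding indep_def using Qg_B by blast

text \<open>\<open>v\<close> misses all of \<open>Qg\<close>, at least about \<open>u\<close>
  vertices, which leaves about \<open>u\<close> of its \<open>2 * u\<close> nonneighbours for
  \<open>UI\<close>.\<close>

lemma B_UI: assumes v: "v \<in> B" shows "card (Z v \<inter> UI) \<le> u + 10301 * E"
proof -
  have "Qg \<subseteq> Z v" using Qg_B v Qg_V sym unfolding Z_def by blast
  moreover have "Qg \<inter> UI = {}" unfolding Qg_def by blast
  ultimately have "card ((Z v \<inter> UI) \<union> Qg) = card (Z v \<inter> UI) + card Qg"
    by (intro card_Un_disjoint) auto
  moreover have "card ((Z v \<inter> UI) \<union> Qg) \<le> card (Z v)"
    using \<open>Qg \<subseteq> Z v\<close> by (intro card_mono) auto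
  ultimately show ?thesis using cZ[of v] v B_V card_Qg E_bounds by auto
qed

lemma piece_disjoint: assumes "i \<in> J" "j \<in> J" "i \<noteq> j" shows "piece i \<inter> piece j = {}"
proof (rule equals0I)
  fix v assume v: "v \<in> piece i \<inter> piece j"
  then have "v \<in> B" unfolding piece_def by blast
  then show False using v Z_I_I[OF assms, of v] B_UI[of v] E_bounds u_pos unfolding piece_def by auto
qed

lemma edge_piece:
  assumes "v \<in> B" "w \<in> B" "A v w"
  shows "\<exists>j\<in>J. v \<in> piece j \<and> w \<in> piece j"
proof -
  have V: "v \<in> V" "w \<in> V" using assms B_V by auto
  obtain j where j: "j \<in> J" "card (I j) - 51 * E \<le> real (card (Z v \<inter> I j)) + card (Z w \<inter> I j)"
    using no_rich_edge[OF V assms(3)] .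
  have "9 / 10 * u \<le> card (Z v \<inter> I j)" "9 / 10 * u \<le> card (Z w \<inter> I j)"
    using j I[OF j(1)] B_UI[OF assms(1)] B_UI[OF assms(2)] Z_I_UI[OF j(1), of v] Z_I_UI[OF j(1), of w]
      E_bounds u_pos by auto
  then show ?thesis using j(1) assms(1,2) unfolding piece_def by blast
qed

text \<open>\<open>piece j\<close> may be small and sparse. With \<open>I j\<close> and
  \<open>Qg\<close> it has at least about \<open>3 * u\<close> vertices, each of which misses at
  most \<open>2 * u + d\<close>, so the degree condition of one third is restored.\<close>

definition host :: "'a \<Rightarrow> 'a set" where "host j = I j \<union> Qg \<union> piece j"

lemma host_light:
  assumes "j \<in> J" "l \<in> J" "l \<noteq> j" "v \<in> host j"
  shows "card (Z v \<inter> I l) \<le> u / 5"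
proof -
  consider "v \<in> I j" | "v \<in> Qg" | "v \<in> piece j" using assms(4) unfolding host_def by blast
  then show ?thesis
  proof cases
    case 1
    have "card (Z v \<inter> I l) \<le> card (Z v - I j)" using dis[OF assms(1,2)] assms(3) by (intro card_mono) auto
    then show ?thesis using I_miss[OF assms(1) 1] E_bounds by linarith
  next
    case 2
    then show ?thesis using Qg_light[OF 2 assms(2)] u_pos by simp
  next
    case 3
    then have vB: "v \<in> B" unfolding piece_def by blast
    have "card (Z v \<inter> I j) + card (Z v \<inter> I l) \<le> card (Z v \<inter> UI)"
      using Z_I_I assms by blast
    then show ?thesis using 3 B_UI[OF vB] E_bounds u_pos unfolding piece_def by auto
  qed
qed

lemma host_V: "j \<in> J \<Longrightarrow> host j \<subseteq> V"
  unfolding host_def piece_def using I Qg_V B_V by blast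

text \<open>A triangle would extend through the other \<open>r - 3\<close> classes to a clique on
  \<open>r\<close> vertices, since its members together miss at most \<open>3/5 u\<close> of each
  class.\<close>

lemma triangle_free_host: assumes j: "j \<in> J" shows "triangle_free (host j)"
  unfolding triangle_free_def
proof (intro ballI notI)
  fix a b c assume abc: "a \<in> host j" "b \<in> host j" "c \<in> host j" "A a b \<and> A b c \<and> A a c"
  have ne: "a \<noteq> b" "b \<noteq> c" "a \<noteq> c" using abc(4) irr by blast+
  show False
  proof (rule no_rich_clique[of "J - {j}" "{a, b, c}"])
    show "{a, b, c} \<subseteq> V" using abc host_V[OF j] by blast
    show "clique {a, b, c}" using abc(4) sym unfolding clique_def by blast
    show "card {a, b, c} + card (J - {j}) = r" using ne j cJ finJ r4 by simp
    show "(\<Sum>s\<in>{a, b, c}. real (card (Z s \<inter> I l))) + 51 * E < card (I l)" if l: "l \<in> J - {j}" for l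
      using host_light[OF j, of l a] host_light[OF j, of l b] host_light[OF j, of l c] l abc ne
        I[of l] E_bounds u_pos by auto
  qed auto
qed

lemma colourable_host:
  fixes N x :: real
  assumes j: "j \<in> J" and "growth_params N x k" "card V \<le> N" "x * (20000 * E) \<le> u"
  shows "colourable (host j) (10 ^ 27 + k)"
proof -
  have fin: "finite (host j)" using host_V[OF j] by (rule finite_sub)
  have "I j \<inter> Qg = {}" unfolding Qg_def UI_def using j by blast
  then have "card (I j \<union> Qg) = card (I j) + card Qg" using finI[OF j] by (intro card_Un_disjoint) auto
  moreover have "card (I j \<union> Qg) \<le> card (host j)" using fin unfolding host_def by (intro card_mono) auto
  ultimately have big: "3 * u - 10400 * E \<le> card (host j)" using I[OF j] card_Qg E_bounds by auto
  have "card (host j) \<le> card V" using host_V[OF j] finV by (intro card_mono) auto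
  then have "card (host j) \<le> N" using assms(3) by linarith
  moreover have "card (host j) / 3 - 20000 * E \<le> card (nb (host j) v)" if v: "v \<in> host j" for v
  proof -
    have "{w\<in>host j. \<not> A v w} \<subseteq> Z v" unfolding Z_def using host_V[OF j] by blast
    then have "card {w\<in>host j. \<not> A v w} \<le> card (Z v)" by (intro card_mono) auto
    moreover have "card {w\<in>host j. \<not> A v w} + card (nb (host j) v) = card (host j)"
      using card_nonnbs[OF fin] .
    moreover have "v \<in> V" using v host_V[OF j] by blast
    ultimately show ?thesis using cZ[of v] big E_bounds by simp
  qed
  moreover have "x * (20000 * E) \<le> card (host j)" using assms(4) big E_bounds u_pos by linarith
  ultimately show ?thesis
    using fin triangle_free_host[OF j] assms(2) E_bounds(2)
    by (intro colourable_triangle_free[of "host j" "20000 * E" N x k]) auto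
qed

lemma colourable_near_multipartite:
  fixes N x :: real
  assumes "growth_params N x k" "card V \<le> N" "x * (20000 * E) \<le> u"
  shows "colourable V (10 ^ 27 + k + (r - 1))"
proof -
  have "colourable B (10 ^ 27 + k)"
  proof (rule colourable_pieces[of _ J piece])
    show "colourable (piece j) (10 ^ 27 + k)" if "j \<in> J" for j
      using colourable_host[OF that assms] by (rule colourable_mono) (auto simp: host_def)
    show "piece i \<inter> piece j = {}" if "i \<in> J" "j \<in> J" "i \<noteq> j" for i j using that by (rule piece_disjoint)
    show "\<exists>j\<in>J. v \<in> piece j \<and> w \<in> piece j" if "v \<in> B" "w \<in> B" "A v w" for v w
      using that by (rule edge_piece)
  qed simp
  then have cQB: "colourable (Qg \<union> B) (1 + (10 ^ 27 + k))"
    by (rule colourable_Un[OF colourable_indep[OF indep_Qg]])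
  have "colourable (\<Union>j\<in>J. heavy j) (card J)"
    using finJ heavy_indep by (rule colourable_UN_indep)
  then have "colourable ((\<Union>j\<in>J. heavy j) \<union> (Qg \<union> B)) (card J + (1 + (10 ^ 27 + k)))"
    using cQB by (rule colourable_Un)
  moreover have "V \<subseteq> (\<Union>j\<in>J. heavy j) \<union> (Qg \<union> B)" unfolding B_def by blast
  moreover have "card J + (1 + (10 ^ 27 + k)) \<le> 10 ^ 27 + k + (r - 1)" using cJ r4 by simp
  ultimately show ?thesis by (rule colourable_mono)
qed

end

end

section \<open>Induction on the clique number\<close>

fun defect_const :: "nat \<Rightarrow> real" where
  "defect_const 0 = 1"
| "defect_const (Suc r) = (if r < 3 then 1
     else 20000 * (real (Suc r))\<^sup>2 * (2 * real (Suc r) - 3) + 8 * defect_const r)"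

lemma defect_const_pos: "0 < defect_const r"
proof (induction r)
  case (Suc r)
  then show ?case by (auto intro!: add_nonneg_pos)
qed simp

text \<open>Removing an independent set costs one colour and at most doubles the defect. In
  \<open>defect_const\<close> the first summand serves the nearly multipartite case, where
  \<open>20000 * E\<close> must be small against \<open>u\<close>; the factor 8 allows for a doubled
  defect on at least a quarter of the vertices.\<close>

theorem (in sgraph) colourable_clique_free:
  fixes d N x :: real
  assumes "3 \<le> r" "finite V" "\<And>L. L \<subseteq> V \<Longrightarrow> clique L \<Longrightarrow> card L \<noteq> r"
    "\<And>v. v \<in> V \<Longrightarrow> card {w\<in>V. \<not> A v w} \<le> 2 * card V / (2 * real r - 3) + d" "0 \<le> d"
    "growth_params N x k" "card V \<le> N" "defect_const r * x * d \<le> card V"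
  shows "colourable V (10 ^ 27 + k + r)"
  using assms
proof (induction r arbitrary: V d rule: dec_induct)
  case base
  note fin = base(1) and free = base(2) and non = base(3) and d = base(4) and g = base(5-7)
    have "triangle_free V"
      unfolding triangle_free_def
    proof (intro ballI notI)
      fix a b c assume abc: "a \<in> V" "b \<in> V" "c \<in> V" "A a b \<and> A b c \<and> A a c"
      have "a \<noteq> b" "b \<noteq> c" "a \<noteq> c" using abc(4) irr by blast+
      then have "card {a, b, c} = 3" by simp
      moreover have "clique {a, b, c}" using abc(4) sym unfolding clique_def by blast
      ultimately show False using free[of "{a, b, c}"] abc by blast
    qed
    moreover have "card V / 3 - d \<le> card (nb V v)" if v: "v \<in> V" for v
    proof -
      have "card {w\<in>V. \<not> A v w} + card (nb V v) = card V" using card_nonnbs[OF fin] .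
      moreover have "card {w\<in>V. \<not> A v w} \<le> 2 * card V / (2 * real 3 - 3) + d" using non[OF v] .
      ultimately show ?thesis by simp
    qed
    ultimately have "colourable V (10 ^ 27 + k)"
      using g d fin by (intro colourable_triangle_free[of V d N x k]) (auto simp: numeral_3_eq_3)
    then show "colourable V (10 ^ 27 + k + 3)" by (rule colourable_mono) auto
next
  case (step r)
  note IH = step.IH and fin = step.prems(1) and free = step.prems(2) and non = step.prems(3)
    and d = step.prems(4) and g = step.prems(5-7)
  define s where "s = 2 * real (Suc r) - 3"
  have s5: "5 \<le> s" unfolding s_def using step.hyps by simp
  define K0 where "K0 = defect_const r"
  define K where "K = defect_const (Suc r)"
  have K0: "0 < K0" unfolding K0_def by (rule defect_const_pos)
  have "K = 20000 * (real (Suc r))\<^sup>2 * s + 8 * K0" unfolding K_def K0_def s_def using step.hyps by simp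
  then have K: "0 < K" "8 * K0 \<le> K" "20000 * (real (Suc r))\<^sup>2 * s \<le> K" using K0 s5 by (auto intro!: add_nonneg_pos)
  have g: "growth_params N x k" "card V \<le> N" "K * x * d \<le> card V" using g unfolding K_def .
    show "colourable V (10 ^ 27 + k + Suc r)"
    proof (cases "V = {}")
      case True
      then show ?thesis by (simp add: colourable_def)
    next
      case False
      define u where "u = card V / s"
      have x: "10 ^ 12 \<le> x" using growth_params_large[OF g(1)] .
      have xd: "0 \<le> x * d" using x d by simp
      have cVs: "real (card V) = s * u" unfolding u_def using s5 by simp
      have npos: "0 < real (card V)" using False fin by (simp add: card_gt_0_iff)
      then have u0: "0 < u" unfolding u_def using s5 by simp
      have big: "20000 * (real (Suc r))\<^sup>2 * (x * d) \<le> u"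
      proof -
        have "(20000 * (real (Suc r))\<^sup>2 * s) * (x * d) \<le> K * (x * d)" using K(3) xd by (rule mult_right_mono)
        then have "s * (20000 * (real (Suc r))\<^sup>2 * (x * d)) \<le> s * u" using g(3) cVs by (simp add: mult_ac)
        then show ?thesis using s5 by simp
      qed
      interpret dense_kfree A V "Suc r" u d
      proof unfold_locales
        show "finite V" by (rule fin)
        show "4 \<le> Suc r" using step.hyps by simp
        show "card L \<noteq> Suc r" if "L \<subseteq> V" "clique L" for L using that by (rule free)
        show "real (card V) = (2 * real (Suc r) - 3) * u" using cVs unfolding s_def .
        show "card {w\<in>V. \<not> A v w} \<le> 2 * u + d" if "v \<in> V" for v
          using non[OF that] unfolding u_def s_def by simp
        show "0 \<le> d" "0 < u" by (rule d, rule u0)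
        have "20000 * (real (Suc r))\<^sup>2 * (10 ^ 12 * d) \<le> 20000 * (real (Suc r))\<^sup>2 * (x * d)"
          using x d by (intro mult_left_mono mult_right_mono) auto
        then have "20000 * (real (Suc r))\<^sup>2 * (10 ^ 12 * d) \<le> u" using big by linarith
        moreover have "0 \<le> (real (Suc r))\<^sup>2 * d" using d by simp
        moreover have "20000 * (real (Suc r))\<^sup>2 * (10 ^ 12 * d) = 20000 * 10 ^ 12 * ((real (Suc r))\<^sup>2 * d)"
          "10 ^ 8 * (real (Suc r))\<^sup>2 * d = 10 ^ 8 * ((real (Suc r))\<^sup>2 * d)" by simp_all
        ultimately show "10 ^ 8 * (real (Suc r))\<^sup>2 * d \<le> u" by simp
      qed
      show ?thesis
      proof (rule reducible_or_multipartite)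
        fix C assume C: "C \<subseteq> V" "indep C" "\<And>L. L \<subseteq> V - C \<Longrightarrow> clique L \<Longrightarrow> card L \<noteq> Suc r - 1"
        have "real (card (V - C)) = real (card V) - card C"
          using finite_subset[OF C(1) fin] card_mono[OF fin C(1)] C(1) by (simp add: card_Diff_subset of_nat_diff)
        then have cVC: "s * u - 2 * u - d \<le> card (V - C)" using indep_card[OF C(2,1)] cVs by linarith
        have le: "card (V - C) \<le> card V" using fin by (intro card_mono) auto
        have d_u: "d \<le> u"
        proof -
          have "1 \<le> (real (Suc r))\<^sup>2" by (intro one_le_power) simp
          then have "1 * 1 \<le> 10 ^ 8 * (real (Suc r))\<^sup>2" by (intro mult_mono) auto
          then have "1 * 1 * d \<le> 10 ^ 8 * (real (Suc r))\<^sup>2 * d" using d by (rule mult_right_mono)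
          then show ?thesis using d_small by linarith
        qed
        have "colourable (V - C) (10 ^ 27 + k + r)"
        proof (rule IH[of "V - C" "2 * d"])
          show "finite (V - C)" using fin by simp
          show "card L \<noteq> r" if "L \<subseteq> V - C" "clique L" for L using C(3)[OF that] by simp
          show "0 \<le> 2 * d" using d by simp
          show "growth_params N x k" by (rule g)
          show "card (V - C) \<le> N" using le g(2) by linarith
          show "card {w\<in>V - C. \<not> A v w} \<le> 2 * card (V - C) / (2 * real r - 3) + 2 * d"
            if v: "v \<in> V - C" for v
          proof -
            have "{w\<in>V - C. \<not> A v w} \<subseteq> {w\<in>V. \<not> A v w}" by blast
            then have "card {w\<in>V - C. \<not> A v w} \<le> card {w\<in>V. \<not> A v w}" using fin by (intro card_mono) auto
            then have "card {w\<in>V - C. \<not> A v w} \<le> 2 * u + d" using nonnbs[of v] v by auto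
            \<comment> \<open>Removing exactly \<open>2 * u\<close> vertices would keep the unit
              \<open>u\<close>, since the factor drops from \<open>s\<close> to
              \<open>s - 2\<close>; the possible surplus \<open>d\<close> is why the defect
              grows.\<close>
            moreover have "2 * u - d \<le> 2 * card (V - C) / (2 * real r - 3)"
            proof -
              have s2: "2 * real r - 3 = s - 2" unfolding s_def by simp
              have "(2 * u - d) * (s - 2) \<le> 2 * card (V - C)"
              proof -
                have "d * 2 \<le> d * (s - 2)" using d s5 by (intro mult_left_mono) auto
                then show ?thesis using cVC by (simp add: algebra_simps)
              qed
              then show ?thesis unfolding s2 using s5 by (simp add: pos_le_divide_eq)
            qed
            ultimately show ?thesis by linarith
          qed
          have "8 * K0 * (x * d) \<le> K * (x * d)" using K(2) xd by (rule mult_right_mono)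
          then have "8 * (K0 * (x * d)) \<le> s * u" using g(3) cVs by (simp add: mult_ac)
          moreover have "s * u \<le> 4 * card (V - C)"
          proof -
            have "5 * u \<le> s * u" using s5 u0 by (intro mult_right_mono) auto
            then show ?thesis using cVC d_u u0 by linarith
          qed
          ultimately show "defect_const r * x * (2 * d) \<le> card (V - C)" unfolding K0_def by simp
        qed
        then have "colourable (C \<union> (V - C)) (1 + (10 ^ 27 + k + r))"
          by (rule colourable_Un[OF colourable_indep[OF C(2)]])
        then show ?thesis by (rule colourable_mono) auto
      next
        fix J :: "'a set" and I
        assume J: "finite J" "card J = Suc r - 2"
          "\<And>j. j \<in> J \<Longrightarrow> I j \<subseteq> V \<and> indep (I j) \<and> 2 * u - 50 * e \<le> card (I j)"
          "\<And>i j. i \<in> J \<Longrightarrow> j \<in> J \<Longrightarrow> i \<noteq> j \<Longrightarrow> I i \<inter> I j = {}"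
        have xb: "x * (20000 * (real (Suc r) * e)) \<le> u"
          using big unfolding e_def by (simp add: power2_eq_square mult_ac)
        have "colourable V (10 ^ 27 + k + (Suc r - 1))"
          by (rule colourable_near_multipartite[OF J g(1,2) xb])
        then show ?thesis by (rule colourable_mono) auto
      qed
    qed
qed

section \<open>Edge sets, the choice of parameters and the theorem\<close>

lemma sgraph_adjacency: "sgraph (\<lambda>u v. u \<noteq> v \<and> {u, v} \<in> E)"
  by unfold_locales (auto simp: insert_commute)

lemma degree_eq:
  assumes "simple_graph V E" "v \<in> V"
  shows "degree E v = card {w\<in>V. v \<noteq> w \<and> {v, w} \<in> E}"
proof -
  have "{e\<in>E. v \<in> e} = (\<lambda>w. {v, w}) ` {w\<in>V. v \<noteq> w \<and> {v, w} \<in> E}"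
  proof
    show "{e\<in>E. v \<in> e} \<subseteq> (\<lambda>w. {v, w}) ` {w\<in>V. v \<noteq> w \<and> {v, w} \<in> E}"
    proof
      fix e assume e: "e \<in> {e\<in>E. v \<in> e}"
      then have "card e = 2" "e \<subseteq> V" using assms(1) unfolding simple_graph_def by auto
      then obtain w where "e = {v, w}" "v \<noteq> w" using e unfolding card_2_iff by auto
      then show "e \<in> (\<lambda>w. {v, w}) ` {w\<in>V. v \<noteq> w \<and> {v, w} \<in> E}" using e \<open>e \<subseteq> V\<close> by auto
    qed
  qed auto
  moreover have "inj_on (\<lambda>w. {v, w}) {w\<in>V. v \<noteq> w \<and> {v, w} \<in> E}"
    by (rule inj_onI) (auto simp: doubleton_eq_iff)
  ultimately show ?thesis unfolding degree_def by (simp add: card_image)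
qed

text \<open>With \<open>\<eta> = n powr -a\<close> the conditions need \<open>a > 1 / k\<close> for
  the number of rounds and \<open>a < \<delta>\<close> for \<open>m\<close> of order
  \<open>n powr a * ln n\<close>. As \<open>k > 1 / \<delta> + 1\<close>, the value
  \<open>a = \<delta> / (1 + \<delta>)\<close> satisfies both.\<close>

lemma eventually_growth_params:
  fixes \<delta> K :: real
  assumes "0 < \<delta>" "0 < K" "1 / \<delta> + 1 < real k"
  shows "eventually (\<lambda>n. growth_params (real n) (real n powr \<delta> / K) k) sequentially"
proof -
  define a where "a = \<delta> / (1 + \<delta>)"
  define b where "b = \<delta> - a"
  have a0: "0 < a" unfolding a_def using assms(1) by simp
  have b0: "0 < b" unfolding b_def a_def using assms(1) by (simp add: field_simps)
  have ka: "1 < a * real k"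
  proof -
    have "1 / \<delta> + 1 = (1 + \<delta>) / \<delta>" using assms(1) by (simp add: add_divide_distrib)
    then have "a * (1 / \<delta> + 1) = 1" unfolding a_def using assms(1) by simp
    then show ?thesis using mult_strict_left_mono[OF assms(3) a0] by simp
  qed
  have "eventually (\<lambda>n::nat. 10 ^ 12 * K * (4 * ln (real n) + 2) \<le> real n powr b) sequentially"
    using b0 by real_asymp
  moreover have "eventually (\<lambda>n::nat. real n powr - a \<le> 1 / 2) sequentially"
    using a0 by real_asymp
  moreover have "eventually (\<lambda>n::nat. 2 \<le> n) sequentially" by (rule eventually_ge_at_top)
  ultimately show ?thesis
  proof eventually_elim
    case (elim n)
    define \<eta> where "\<eta> = real n powr - a"
    have n: "1 < real n" using elim(3) by simp
    have \<eta>: "0 < \<eta>" "\<eta> \<le> 1 / 2" unfolding \<eta>_def using elim n by simp_all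
    have \<eta>n: "\<eta> * real n powr a = 1" unfolding \<eta>_def using n by (simp flip: powr_add)
    \<comment> \<open>From \<open>\<eta> \<le> 1/2\<close> follows
      \<open>ln (1 + \<eta>) \<ge> \<eta> / 2\<close>, so the factor 4 gives
      \<open>m * ln (1 + \<eta>) \<ge> 2 * ln n\<close>.\<close>
    define m where "m = nat \<lceil>4 * real n powr a * ln (real n)\<rceil>"
    have ln0: "0 < ln (real n)" using n by simp
    have pa: "1 \<le> real n powr a" using n a0 by (simp add: ge_one_powr_ge_zero)
    have nn: "0 \<le> 4 * real n powr a * ln (real n)" using ln0 by simp
    have m: "4 * real n powr a * ln (real n) \<le> real m" "real m \<le> 4 * real n powr a * ln (real n) + 1"
      unfolding m_def using nn by linarith+
    have "\<eta> / 2 \<le> ln (1 + \<eta>)"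
    proof -
      have "\<eta> - \<eta>\<^sup>2 \<le> ln (1 + \<eta>)" using \<eta> by (intro ln_one_plus_pos_lower_bound) auto
      moreover have "\<eta>\<^sup>2 \<le> \<eta> * (1 / 2)" unfolding power2_eq_square using \<eta> by (intro mult_left_mono) auto
      ultimately show ?thesis by simp
    qed
    then have "real m * (\<eta> / 2) \<le> real m * ln (1 + \<eta>)" by (intro mult_left_mono) auto
    moreover have "4 * real n powr a * ln (real n) * (\<eta> / 2) \<le> real m * (\<eta> / 2)"
      using m(1) \<eta> by (intro mult_right_mono) auto
    moreover have "4 * real n powr a * ln (real n) * (\<eta> / 2) = 2 * ln (real n)"
    proof -
      have "4 * real n powr a * ln (real n) * (\<eta> / 2) = 2 * (\<eta> * real n powr a) * ln (real n)" by simp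
      then show ?thesis unfolding \<eta>n by simp
    qed
    ultimately have "ln (real n) < real m * ln (1 + \<eta>)" using ln0 by linarith
    also have "\<dots> = ln ((1 + \<eta>) ^ m)" using \<eta> by (simp add: ln_realpow)
    finally have 1: "real n < (1 + \<eta>) ^ m" using n \<eta> by simp
    have "\<eta> ^ k = real n powr (- a * real k)" unfolding \<eta>_def using n by (simp add: powr_powr flip: powr_realpow)
    then have "\<eta> ^ k * real n = real n powr (- a * real k) * real n powr 1" using n by simp
    also have "\<dots> = real n powr (1 - a * real k)" by (subst powr_add[symmetric]) simp
    also have "\<dots> < real n powr 0" using n ka by (intro powr_less_mono) auto
    finally have 2: "\<eta> ^ k * real n < 1" using n by simp
    have "10 ^ 12 * (real m + 1) \<le> 10 ^ 12 * (real n powr a * (4 * ln (real n) + 2))"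
      using m(2) pa by (intro mult_left_mono) (auto simp: algebra_simps)
    also have "\<dots> = (10 ^ 12 * K * (4 * ln (real n) + 2)) * (real n powr a / K)" using assms(2) by simp
    also have "\<dots> \<le> real n powr b * (real n powr a / K)" using elim(1) assms(2) by (intro mult_right_mono) auto
    also have "\<dots> = real n powr \<delta> / K" unfolding b_def by (simp flip: powr_add)
    finally have 3: "10 ^ 12 * (real m + 1) \<le> real n powr \<delta> / K" .
    show ?case unfolding growth_params_def using 1 2 3 \<eta>(1) by blast
  qed
qed

theorem theorem5p2:
  fixes r :: nat and \<delta> \<epsilon> :: real and q :: int
  assumes "r \<ge> 3" and "0 < \<delta>" and "\<delta> < 1" and "\<epsilon> > 0"
    and "q = \<lceil>(1 + \<epsilon>) * (1 - \<delta>) / \<delta>\<rceil>"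
  shows "\<forall>\<^sub>F n in sequentially. \<forall>(V :: 'a set) (E :: 'a set set).
    simple_graph V E \<and> card V = n \<and> maximal_K_free r V E \<and>
    real (min_degree V E) \<ge> (2 * real r - 5) / (2 * real r - 3) * real n - real n powr (1 - \<delta>)
    \<longrightarrow> int (chromatic_number V E) \<le> 10 ^ 391 + (int r - 2) + q"
proof -
  have q: "(1 + \<epsilon>) * (1 - \<delta>) / \<delta> \<le> q" unfolding assms(5) by (rule le_of_int_ceiling)
  have pos: "0 < (1 - \<delta>) / \<delta>" using assms(2,3) by simp
  have "(1 + \<epsilon>) * (1 - \<delta>) / \<delta> = (1 - \<delta>) / \<delta> + \<epsilon> * ((1 - \<delta>) / \<delta>)" by (simp add: distrib_right add_divide_distrib)
  moreover have "0 < \<epsilon> * ((1 - \<delta>) / \<delta>)" using assms(4) pos by (rule mult_pos_pos)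
  ultimately have q1: "(1 - \<delta>) / \<delta> < q" using q by linarith
  then have "0 < real_of_int q" using pos by linarith
  then have q0: "0 < q" by simp
  \<comment> \<open>\<open>\<epsilon> > 0\<close> makes \<open>q > 1 / \<delta> - 1\<close> strict,
    so two more rounds exceed the required \<open>1 / \<delta> + 1\<close>.\<close>
  define k where "k = nat (q + 2)"
  have kq: "int k = q + 2" unfolding k_def using q0 by simp
  then have "real k = real_of_int (q + 2)" by (metis of_int_of_nat_eq)
  then have k: "1 / \<delta> + 1 < real k" using q1 assms(2) by (simp add: diff_divide_distrib)
  define K where "K = defect_const r"
  have K0: "0 < K" unfolding K_def by (rule defect_const_pos)
  have "eventually (\<lambda>n::nat. 1 \<le> n) sequentially" by (rule eventually_ge_at_top)
  with eventually_growth_params[OF assms(2) K0 k] show ?thesis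
  proof eventually_elim
    case (elim n)
    show ?case
    proof (intro allI impI)
      fix V :: "'a set" and E :: "'a set set"
      assume "simple_graph V E \<and> card V = n \<and> maximal_K_free r V E \<and>
        (2 * real r - 5) / (2 * real r - 3) * real n - real n powr (1 - \<delta>) \<le> real (min_degree V E)"
      then have G: "simple_graph V E" "card V = n" "K_free r V E"
        and md: "(2 * real r - 5) / (2 * real r - 3) * real n - real n powr (1 - \<delta>) \<le> min_degree V E"
        unfolding maximal_K_free_def by auto
      have fin: "finite V" and E2: "\<And>e. e \<in> E \<Longrightarrow> card e = 2" using G(1) unfolding simple_graph_def by auto
      define A where "A u v \<longleftrightarrow> u \<noteq> v \<and> {u, v} \<in> E" for u v
      have "sgraph A" unfolding A_def by (rule sgraph_adjacency)
      then interpret sgraph A .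
      have "colourable V (10 ^ 27 + k + r)"
      proof (rule colourable_clique_free[of r V "real n powr (1 - \<delta>)" "real n" "real n powr \<delta> / K"])
        show "3 \<le> r" "finite V" by (rule assms(1), rule fin)
        show "card L \<noteq> r" if "L \<subseteq> V" "clique L" for L
          using G(3) that unfolding K_free_def contains_K_def clique_def A_def by blast
        show "card {w\<in>V. \<not> A v w} \<le> 2 * card V / (2 * real r - 3) + real n powr (1 - \<delta>)" if v: "v \<in> V" for v
        proof -
          have "min_degree V E \<le> degree E v" unfolding min_degree_def using fin v by (intro Min_le) auto
          also have "degree E v = card (nb V v)" using degree_eq[OF G(1) v] unfolding nb_def A_def .
          finally have "(2 * real r - 5) / (2 * real r - 3) * real n - real n powr (1 - \<delta>) \<le> card (nb V v)"
            using md by linarith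
          moreover have "card {w\<in>V. \<not> A v w} + card (nb V v) = card V" using card_nonnbs[OF fin] .
          moreover have "(2 * real r - 5) / (2 * real r - 3) * real n = n - 2 * real n / (2 * real r - 3)"
            using assms(1) by (simp add: field_simps)
          moreover have "2 * card V / (2 * real r - 3) = 2 * real n / (2 * real r - 3)" using G(2) by simp
          ultimately show ?thesis using G(2) by linarith
        qed
        show "0 \<le> real n powr (1 - \<delta>)" by simp
        show "growth_params (real n) (real n powr \<delta> / K) k" by (rule elim(1))
        show "real (card V) \<le> real n" using G(2) by simp
        \<comment> \<open>The growth parameter times the defect is exactly \<open>n / K\<close>, so
          the condition with \<open>defect_const\<close> holds with equality.\<close>
        have "real n powr \<delta> * real n powr (1 - \<delta>) = real n" using elim(2) by (simp flip: powr_add)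
        then show "defect_const r * (real n powr \<delta> / K) * real n powr (1 - \<delta>) \<le> real (card V)"
          using G(2) K0 unfolding K_def by simp
      qed
      then obtain c :: "'a \<Rightarrow> nat" where c: "\<forall>v\<in>V. c v < 10 ^ 27 + k + r" "\<forall>u\<in>V. \<forall>v\<in>V. A u v \<longrightarrow> c u \<noteq> c v"
        unfolding colourable_def by blast
      have "proper_colouring V E (10 ^ 27 + k + r) c"
        unfolding proper_colouring_def
      proof (intro conjI ballI impI)
        fix u v assume uv: "u \<in> V" "v \<in> V" "{u, v} \<in> E"
        then have "u \<noteq> v" using E2[of "{u, v}"] by auto
        then show "c u \<noteq> c v" using c(2) uv unfolding A_def by blast
      qed (use c(1) in blast)
      then have "chromatic_number V E \<le> 10 ^ 27 + k + r" unfolding chromatic_number_def by (intro Least_le exI)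
      then have "int (chromatic_number V E) \<le> int (10 ^ 27 + k + r)" by (rule of_nat_mono)
      also have "\<dots> = 10 ^ 27 + (q + 2) + int r" using kq by simp
      also have "\<dots> \<le> 10 ^ 391 + (int r - 2) + q" by simp
      finally show "int (chromatic_number V E) \<le> 10 ^ 391 + (int r - 2) + q" .
    qed
  qed
qed

end
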